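(* For a sequence $\mathbf a=(a_n)_{n\ge1}$ in one of the spaces $\ell^1_r(\mathbb N)$ put $\alpha(\mathbf a)=\sup_{n\ge1}|a_n|^{1/n}$. (1) For even potentials $\mathcal V(x)=\frac{x^2}2-\sum_{n\ge1}\frac{a_{2n}x^{2n}}{2n}$: if $\alpha(\mathbf a)<\sqrt8$, then the planar limit $\mathcal F_0^{\mathrm{ev}}(\mathbf a)$ is absolutely convergent as a power series in infinitely many variables. In particular $\mathcal F_0^{\mathrm{ev}}$ is analytic on $B^{\mathrm{ev}}_{1/\sqrt8}$. (2) For potentials $\mathcal V(x)=\frac{x^2}2-\sum_{n\ge1}\frac{a_nx^n}{n}$: if $\alpha(\mathbf a)<\sqrt{12}$, then $\mathcal F_0(\mathbf a)$ is an absolutely convergent series in infinitely many variables. In particular $\mathcal F_0$ is analytic on $B_{1/\sqrt{12}}$.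
   Context: Formal planar limit: let $\mathcal A=\mathbb Q[[a_1,a_2,\dots]]$ and let $\mathcal H_N$ be the space of $N\times N$ Hermitian matrices. Put $$\mathcal Z=\frac{\int_{\mathcal H_N}\exp\big(-N\,\mathrm{Tr}(M^2/2)+N\sum_{n\ge1}\frac{a_n}{n}\mathrm{Tr}(M^n)\big)dM}{\int_{\mathcal H_N}\exp(-N\,\mathrm{Tr}(M^2/2))\,dM},$$ expanded in powers of the $a_n$ and integrated coefficientwise against the Gaussian. Then $\log\mathcal Z=\sum_{g\ge0}N^{2-2g}\mathcal F_g$ with $\mathcal F_g\in\mathcal A$; $\mathcal F_0\in\mathcal A$ is the formal planar limit, and $\mathcal F_0^{\mathrm{ev}}$ is the planar limit for even potentials, i.e. $\mathcal F_0$ with all odd-indexed variables set to $0$. $\mathcal F_0(\mathbf a)$ denotes the series evaluated at the sequence $\mathbf a$. For $r>0$, $\ell^1_r(\mathbb N)$ is the space of complex sequences with $\|\mathbf a\|_r=\sum_{n\ge1}|a_n|r^n<\infty$, and $\ell^1_r(2\mathbb N)$ is its subspace of sequences with $a_{2n-1}=0$ for all $n\ge1$; $B_r$ and $B_r^{\mathrm{ev}}$ are the open balls of radius $1$ centred at $0$ in $\ell^1_r(\mathbb N)$ and $\ell^1_r(2\mathbb N)$ respectively. Analytic essentially means that the Taylor series in the infinitely many variables $a_n$ converges.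
   Formalization: The printed constants are inverted: a with only a_2=2 is a counterexample, since F_0=-(1/2)log(1-a_2). What is proved: convergence for alpha(a)<1/sqrt8 (even) and alpha(a)<1/sqrt12, and analyticity on the balls B^ev_{sqrt8} and B_{sqrt12}. *)

theory Defs
  imports
    "HOL-Analysis.Analysis"
    "HOL-Library.Poly_Mapping"
    "Jordan_Normal_Form.Matrix"
begin

section \<open>Formal power series in infinitely many variables\<close>

text \<open>
  A multi-index is a finitely supported map \<open>m\<close>, standing for the monomial
  \<open>\<Prod>n. a\<^sub>n ^ m n\<close>; a formal power series is the family of its coefficients.
  The variables are \<open>a\<^sub>1, a\<^sub>2, \<dots>\<close>: the index \<open>0\<close> exists in the type but never occurs in
  the series below with a nonzero coefficient.
\<close>

type_synonym midx = "nat \<Rightarrow>\<^sub>0 nat"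
type_synonym 'a mps = "midx \<Rightarrow> 'a"

definition mdeg :: "midx \<Rightarrow> nat" where
  "mdeg m = (\<Sum>n\<in>Poly_Mapping.keys m. Poly_Mapping.lookup m n)"

definition mps_one :: "complex mps" where
  "mps_one m = (if m = 0 then 1 else 0)"

definition mps_mult :: "complex mps \<Rightarrow> complex mps \<Rightarrow> complex mps" where
  "mps_mult f g m = (\<Sum>(p, q) \<in> {(p, q). p + q = m}. f p * g q)"

definition mps_power :: "complex mps \<Rightarrow> nat \<Rightarrow> complex mps" where
  "mps_power f k = (mps_mult f ^^ k) mps_one"

text \<open>
  Exponential of a series with constant term \<open>0\<close> and logarithm of a series with constant
  term \<open>1\<close>. The sums over \<open>k\<close> are cut off at the degree of the monomial because the \<open>k\<close>-th
  power of a series with constant term \<open>0\<close> has no monomials of degree less than \<open>k\<close>.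
\<close>

definition mps_exp :: "complex mps \<Rightarrow> complex mps" where
  "mps_exp f m = (\<Sum>k\<le>mdeg m. mps_power f k m / fact k)"

definition mps_log :: "complex mps \<Rightarrow> complex mps" where
  "mps_log f m =
     (\<Sum>k = 1..mdeg m. (- 1) ^ (k + 1) / of_nat k * mps_power (\<lambda>p. f p - mps_one p) k m)"


section \<open>The matrix integral and the formal planar limit\<close>

definition mtrace :: "complex mat \<Rightarrow> complex" where
  "mtrace A = (\<Sum>i<dim_row A. A $$ (i, i))"

text \<open>
  Real coordinates on the space of Hermitian \<open>N \<times> N\<close> matrices: \<open>x (i, i)\<close> is the diagonal
  entry, and for \<open>i < j\<close> the entry at \<open>(i, j)\<close> has real part \<open>x (i, j)\<close> and imaginary part
  \<open>x (j, i)\<close>. Lebesgue measure \<open>dM\<close> is the product measure in these coordinates.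
\<close>

definition herm_mat :: "nat \<Rightarrow> (nat \<times> nat \<Rightarrow> real) \<Rightarrow> complex mat" where
  "herm_mat N x = mat N N (\<lambda>(i, j).
     if i = j then complex_of_real (x (i, i))
     else if i < j then Complex (x (i, j)) (x (j, i))
     else Complex (x (j, i)) (- x (i, j)))"

definition herm_integral :: "nat \<Rightarrow> (complex mat \<Rightarrow> complex) \<Rightarrow> complex" where
  "herm_integral N f =
     (\<integral>x. f (herm_mat N x) \<partial>(\<Pi>\<^sub>M p \<in> {..<N} \<times> {..<N}. (lborel :: real measure)))"

definition gauss_weight :: "nat \<Rightarrow> complex mat \<Rightarrow> complex" where
  "gauss_weight N M = exp (- of_nat N * (mtrace (M ^\<^sub>m 2) / 2))"

text \<open>The formal series \<open>N * (\<Sum>n\<ge>1. a\<^sub>n / n * Tr (M ^ n))\<close> in the variables \<open>a\<^sub>n\<close>.\<close>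

definition interaction :: "nat \<Rightarrow> complex mat \<Rightarrow> complex mps" where
  "interaction N M m =
     (\<Sum>n \<in> {n \<in> Poly_Mapping.keys m. 1 \<le> n \<and> m = Poly_Mapping.single n 1}.
        of_nat N / of_nat n * mtrace (M ^\<^sub>m n))"

definition partition_series :: "nat \<Rightarrow> complex mps" where
  "partition_series N m =
     herm_integral N (\<lambda>M. mps_exp (interaction N M) m * gauss_weight N M)
       / herm_integral N (gauss_weight N)"

text \<open>
  \<open>log Z = (\<Sum>g\<ge>0. N ^ (2 - 2 g) * F g)\<close> for every matrix size \<open>N \<ge> 1\<close>, coefficientwise: each
  monomial receives contributions from finitely many \<open>g\<close> only. This determines all the
  \<open>F g\<close>.
\<close>

definition genus_expansion :: "(nat \<Rightarrow> rat mps) \<Rightarrow> bool" where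
  "genus_expansion F \<longleftrightarrow>
     (\<forall>m. finite {g. F g m \<noteq> 0} \<and>
          (\<forall>N\<ge>1. mps_log (partition_series N) m =
             (\<Sum>g \<in> {g. F g m \<noteq> 0}. of_nat N powi (2 - 2 * int g) * of_rat (F g m))))"

definition genus_series :: "nat \<Rightarrow> rat mps" where
  "genus_series = (THE F. genus_expansion F)"

definition planar_limit :: "rat mps" where
  "planar_limit = genus_series 0"

definition planar_limit_even :: "rat mps" where
  "planar_limit_even m = (if \<forall>n\<in>Poly_Mapping.keys m. even n then planar_limit m else 0)"


section \<open>Evaluation, sequence spaces and analyticity\<close>

definition monom_at :: "(nat \<Rightarrow> complex) \<Rightarrow> midx \<Rightarrow> complex" where
  "monom_at a m = (\<Prod>n\<in>Poly_Mapping.keys m. a n ^ Poly_Mapping.lookup m n)"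

definition abs_convergent_at :: "complex mps \<Rightarrow> (nat \<Rightarrow> complex) \<Rightarrow> bool" where
  "abs_convergent_at F a \<longleftrightarrow> (\<lambda>m. cmod (F m * monom_at a m)) summable_on UNIV"

definition mps_eval :: "complex mps \<Rightarrow> (nat \<Rightarrow> complex) \<Rightarrow> complex" where
  "mps_eval F a = infsum (\<lambda>m. F m * monom_at a m) UNIV"

definition rat_mps :: "rat mps \<Rightarrow> complex mps" where
  "rat_mps F m = of_rat (F m)"

text \<open>Sequences \<open>(a\<^sub>n)\<close>, \<open>n \<ge> 1\<close>, are functions on \<open>nat\<close> normalised by \<open>a 0 = 0\<close>.\<close>

definition ell1 :: "real \<Rightarrow> (nat \<Rightarrow> complex) set" where
  "ell1 r = {a. a 0 = 0 \<and> summable (\<lambda>n. cmod (a n) * r ^ n)}"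

definition ell1_even :: "real \<Rightarrow> (nat \<Rightarrow> complex) set" where
  "ell1_even r = {a \<in> ell1 r. \<forall>n\<ge>1. a (2 * n - 1) = 0}"

definition ell1_norm :: "real \<Rightarrow> (nat \<Rightarrow> complex) \<Rightarrow> real" where
  "ell1_norm r a = suminf (\<lambda>n. cmod (a n) * r ^ n)"

definition unit_ball :: "real \<Rightarrow> (nat \<Rightarrow> complex) set" where
  "unit_ball r = {a \<in> ell1 r. ell1_norm r a < 1}"

definition unit_ball_even :: "real \<Rightarrow> (nat \<Rightarrow> complex) set" where
  "unit_ball_even r = {a \<in> ell1_even r. ell1_norm r a < 1}"

text \<open>
  For \<open>r > 0\<close>, \<open>alpha a \<le> 1 / r\<close> says that \<open>cmod (a n) * r ^ n \<le> 1\<close> for all \<open>n \<ge> 1\<close>, which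
  holds throughout \<open>unit_ball r\<close>. A convergence domain for the planar limit has to force
  \<open>cmod (a 2) < 1\<close>, since its part in \<open>a 2\<close> alone is \<open>- ln (1 - a 2) / 2\<close>; so the bounds on
  \<open>alpha\<close> are smaller than \<open>1\<close>, and the radii of the matching balls are their reciprocals.
\<close>

definition alpha :: "(nat \<Rightarrow> complex) \<Rightarrow> real" where
  "alpha a = (SUP n\<in>{1..}. root n (cmod (a n)))"

text \<open>
  A function is analytic on an open set \<open>U\<close> (of \<open>ell1 r\<close> or of \<open>ell1_even r\<close>) if
  around every point of \<open>U\<close> it is the sum of an absolutely convergent power series
  in the infinitely many coordinates.
\<close>

definition analytic_fun_on ::
    "real \<Rightarrow> ((nat \<Rightarrow> complex) \<Rightarrow> complex) \<Rightarrow> (nat \<Rightarrow> complex) set \<Rightarrow> bool" where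
  "analytic_fun_on r f U \<longleftrightarrow>
     (\<forall>a\<in>U. \<exists>\<delta>>0. \<exists>G. \<forall>b\<in>U. ell1_norm r (\<lambda>n. b n - a n) < \<delta> \<longrightarrow>
        abs_convergent_at G (\<lambda>n. b n - a n) \<and> f b = mps_eval G (\<lambda>n. b n - a n))"

text \<open>
  A formal series is analytic on \<open>U\<close> if it converges absolutely at every point of \<open>U\<close>
  and its sum is an analytic function there.
\<close>

definition analytic_series_on :: "real \<Rightarrow> complex mps \<Rightarrow> (nat \<Rightarrow> complex) set \<Rightarrow> bool" where
  "analytic_series_on r F U \<longleftrightarrow>
     (\<forall>a\<in>U. abs_convergent_at F a) \<and> analytic_fun_on r (mps_eval F) U"

end

(*
  Gaussian integration by parts turns log Z into a recursion for its derivatives V_n = (n / N^2) d/da_n log Z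
  (the loop equation)
    V_n = sum_{j+l=n-2} (V_j V_l + (l / N^2) d/da_l V_j) + sum_{p>=1} a_p V_{n+p-2},   V_0 = 1.
  By induction on n plus the weighted degree, every coefficient of V_n is a rational polynomial in 1 / N^2;
  this is the genus expansion.  Its value at 1 / N = 0 solves Tutte's recursion, which lacks the derivative
  term.  All coefficients of the planar solution are nonnegative, so at |a_p| <= b_p it is dominated by any
  numerical h with h_n >= sum_{j+l=n-2} h_j h_l + sum_p b_p h_{n+p-2}, and F_0 is dominated by the planar
  V_2.  For b_p = 12^(-p/2), and for b_p = 8^(-p/2) on even p, the recursion is at its critical point: the
  discriminant of the quadratic equation for the generating function of h has a triple root, and h can be
  written down explicitly.  Since these b_p bound |a_p| on the closed unit balls, absolute convergence there
  and re-expansion around each centre give analyticity.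
*)

theory Submission
  imports Defs "HOL-Probability.Distributions"
begin

text \<open>The numerical recursion for h is not well-founded: through the sum over p, h_n refers to
  all larger indices. With b_p = y^(-p), h_n = y^n c_n and K = y^2 that sum becomes S - (c_0 + ... +
  c_(n-2)), where S is the total of all c_i. Treating S as a parameter, C = sum c_n x^n satisfies
  x^2 (1 - x) C^2 - (K (1 - x) + x^2) C + K - (K - S) x = 0. The discriminant is a quartic in x with
  parameters K and S; it has a triple root at K = 12, S = 4/3. For even potentials, with x marking
  steps of two in n, it is a cubic, and K = 8, S = 5/4 make it the cube (4 - 3 x)^3. S is only a
  guess for the sum of the c_n and has to be confirmed afterwards. The coefficients of the square
  root of the discriminant are nonnegative from some index on and geometrically small, and c_n is a
  multiple of their tail. So the c_n are nonnegative and summable, and the recursion itself then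
  forces the remainders S - (c_0 + ... + c_n) to decrease to 0. The supersolution inequality uses
  only that they are nonnegative.\<close>

lemma finite_midx_below: "finite {p :: midx. \<forall>n. Poly_Mapping.lookup p n \<le> Poly_Mapping.lookup m n}"
proof -
  let ?K = "Poly_Mapping.keys m"
  let ?S = "{p :: midx. \<forall>n. Poly_Mapping.lookup p n \<le> Poly_Mapping.lookup m n}"
  let ?r = "\<lambda>p :: midx. restrict (Poly_Mapping.lookup p) ?K"
  have "?r ` ?S \<subseteq> (\<Pi>\<^sub>E n\<in>?K. {..Poly_Mapping.lookup m n})"
    by auto
  then have "finite (?r ` ?S)"
    by (rule finite_subset) (intro finite_PiE, auto)
  moreover have "inj_on ?r ?S"
  proof (rule inj_onI, rule poly_mapping_eqI)
    fix p q n assume pq: "p \<in> ?S" "q \<in> ?S" "?r p = ?r q"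
    show "Poly_Mapping.lookup p n = Poly_Mapping.lookup q n"
    proof (cases "n \<in> ?K")
      case True then show ?thesis using fun_cong[OF pq(3), of n] by simp
    next
      case False
      then have "Poly_Mapping.lookup m n = 0" by (simp add: in_keys_iff)
      then show ?thesis using pq(1,2) by (metis (mono_tags, lifting) le_zero_eq mem_Collect_eq)
    qed
  qed
  ultimately show ?thesis using finite_imageD by blast
qed

lemma finite_midx_splits: "finite {(p :: midx, q). p + q = m}"
proof -
  let ?B = "{p :: midx. \<forall>n. Poly_Mapping.lookup p n \<le> Poly_Mapping.lookup m n}"
  have "{(p, q). p + q = m} \<subseteq> ?B \<times> ?B"
    by (auto simp: lookup_add)
  then show ?thesis
    using finite_midx_below[of m] by (meson finite_SigmaI finite_subset)
qed

section \<open>Unit multi-indices, supports and the total degree\<close>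

definition unit_midx :: "nat \<Rightarrow> midx" where
  "unit_midx n = Poly_Mapping.single n 1"

lemma lookup_unit_midx: "Poly_Mapping.lookup (unit_midx n) k = (if n = k then 1 else 0)"
  by (simp add: unit_midx_def lookup_single when_def)

lemma keys_unit_midx [simp]: "Poly_Mapping.keys (unit_midx n) = {n}"
  by (simp add: unit_midx_def)

text \<open>Subtraction of multi-indices truncates at 0 in each variable, so subtracting a unit and
  adding it back loses nothing only when \<open>n\<close> occurs in \<open>m\<close>.\<close>

lemma midx_add_diff_unit:
  fixes m :: midx
  assumes "n \<in> Poly_Mapping.keys m"
  shows "m - unit_midx n + unit_midx n = m"
  using assms by (intro poly_mapping_eqI) (auto simp: lookup_add lookup_minus lookup_unit_midx in_keys_iff)

lemma midx_split_unit:
  fixes p q m :: midx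
  assumes "n \<in> Poly_Mapping.keys p"
  shows "p + q = m + unit_midx n \<longleftrightarrow> (p - unit_midx n) + q = m"
proof -
  have "p + q = (p - unit_midx n + unit_midx n) + q"
    using midx_add_diff_unit[OF assms] by simp
  also have "\<dots> = (p - unit_midx n + q) + unit_midx n"
    by (simp add: add_ac)
  finally show ?thesis by simp
qed

lemma keys_midx_add: "Poly_Mapping.keys (p + q :: midx) = Poly_Mapping.keys p \<union> Poly_Mapping.keys q"
  by (auto simp: in_keys_iff lookup_add)

lemma mdeg_eq_sum:
  assumes "finite S" "Poly_Mapping.keys m \<subseteq> S"
  shows "mdeg m = (\<Sum>n\<in>S. Poly_Mapping.lookup m n)"
  unfolding mdeg_def using assms by (intro sum.mono_neutral_left) (auto simp: in_keys_iff)

lemma mdeg_add: "mdeg (p + q) = mdeg p + mdeg q"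
proof -
  let ?S = "Poly_Mapping.keys p \<union> Poly_Mapping.keys q"
  have "mdeg (p + q) = (\<Sum>n\<in>?S. Poly_Mapping.lookup (p + q) n)"
    by (rule mdeg_eq_sum) (auto simp: keys_midx_add)
  also have "\<dots> = mdeg p + mdeg q"
    by (subst (1 2) mdeg_eq_sum[where S = ?S]) (auto simp: lookup_add sum.distrib)
  finally show ?thesis .
qed

lemma mdeg_0 [simp]: "mdeg 0 = 0"
  by (simp add: mdeg_def)

lemma mdeg_unit [simp]: "mdeg (unit_midx n) = 1"
  by (simp add: mdeg_def lookup_unit_midx)

lemma mdeg_eq_0_iff [simp]: "mdeg m = 0 \<longleftrightarrow> m = 0"
  by (auto simp: mdeg_def in_keys_iff intro!: poly_mapping_eqI)

text \<open>Removing one unit from a nonzero multi-index lowers \<open>mdeg\<close> by one. The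
  shape of the step matches \<open>vertex_poly_add_unit\<close>, the recursion by which the
  exponentiated interaction is differentiated.\<close>

lemma midx_unit_induct [case_names zero add_unit]:
  fixes m :: midx
  assumes "P 0" and step: "\<And>m n. P m \<Longrightarrow> P (m + unit_midx n)"
  shows "P m"
proof (induction "mdeg m" arbitrary: m)
  case 0 then show ?case using assms(1) by simp
next
  case (Suc k)
  then have "m \<noteq> 0" by auto
  then obtain n where n: "n \<in> Poly_Mapping.keys m" by (metis ex_in_conv keys_eq_empty)
  have "mdeg (m - unit_midx n + unit_midx n) = Suc k"
    using Suc(2) midx_add_diff_unit[OF n] by simp
  then have "mdeg (m - unit_midx n) = k" by (simp add: mdeg_add)
  then show ?case using Suc(1)[of "m - unit_midx n"] step midx_add_diff_unit[OF n] by metis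
qed

section \<open>The ring of formal series\<close>

text \<open>A type of its own, because \<open>complex mps\<close> is a function type: as an instance
  of \<open>comm_ring_1\<close> the series acquire powers, geometric sums and
  \<open>algebra_simps\<close>.\<close>

typedef ser = "UNIV :: complex mps set" morphisms coef Ser ..

lemma coef_Ser [simp]: "coef (Ser f) = f"
  by (simp add: Ser_inverse)

lemma ser_eqI: "(\<And>m. coef f m = coef g m) \<Longrightarrow> f = g"
  using coef_inject by blast

instantiation ser :: comm_ring_1
begin

definition "0 = Ser (\<lambda>_. 0)"
definition "1 = Ser mps_one"
definition "f + g = Ser (\<lambda>m. coef f m + coef g m)"
definition "- f = Ser (\<lambda>m. - coef f m)"
definition "(f :: ser) - g = Ser (\<lambda>m. coef f m - coef g m)"
definition "f * g = Ser (mps_mult (coef f) (coef g))"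

text \<open>Both sides sum over the decompositions of \<open>m\<close> into three parts; the
  bijection only rebrackets them.\<close>

lemma mps_mult_assoc: "mps_mult (mps_mult f g) h = mps_mult f (mps_mult g h)"
proof
  fix m :: midx
  let ?S = "\<lambda>m :: midx. {(p, q). p + q = m}"
  have "mps_mult (mps_mult f g) h m = (\<Sum>z\<in>?S m. \<Sum>y\<in>?S (fst z). f (fst y) * g (snd y) * h (snd z))"
    by (simp add: mps_mult_def sum_distrib_right case_prod_unfold)
  also have "\<dots> = (\<Sum>(z, y)\<in>Sigma (?S m) (\<lambda>z. ?S (fst z)). f (fst y) * g (snd y) * h (snd z))"
    by (rule sum.Sigma) (auto simp: finite_midx_splits)
  also have "\<dots> = (\<Sum>(z, y)\<in>Sigma (?S m) (\<lambda>z. ?S (snd z)). f (fst z) * (g (fst y) * h (snd y)))"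
    by (rule sum.reindex_bij_witness[where
          j = "\<lambda>((p, r), (s, t)). ((s, t + r), (t, r))" and
          i = "\<lambda>((p, r), (s, t)). ((p + s, t), (p, s))"]) (auto simp: add.assoc mult.assoc)
  also have "\<dots> = (\<Sum>z\<in>?S m. \<Sum>y\<in>?S (snd z). f (fst z) * (g (fst y) * h (snd y)))"
    by (rule sum.Sigma[symmetric]) (auto simp: finite_midx_splits)
  also have "\<dots> = mps_mult f (mps_mult g h) m"
    by (simp add: mps_mult_def sum_distrib_left case_prod_unfold)
  finally show "mps_mult (mps_mult f g) h m = mps_mult f (mps_mult g h) m" .
qed

lemma mps_mult_comm: "mps_mult f g = mps_mult g f"
  by (rule ext, unfold mps_mult_def, rule sum.reindex_bij_witness[where i = prod.swap and j = prod.swap])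
     (auto simp: add.commute mult.commute)

lemma mps_one_mult: "mps_mult mps_one f = f"
proof
  fix m
  have "mps_mult mps_one f m = (\<Sum>(p, q)\<in>{(0, m)}. mps_one p * f q)"
    unfolding mps_mult_def
    by (rule sum.mono_neutral_right) (auto simp: finite_midx_splits mps_one_def split: if_splits)
  then show "mps_mult mps_one f m = f m" by (simp add: mps_one_def)
qed

lemma mps_mult_add_left: "mps_mult (\<lambda>m. f m + g m) h = (\<lambda>m. mps_mult f h m + mps_mult g h m)"
  by (auto simp: mps_mult_def fun_eq_iff sum.distrib[symmetric] case_prod_unfold distrib_right intro!: sum.cong)

instance
proof
  fix f g h :: ser
  show "f * g * h = f * (g * h)" by (simp add: times_ser_def mps_mult_assoc)
  show "f * g = g * f" by (simp add: times_ser_def mps_mult_comm)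
  show "1 * f = f" by (simp add: times_ser_def one_ser_def mps_one_mult coef_inverse)
  show "(f + g) * h = f * h + g * h" by (simp add: times_ser_def plus_ser_def mps_mult_add_left)
  show "(0::ser) \<noteq> 1"
  proof
    assume "(0::ser) = 1"
    then have "coef 0 0 = coef 1 0" by simp
    then show False by (simp add: zero_ser_def one_ser_def mps_one_def)
  qed
qed (auto simp: plus_ser_def minus_ser_def uminus_ser_def zero_ser_def algebra_simps coef_inverse)

end

lemma coef_zero [simp]: "coef 0 m = 0"
  and coef_one: "coef 1 m = (if m = 0 then 1 else 0)"
  and coef_add [simp]: "coef (f + g) m = coef f m + coef g m"
  and coef_uminus [simp]: "coef (- f) m = - coef f m"
  and coef_diff [simp]: "coef (f - g) m = coef f m - coef g m"
  and coef_mult: "coef (f * g) m = (\<Sum>(p, q) \<in> {(p, q). p + q = m}. coef f p * coef g q)"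
  by (simp_all add: zero_ser_def one_ser_def plus_ser_def uminus_ser_def minus_ser_def
      times_ser_def mps_one_def mps_mult_def)

lemma coef_sum [simp]: "coef (sum f A) m = (\<Sum>i\<in>A. coef (f i) m)"
  by (induction A rule: infinite_finite_induct) auto

lemma coef_mult_0 [simp]: "coef (f * g) 0 = coef f 0 * coef g 0"
proof -
  have "{(p :: midx, q). p + q = 0} = {(0, 0)}"
  proof safe
    fix p q :: midx assume "p + q = 0"
    then have "mdeg p + mdeg q = 0" by (metis mdeg_add mdeg_0)
    then show "p = 0" "q = 0" by auto
  qed auto
  then show ?thesis by (simp add: coef_mult)
qed

definition sconst :: "complex \<Rightarrow> ser" where
  "sconst c = Ser (\<lambda>m. if m = 0 then c else 0)"

lemma coef_sconst: "coef (sconst c) m = (if m = 0 then c else 0)"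
  by (simp add: sconst_def)

lemma coef_sconst_mult [simp]: "coef (sconst c * f) m = c * coef f m"
proof -
  have "coef (sconst c * f) m = (\<Sum>(p, q)\<in>{(0, m)}. coef (sconst c) p * coef f q)"
    unfolding coef_mult
    by (rule sum.mono_neutral_right) (auto simp: finite_midx_splits coef_sconst split: if_splits)
  then show ?thesis by (simp add: coef_sconst)
qed

text \<open>Every monomial that occurs in \<open>f\<close> has \<open>mdeg\<close> at least 1, and
  \<open>mdeg\<close> is additive.\<close>

lemma coef_power_eq_0:
  assumes "coef f 0 = 0" "mdeg m < k"
  shows "coef (f ^ k) m = 0"
  using assms(2)
proof (induction k arbitrary: m)
  case (Suc k)
  have "coef f p * coef (f ^ k) q = 0" if "p + q = m" for p q
  proof (cases "p = 0")
    case True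
    then show ?thesis using assms by simp
  next
    case False
    then have "mdeg p \<ge> 1" by (metis One_nat_def Suc_le_eq mdeg_eq_0_iff neq0_conv)
    then have "mdeg q < k" using Suc.prems that by (auto simp: mdeg_add)
    then show ?thesis using Suc.IH by simp
  qed
  then show ?case unfolding power_Suc coef_mult by (intro sum.neutral) auto
qed simp

text \<open>Once \<open>f - g\<close> vanishes in all degrees below that of \<open>m\<close>, only
  the constant term of \<open>z\<close> meets its coefficient at \<open>m\<close>. This permits
  division by the partition function.\<close>

lemma ser_mult_left_cancel:
  assumes "coef z 0 \<noteq> 0" "z * f = z * g"
  shows "f = g"
proof -
  have *: "coef (f - g) m = 0" for m
  proof (induction "mdeg m" arbitrary: m rule: less_induct)
    case less
    have "0 = coef (z * (f - g)) m" using assms(2) by (simp add: right_diff_distrib)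
    also have "\<dots> = (\<Sum>(p, q)\<in>{(0, m)}. coef z p * coef (f - g) q)"
      unfolding coef_mult
    proof (rule sum.mono_neutral_right)
      show "\<forall>i\<in>{(p, q). p + q = m} - {(0, m)}. (case i of (p, q) \<Rightarrow> coef z p * coef (f - g) q) = 0"
      proof
        fix i assume i: "i \<in> {(p, q). p + q = m} - {(0, m)}"
        obtain p q where pq: "i = (p, q)" by fastforce
        with i have "m = p + q" "p \<noteq> 0" by auto
        then have "mdeg q < mdeg m" by (auto simp: mdeg_add zero_less_iff_neq_zero)
        then show "(case i of (p, q) \<Rightarrow> coef z p * coef (f - g) q) = 0"
          using less[of q] pq by simp
      qed
    qed (auto simp: finite_midx_splits)
    finally show ?case using assms(1) by simp
  qed
  show ?thesis by (rule ser_eqI) (use * in simp)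
qed

section \<open>Partial derivatives of series, and of their exponentials and logarithms\<close>

definition sderiv :: "nat \<Rightarrow> ser \<Rightarrow> ser" where
  "sderiv n f = Ser (\<lambda>m. of_nat (Suc (Poly_Mapping.lookup m n)) * coef f (m + unit_midx n))"

lemma coef_sderiv: "coef (sderiv n f) m = of_nat (Suc (Poly_Mapping.lookup m n)) * coef f (m + unit_midx n)"
  by (simp add: sderiv_def)

lemma sderiv_add [simp]: "sderiv n (f + g) = sderiv n f + sderiv n g"
  by (rule ser_eqI) (simp add: coef_sderiv algebra_simps)

lemma sderiv_sconst [simp]: "sderiv n (sconst c) = 0"
proof (rule ser_eqI)
  fix m :: midx
  have "mdeg (m + unit_midx n) \<noteq> 0" by (simp add: mdeg_add)
  then have "m + unit_midx n \<noteq> 0" by fastforce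
  then show "coef (sderiv n (sconst c)) m = coef 0 m" by (simp add: coef_sderiv coef_sconst)
qed

lemma sconst_1 [simp]: "sconst 1 = 1"
  by (rule ser_eqI) (simp add: coef_sconst coef_one)

lemma sderiv_one [simp]: "sderiv n 1 = 0"
  using sderiv_sconst[of n 1] by (simp del: sderiv_sconst)

text \<open>One half of the product rule: the weight kills the splittings in which \<open>p\<close>
  lacks \<open>n\<close>, and in the others one unit is taken off \<open>p\<close>.\<close>

lemma sum_splits_weighted:
  "(\<Sum>(p, q)\<in>{(p, q). p + q = m + unit_midx n}. of_nat (Poly_Mapping.lookup p n) * (f p * g q)) =
   (\<Sum>(p, q)\<in>{(p, q). p + q = m}. of_nat (Suc (Poly_Mapping.lookup p n)) * (f (p + unit_midx n) * g q) :: complex)"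
  (is "sum ?F ?A = sum ?G ?B")
proof -
  have "sum ?F ?A = sum ?F {(p, q) \<in> ?A. n \<in> Poly_Mapping.keys p}"
    by (rule sum.mono_neutral_right) (auto simp: finite_midx_splits in_keys_iff)
  also have "\<dots> = sum ?G ?B"
  proof (rule sum.reindex_bij_witness[where i = "\<lambda>(p, q). (p + unit_midx n, q)" and
          j = "\<lambda>(p, q). (p - unit_midx n, q)"], goal_cases)
    case (1 z)
    then show ?case using midx_add_diff_unit by auto
  next
    case (2 z)
    then show ?case using midx_split_unit by auto
  next
    case (3 z)
    then show ?case by auto
  next
    case (4 z)
    then show ?case by (auto simp: keys_midx_add add_ac)
  next
    case (5 z)
    then obtain p q where z: "z = (p, q)" and n: "n \<in> Poly_Mapping.keys p" by auto
    then have "Suc (Poly_Mapping.lookup (p - unit_midx n) n) = Poly_Mapping.lookup p n"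
      by (simp add: lookup_minus lookup_unit_midx in_keys_iff)
    then show ?case using z midx_add_diff_unit[OF n] by (simp del: of_nat_Suc)
  qed
  finally show ?thesis .
qed

lemma sderiv_mult: "sderiv n (f * g) = sderiv n f * g + f * sderiv n g"
proof (rule ser_eqI)
  fix m :: midx
  let ?A = "{(p, q). p + q = m + unit_midx n}"
  have "coef (sderiv n (f * g)) m =
      (\<Sum>(p, q)\<in>?A. of_nat (Suc (Poly_Mapping.lookup m n)) * (coef f p * coef g q))"
    by (simp add: coef_sderiv coef_mult sum_distrib_left case_prod_unfold)
  \<comment> \<open>The exponent of the \<open>n\<close>-th variable in
    \<open>m + unit_midx n\<close> is shared between \<open>p\<close> and \<open>q\<close>; the two
    summands become the two halves of the product rule.\<close>
  also have "\<dots> = (\<Sum>(p, q)\<in>?A. of_nat (Poly_Mapping.lookup p n) * (coef f p * coef g q)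
      + of_nat (Poly_Mapping.lookup q n) * (coef f p * coef g q))"
  proof (rule sum.cong[OF refl], clarify)
    fix p q :: midx assume "p + q = m + unit_midx n"
    then have "Poly_Mapping.lookup p n + Poly_Mapping.lookup q n = Suc (Poly_Mapping.lookup m n)"
      by (metis One_nat_def add.commute add_Suc lookup_add lookup_unit_midx plus_1_eq_Suc)
    then have "of_nat (Suc (Poly_Mapping.lookup m n)) = (of_nat (Poly_Mapping.lookup p n) + of_nat (Poly_Mapping.lookup q n) :: complex)"
      by (metis of_nat_add)
    then show "of_nat (Suc (Poly_Mapping.lookup m n)) * (coef f p * coef g q) = of_nat (Poly_Mapping.lookup p n) * (coef f p * coef g q)
      + of_nat (Poly_Mapping.lookup q n) * (coef f p * coef g q)"
      by (simp only: distrib_right)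
  qed
  also have "\<dots> = (\<Sum>(p, q)\<in>?A. of_nat (Poly_Mapping.lookup p n) * (coef f p * coef g q)) +
      (\<Sum>(p, q)\<in>?A. of_nat (Poly_Mapping.lookup q n) * (coef f p * coef g q))"
    by (simp add: case_prod_unfold sum.distrib)
  also have "(\<Sum>(p, q)\<in>?A. of_nat (Poly_Mapping.lookup q n) * (coef f p * coef g q)) =
      (\<Sum>(p, q)\<in>?A. of_nat (Poly_Mapping.lookup p n) * (coef g p * coef f q))"
    by (rule sum.reindex_bij_witness[where i = prod.swap and j = prod.swap]) (auto simp: add.commute)
  finally show "coef (sderiv n (f * g)) m = coef (sderiv n f * g + f * sderiv n g) m"
    unfolding sum_splits_weighted coef_add mult.commute[of f "sderiv n g"]
    by (simp add: coef_mult coef_sderiv mult.assoc case_prod_unfold)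
qed

lemma sderiv_sconst_mult [simp]: "sderiv n (sconst c * f) = sconst c * sderiv n f"
  by (simp add: sderiv_mult)

lemma sderiv_power: "sderiv n (f ^ Suc k) = sconst (of_nat (Suc k)) * (f ^ k * sderiv n f)"
proof (induction k)
  case (Suc k)
  have "sconst (of_nat (Suc (Suc k))) = 1 + sconst (of_nat (Suc k))"
    by (rule ser_eqI) (simp add: coef_sconst coef_one)
  then show ?case
    unfolding power_Suc[of f "Suc k"] sderiv_mult Suc by (simp add: algebra_simps)
qed simp

lemma mps_power_coef: "mps_power (coef f) k = coef (f ^ k)"
  by (induction k) (simp_all add: mps_power_def one_ser_def times_ser_def)

lemma sconst_mult_sconst: "sconst a * (sconst b * f) = sconst (a * b) * f"
  by (rule ser_eqI) simp

text \<open>By additivity of \<open>mdeg\<close>, a product does not look beyond the degree of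
  \<open>m\<close>. An exponential or logarithm inside a product may therefore be replaced by a
  polynomial truncation.\<close>

lemma coef_mult_cong:
  assumes "\<And>q. mdeg q \<le> mdeg m \<Longrightarrow> coef g q = coef h q"
  shows "coef (f * g) m = coef (f * h) m"
  unfolding coef_mult using assms by (intro sum.cong) (auto simp: mdeg_add)

lemma sum_eq_if_power_vanishes:
  assumes "coef f 0 = 0" "mdeg m \<le> K" "finite A" "A \<subseteq> {..K}" "A \<inter> {..mdeg m} = B"
  shows "(\<Sum>k\<in>B. c k * coef (f ^ k) m) = (\<Sum>k\<in>A. c k * coef (f ^ k) m)"
proof (rule sum.mono_neutral_left)
  show "\<forall>k\<in>A - B. c k * coef (f ^ k) m = 0"
    using assms coef_power_eq_0[OF assms(1)] by (metis (no_types, lifting) DiffE IntI atMost_iff linorder_not_le mult_zero_right)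
qed (use assms in auto)

text \<open>\<open>mps_exp\<close> is cut off at a degree that varies with the monomial, so the
  computation runs on the fixed truncations \<open>E K\<close>. The left side needs one order more,
  since differentiation reads a coefficient one degree higher.\<close>

theorem sderiv_mps_exp:
  assumes "coef f 0 = 0"
  shows "sderiv n (Ser (mps_exp (coef f))) = sderiv n f * Ser (mps_exp (coef f))"
proof (rule ser_eqI)
  fix m :: midx
  define E where "E K = (\<Sum>k\<le>K. sconst (1 / fact k) * f ^ k)" for K
  have trunc: "mps_exp (coef f) q = coef (E K) q" if "mdeg q \<le> K" for q K
    using sum_eq_if_power_vanishes[OF assms that, of "{..K}" "{..mdeg q}" "\<lambda>k. 1 / fact k"] that
    by (simp add: E_def mps_exp_def mps_power_coef Int_absorb1)
  have deriv: "sderiv n (E (Suc K)) = sderiv n f * E K" for K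
  proof (induction K)
    case 0
    show ?case by (simp add: E_def)
  next
    case (Suc K)
    have "of_nat (Suc (Suc K)) / fact (Suc (Suc K)) = (1 / fact (Suc K) :: complex)"
      by (simp add: fact_Suc[of "Suc K"] del: of_nat_Suc fact_Suc)
    then have "sderiv n (sconst (1 / fact (Suc (Suc K))) * f ^ Suc (Suc K)) =
        sderiv n f * (sconst (1 / fact (Suc K)) * f ^ Suc K)"
      unfolding sderiv_sconst_mult sderiv_power sconst_mult_sconst by (simp add: mult_ac del: of_nat_Suc fact_Suc)
    moreover have "E (Suc (Suc K)) = E (Suc K) + sconst (1 / fact (Suc (Suc K))) * f ^ Suc (Suc K)"
      "E (Suc K) = E K + sconst (1 / fact (Suc K)) * f ^ Suc K"
      by (simp_all add: E_def del: fact_Suc power_Suc)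
    ultimately show ?case using Suc by (simp add: distrib_left del: fact_Suc power_Suc)
  qed
  have "coef (sderiv n (Ser (mps_exp (coef f)))) m = coef (sderiv n (E (Suc (mdeg m)))) m"
    by (simp add: coef_sderiv trunc[of _ "Suc (mdeg m)"] mdeg_add)
  also have "\<dots> = coef (sderiv n f * Ser (mps_exp (coef f))) m"
    unfolding deriv by (rule coef_mult_cong) (simp add: trunc)
  finally show "coef (sderiv n (Ser (mps_exp (coef f)))) m =
      coef (sderiv n f * Ser (mps_exp (coef f))) m" .
qed

text \<open>With \<open>u = z - 1\<close>, the derivative of a truncated logarithm is a geometric
  sum in \<open>- u\<close> times the derivative of \<open>u\<close>. Multiplication by
  \<open>z = 1 - (- u)\<close> telescopes the sum, up to a power of \<open>u\<close> too high to
  reach \<open>m\<close>.\<close>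

theorem mult_sderiv_mps_log:
  assumes "coef z 0 = 1"
  shows "z * sderiv n (Ser (mps_log (coef z))) = sderiv n z"
proof (rule ser_eqI)
  fix m :: midx
  define u where "u = z - 1"
  have u0: "coef u 0 = 0" using assms by (simp add: u_def coef_one)
  define L where "L K = (\<Sum>k = 1..K. sconst ((- 1) ^ (k + 1) / of_nat k) * u ^ k)" for K
  have "(\<lambda>p. coef z p - mps_one p) = coef u"
    by (simp add: u_def fun_eq_iff coef_one mps_one_def)
  then have log: "mps_log (coef z) q = (\<Sum>k = 1..mdeg q. (- 1) ^ (k + 1) / of_nat k * coef (u ^ k) q)" for q
    unfolding mps_log_def by (simp only: mps_power_coef)
  have trunc: "mps_log (coef z) q = coef (L K) q" if "mdeg q \<le> K" for q K
    using sum_eq_if_power_vanishes[OF u0 that, of "{1..K}" "{1..mdeg q}" "\<lambda>k. (- 1) ^ (k + 1) / of_nat k"] that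
    by (auto simp: L_def log)
  have deriv: "sderiv n (L K) = (\<Sum>k<K. (- u) ^ k) * sderiv n u" for K
  proof (induction K)
    case 0
    have "sderiv n 0 = 0" by (rule ser_eqI) (simp add: coef_sderiv)
    then show ?case by (simp add: L_def)
  next
    case (Suc K)
    have pm: "sconst ((- 1) ^ k) * g = (- 1) ^ k * g" for k g
    proof (induction k)
      case (Suc k)
      have "sconst ((- 1) ^ Suc k) * g = - (sconst ((- 1) ^ k) * g)"
        by (rule ser_eqI) simp
      then show ?case using Suc by simp
    qed simp
    have "(- 1) ^ (Suc K + 1) / of_nat (Suc K) * of_nat (Suc K) = ((- 1) ^ K :: complex)"
      by (simp del: of_nat_Suc)
    then have "sderiv n (sconst ((- 1) ^ (Suc K + 1) / of_nat (Suc K)) * u ^ Suc K) =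
        (- 1) ^ K * (u ^ K * sderiv n u)"
      unfolding sderiv_sconst_mult sderiv_power sconst_mult_sconst by (simp only: pm)
    also have "\<dots> = (- u) ^ K * sderiv n u"
      by (simp add: power_minus[of u] mult.assoc)
    finally have "sderiv n (sconst ((- 1) ^ (Suc K + 1) / of_nat (Suc K)) * u ^ Suc K) = (- u) ^ K * sderiv n u" .
    moreover have "L (Suc K) = L K + sconst ((- 1) ^ (Suc K + 1) / of_nat (Suc K)) * u ^ Suc K"
      by (simp add: L_def)
    ultimately show ?case using Suc by (simp only: sderiv_add sum.lessThan_Suc distrib_right)
  qed
  have geo: "z * (\<Sum>k<K. (- u) ^ k) = 1 - (- u) ^ K" for K
    using one_diff_power_eq[of "- u" K] by (simp add: u_def)
  let ?d = "Suc (mdeg m)"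
  have "coef (z * sderiv n (Ser (mps_log (coef z)))) m = coef (z * sderiv n (L ?d)) m"
    by (rule coef_mult_cong) (simp add: coef_sderiv trunc[of _ ?d] mdeg_add)
  also have "\<dots> = coef (sderiv n u) m - coef (sderiv n u * (- u) ^ ?d) m"
    unfolding deriv mult.assoc[symmetric] geo by (simp add: algebra_simps del: power_Suc)
  also have "coef (sderiv n u * (- u) ^ ?d) m = coef (sderiv n u * 0) m"
    by (rule coef_mult_cong) (use coef_power_eq_0[of "- u"] u0 in \<open>simp del: power_Suc\<close>)
  finally show "coef (z * sderiv n (Ser (mps_log (coef z)))) m = coef (sderiv n z) m"
    by (simp add: u_def coef_sderiv coef_one coef_diff) (metis add_eq_0_iff_both_eq_0 gr_zeroI less_numeral_extra(3) lookup_add lookup_unit_midx lookup_zero zero_neq_one add_is_0)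
qed

section \<open>Coefficients of the exponentiated interaction\<close>

definition trace_weight :: "nat \<Rightarrow> nat \<Rightarrow> complex" where
  "trace_weight N n = (if n = 0 then 0 else of_nat N / of_nat n)"

text \<open>The interaction is linear in the variables, so its derivatives are constants; the
  phantom variable of index 0 does not occur in it and gets weight 0.\<close>

lemma sderiv_interaction:
  "sderiv n (Ser (interaction N M)) = sconst (trace_weight N n * mtrace (M ^\<^sub>m n))"
proof (rule ser_eqI)
  fix m :: midx
  have eq: "m + unit_midx n = Poly_Mapping.single k 1 \<longleftrightarrow> m = 0 \<and> k = n" for k
  proof
    assume *: "m + unit_midx n = Poly_Mapping.single k 1"
    then have "mdeg m + 1 = 1" by (metis mdeg_add mdeg_unit unit_midx_def)
    then have "m = 0" by simp
    then show "m = 0 \<and> k = n" using * keys_unit_midx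
      by (metis add_0 singleton_inject unit_midx_def)
  qed (simp add: unit_midx_def)
  have set: "{k \<in> Poly_Mapping.keys (m + unit_midx n). 1 \<le> k \<and> m + unit_midx n = Poly_Mapping.single k 1} =
      (if m = 0 \<and> n \<noteq> 0 then {n} else {})"
    unfolding eq by (auto simp: keys_midx_add)
  show "coef (sderiv n (Ser (interaction N M))) m = coef (sconst (trace_weight N n * mtrace (M ^\<^sub>m n))) m"
    unfolding coef_sderiv coef_Ser interaction_def set
    by (simp add: coef_sconst trace_weight_def)
qed

text \<open>For \<open>m\<close> avoiding the index 0 this is the product over n of (N / n * Tr
  M^n)^(m n) / (m n)!, a polynomial in the matrix entries. The proof works with its unit-step
  recursion instead of this formula.\<close>

definition vertex_poly :: "nat \<Rightarrow> complex mat \<Rightarrow> complex mps" where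
  "vertex_poly N M = mps_exp (interaction N M)"

lemma vertex_poly_0 [simp]: "vertex_poly N M 0 = 1"
  by (simp add: vertex_poly_def mps_exp_def mps_power_def mps_one_def)

text \<open>The differential equation of the exponential, read at the coefficient \<open>m\<close>:
  one more vertex of degree \<open>n\<close> contributes one more trace.\<close>

lemma vertex_poly_add_unit:
  "of_nat (Suc (Poly_Mapping.lookup m n)) * vertex_poly N M (m + unit_midx n) =
   trace_weight N n * mtrace (M ^\<^sub>m n) * vertex_poly N M m"
proof -
  have "coef (Ser (interaction N M)) 0 = 0"
    by (simp add: interaction_def)
  from sderiv_mps_exp[OF this, of n]
  have "coef (sderiv n (Ser (vertex_poly N M))) m =
      coef (sconst (trace_weight N n * mtrace (M ^\<^sub>m n)) * Ser (vertex_poly N M)) m"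
    by (simp add: sderiv_interaction vertex_poly_def)
  then show ?thesis by (simp add: coef_sderiv)
qed

section \<open>Gaussian integration by parts\<close>

text \<open>One-variable Gaussian integration by parts, read off from the closed formulas for even
  and odd moments. At \<open>k = 0\<close> the truncated exponent \<open>k - 1\<close> is multiplied
  by 0.\<close>

lemma normal_moment_rec:
  assumes "\<sigma> > 0"
  shows "(\<integral>t. normal_density 0 \<sigma> t * t ^ Suc k \<partial>lborel) =
    \<sigma>\<^sup>2 * real k * (\<integral>t. normal_density 0 \<sigma> t * t ^ (k - 1) \<partial>lborel)"
proof (cases "even k")
  case True
  then obtain j where j: "k = 2 * j" by (elim evenE)
  have odd: "(\<integral>t. normal_density 0 \<sigma> t * t ^ (2 * i + 1) \<partial>lborel) = 0" for i
    using integral_normal_moment_odd[OF assms, of 0 i] by simp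
  show ?thesis
  proof (cases j)
    case 0
    then show ?thesis using j odd[of 0] by simp
  next
    case (Suc i)
    then show ?thesis using j odd[of j] odd[of i] by simp
  qed
next
  case False
  then obtain j where j: "k = 2 * j + 1" by (elim oddE)
  have even: "(\<integral>t. normal_density 0 \<sigma> t * t ^ (2 * i) \<partial>lborel) = fact (2 * i) / ((2 / \<sigma>\<^sup>2) ^ i * fact i)" for i
    using integral_normal_moment_even[OF assms, of 0 i] by simp
  have "fact (2 * Suc j) / ((2 / \<sigma>\<^sup>2) ^ Suc j * fact (Suc j)) =
      \<sigma>\<^sup>2 * real (2 * j + 1) * (fact (2 * j) / ((2 / \<sigma>\<^sup>2) ^ j * fact j))"
    using assms by (simp add: divide_simps)
  then show ?thesis
    using even[of "Suc j"] even[of j] j by simp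
qed

text \<open>The standard deviations depend on the coordinate because diagonal and off-diagonal
  coordinates of a Hermitian matrix have different variances.\<close>

locale gaussian_coordinates =
  fixes I :: "'i set" and \<sigma> :: "'i \<Rightarrow> real"
  assumes finite_I: "finite I" and \<sigma>_pos: "\<And>i. i \<in> I \<Longrightarrow> \<sigma> i > 0"
begin

definition density :: "('i \<Rightarrow> real) \<Rightarrow> real" where
  "density x = (\<Prod>i\<in>I. normal_density 0 (\<sigma> i) (x i))"

definition mean :: "(('i \<Rightarrow> real) \<Rightarrow> complex) \<Rightarrow> complex" where
  "mean f = (\<integral>x. complex_of_real (density x) * f x \<partial>(\<Pi>\<^sub>M i\<in>I. lborel))"

text \<open>Integrability is tracked separately: a Bochner integral is additive only on integrable
  functions and defaults to 0 elsewhere.\<close>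

definition has_mean :: "(('i \<Rightarrow> real) \<Rightarrow> complex) \<Rightarrow> bool" where
  "has_mean f = integrable (\<Pi>\<^sub>M i\<in>I. lborel) (\<lambda>x. complex_of_real (density x) * f x)"

definition monomial :: "('i \<Rightarrow> nat) \<Rightarrow> ('i \<Rightarrow> real) \<Rightarrow> complex" where
  "monomial k x = (\<Prod>i\<in>I. complex_of_real (x i) ^ k i)"

lemma has_mean_scale [intro]: "has_mean f \<Longrightarrow> has_mean (\<lambda>x. c * f x)"
  unfolding has_mean_def using integrable_mult_right[of c] by (simp add: mult.left_commute)

lemma mean_scale: "mean (\<lambda>x. c * f x) = c * mean f"
  unfolding mean_def by (simp add: mult.left_commute[of _ c])

lemma has_mean_add [intro]: "has_mean f \<Longrightarrow> has_mean g \<Longrightarrow> has_mean (\<lambda>x. f x + g x)"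
  unfolding has_mean_def by (simp add: distrib_left)

lemma mean_add: "has_mean f \<Longrightarrow> has_mean g \<Longrightarrow> mean (\<lambda>x. f x + g x) = mean f + mean g"
  unfolding has_mean_def mean_def by (simp add: distrib_left)

lemma has_mean_0 [simp]: "has_mean (\<lambda>x. 0)"
  by (simp add: has_mean_def)

lemma mean_0 [simp]: "mean (\<lambda>x. 0) = 0"
  by (simp add: mean_def)

lemma has_mean_sum [intro]: "(\<And>a. a \<in> A \<Longrightarrow> has_mean (f a)) \<Longrightarrow> has_mean (\<lambda>x. \<Sum>a\<in>A. f a x)"
  by (induction A rule: infinite_finite_induct) auto

lemma mean_sum: "(\<And>a. a \<in> A \<Longrightarrow> has_mean (f a)) \<Longrightarrow> mean (\<lambda>x. \<Sum>a\<in>A. f a x) = (\<Sum>a\<in>A. mean (f a))"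
  by (induction A rule: infinite_finite_induct) (auto simp: mean_add has_mean_sum)

lemma mean_sum_sum:
  assumes "\<And>a b. a \<in> A \<Longrightarrow> b \<in> B \<Longrightarrow> has_mean (f a b)"
  shows "mean (\<lambda>x. \<Sum>a\<in>A. \<Sum>b\<in>B. f a b x) = (\<Sum>a\<in>A. \<Sum>b\<in>B. mean (f a b))"
proof -
  have "mean (\<lambda>x. \<Sum>a\<in>A. \<Sum>b\<in>B. f a b x) = (\<Sum>a\<in>A. mean (\<lambda>x. \<Sum>b\<in>B. f a b x))"
    by (rule mean_sum) (rule has_mean_sum, rule assms)
  then show ?thesis using assms by (simp add: mean_sum cong: sum.cong)
qed

lemma density_monomial:
  "complex_of_real (density x) * monomial k x =
   complex_of_real (\<Prod>i\<in>I. normal_density 0 (\<sigma> i) (x i) * x i ^ k i)"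
  by (simp add: density_def monomial_def prod.distrib)

lemma product_lborel: "product_sigma_finite (\<lambda>_. lborel :: real measure)"
  by (standard)

lemma integrable_moment: "i \<in> I \<Longrightarrow> integrable lborel (\<lambda>t. normal_density 0 (\<sigma> i) t * t ^ k)"
  using integrable_normal_moment[OF \<sigma>_pos, of i 0 k] by simp

lemma has_mean_monomial: "has_mean (monomial k)"
  unfolding has_mean_def density_monomial
  by (intro integrable_of_real product_sigma_finite.product_integrable_prod product_lborel
      finite_I integrable_moment)

lemma mean_monomial:
  "mean (monomial k) = complex_of_real (\<Prod>i\<in>I. \<integral>t. normal_density 0 (\<sigma> i) t * t ^ k i \<partial>lborel)"
  unfolding mean_def density_monomial integral_complex_of_real
  by (subst product_sigma_finite.product_integral_prod[OF product_lborel finite_I])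
     (simp_all add: integrable_moment)

lemma mean_const: "mean (\<lambda>_. c) = c"
proof -
  have "mean (monomial (\<lambda>_. 0)) = 1"
    unfolding mean_monomial using \<sigma>_pos by simp
  then show ?thesis using mean_scale[of c "monomial (\<lambda>_. 0)"] by (simp add: monomial_def)
qed

lemma mean_monomial_Suc:
  assumes "q \<in> I"
  shows "mean (monomial (k(q := Suc (k q)))) =
    complex_of_real ((\<sigma> q)\<^sup>2) * of_nat (k q) * mean (monomial (k(q := k q - 1)))"
proof -
  have split: "(\<Prod>i\<in>I. \<integral>t. normal_density 0 (\<sigma> i) t * t ^ (k(q := l)) i \<partial>lborel) =
      (\<integral>t. normal_density 0 (\<sigma> q) t * t ^ l \<partial>lborel) *
      (\<Prod>i\<in>I - {q}. \<integral>t. normal_density 0 (\<sigma> i) t * t ^ k i \<partial>lborel)" for l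
    by (subst prod.remove[OF finite_I assms]) (auto intro!: prod.cong)
  show ?thesis
    unfolding mean_monomial split normal_moment_rec[OF \<sigma>_pos[OF assms]] by simp
qed

text \<open>The direction is complex, since differentiating along a single matrix entry combines two
  real coordinates with an imaginary coefficient. The truncated exponent at \<open>k q = 0\<close>
  comes with the factor 0.\<close>

definition monomial_deriv :: "('i \<Rightarrow> complex) \<Rightarrow> ('i \<Rightarrow> nat) \<Rightarrow> ('i \<Rightarrow> real) \<Rightarrow> complex" where
  "monomial_deriv v k x = (\<Sum>q\<in>I. v q * of_nat (k q) * monomial (k(q := k q - 1)) x)"

text \<open>\<open>poly_deriv v f g\<close>: the function \<open>f\<close> is a polynomial in the coordinates and \<open>g\<close> is its
  derivative along the complex direction \<open>v\<close>.\<close>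

inductive poly_deriv :: "('i \<Rightarrow> complex) \<Rightarrow> (('i \<Rightarrow> real) \<Rightarrow> complex) \<Rightarrow> (('i \<Rightarrow> real) \<Rightarrow> complex) \<Rightarrow> bool"
  for v where
  monomial: "poly_deriv v (monomial k) (monomial_deriv v k)"
| scale: "poly_deriv v f f' \<Longrightarrow> poly_deriv v (\<lambda>x. c * f x) (\<lambda>x. c * f' x)"
| add: "poly_deriv v f f' \<Longrightarrow> poly_deriv v g g' \<Longrightarrow> poly_deriv v (\<lambda>x. f x + g x) (\<lambda>x. f' x + g' x)"

lemma poly_deriv_const: "poly_deriv v (\<lambda>_. c) (\<lambda>_. 0)"
proof -
  have "poly_deriv v (\<lambda>x. c * monomial (\<lambda>_. 0) x) (\<lambda>x. c * monomial_deriv v (\<lambda>_. 0) x)"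
    by (intro poly_deriv.intros)
  then show ?thesis by (simp add: monomial_def monomial_deriv_def)
qed

lemma poly_deriv_coord:
  assumes "q \<in> I"
  shows "poly_deriv v (\<lambda>x. complex_of_real (x q)) (\<lambda>_. v q)"
proof -
  let ?k = "(\<lambda>_. 0)(q := 1)"
  have "monomial ?k = (\<lambda>x. complex_of_real (x q))"
    using assms finite_I by (auto simp: monomial_def fun_eq_iff prod.remove[OF finite_I assms] intro!: prod.neutral)
  moreover have "monomial_deriv v ?k = (\<lambda>_. v q)"
    unfolding monomial_deriv_def
    by (subst sum.remove[OF finite_I assms]) (auto simp: monomial_def intro!: ext sum.neutral)
  ultimately show ?thesis using poly_deriv.monomial[of v ?k] by simp
qed

lemma poly_deriv_sum:
  "(\<And>a. a \<in> A \<Longrightarrow> poly_deriv v (f a) (f' a)) \<Longrightarrow>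
   poly_deriv v (\<lambda>x. \<Sum>a\<in>A. f a x) (\<lambda>x. \<Sum>a\<in>A. f' a x)"
  by (induction A rule: infinite_finite_induct) (auto intro: poly_deriv_const poly_deriv.add)

lemma monomial_mult: "monomial k x * monomial l x = monomial (\<lambda>i. k i + l i) x"
  by (simp add: monomial_def power_add prod.distrib)

lemma monomial_deriv_mult:
  "monomial_deriv v (\<lambda>i. k i + l i) x = monomial_deriv v k x * monomial l x + monomial k x * monomial_deriv v l x"
proof -
  have "of_nat (k q + l q) * monomial ((\<lambda>i. k i + l i)(q := k q + l q - 1)) x =
      of_nat (k q) * (monomial (k(q := k q - 1)) x * monomial l x) +
      of_nat (l q) * (monomial k x * monomial (l(q := l q - 1)) x)" for q
  proof -
    have "of_nat (k q) * monomial ((\<lambda>i. k i + l i)(q := k q + l q - 1)) x =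
        of_nat (k q) * monomial (\<lambda>i. (k(q := k q - 1)) i + l i) x"
    proof (cases "k q")
      case (Suc a)
      then have "(\<lambda>i. k i + l i)(q := k q + l q - 1) = (\<lambda>i. (k(q := k q - 1)) i + l i)"
        by auto
      then show ?thesis by (simp only:)
    qed simp
    moreover have "of_nat (l q) * monomial ((\<lambda>i. k i + l i)(q := k q + l q - 1)) x =
        of_nat (l q) * monomial (\<lambda>i. k i + (l(q := l q - 1)) i) x"
    proof (cases "l q")
      case (Suc a)
      then have "(\<lambda>i. k i + l i)(q := k q + l q - 1) = (\<lambda>i. k i + (l(q := l q - 1)) i)"
        by auto
      then show ?thesis by (simp only:)
    qed simp
    ultimately show ?thesis unfolding monomial_mult by (simp only: of_nat_add distrib_right)
  qed
  then show ?thesis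
    unfolding monomial_deriv_def sum_distrib_left sum_distrib_right sum.distrib[symmetric]
    by (intro sum.cong refl) (simp add: mult.assoc, simp add: algebra_simps)
qed

text \<open>Both sides are bilinear in the two polynomials, so a nested induction leaves only the
  product of two monomials.\<close>

lemma poly_deriv_mult:
  assumes "poly_deriv v f f'" "poly_deriv v g g'"
  shows "poly_deriv v (\<lambda>x. f x * g x) (\<lambda>x. f' x * g x + f x * g' x)"
  using assms(1)
proof (induction f f' rule: poly_deriv.induct)
  case (monomial k)
  show ?case using assms(2)
  proof (induction g g' rule: poly_deriv.induct)
    case (monomial l)
    show ?case
      unfolding monomial_mult monomial_deriv_mult[symmetric] by (rule poly_deriv.monomial)
  next
    case (scale f f' c)
    then show ?case using poly_deriv.scale[OF scale.IH, of c] by (simp add: algebra_simps)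
  next
    case (add f f' g g')
    then show ?case using poly_deriv.add[OF add.IH] by (simp add: algebra_simps)
  qed
next
  case (scale f f' c)
  then show ?case using poly_deriv.scale[OF scale.IH, of c] by (simp add: algebra_simps)
next
  case (add f f' h h')
  then show ?case using poly_deriv.add[OF add.IH] by (simp add: algebra_simps)
qed

lemma poly_deriv_has_mean:
  assumes "poly_deriv v f f'"
  shows "has_mean f"
  using assms by induction (auto intro: has_mean_monomial)

lemma coord_mult_monomial: "q \<in> I \<Longrightarrow> complex_of_real (x q) * monomial k x = monomial (k(q := Suc (k q))) x"
  by (simp add: monomial_def prod.remove[OF finite_I, of q] mult.assoc)

text \<open>On monomials this is the one-variable recursion applied in each coordinate; the rest is
  linearity. The integrability claims are carried along because linearity of \<open>mean\<close>
  depends on them.\<close>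

theorem integration_by_parts:
  assumes "poly_deriv v f f'"
  shows "has_mean f' \<and> has_mean (\<lambda>x. (\<Sum>q\<in>I. v q / complex_of_real ((\<sigma> q)\<^sup>2) * x q) * f x) \<and>
    mean (\<lambda>x. (\<Sum>q\<in>I. v q / complex_of_real ((\<sigma> q)\<^sup>2) * x q) * f x) = mean f'"
  using assms
proof induction
  case (monomial k)
  let ?c = "\<lambda>q. v q / complex_of_real ((\<sigma> q)\<^sup>2)"
  have eq: "(\<lambda>x. (\<Sum>q\<in>I. ?c q * complex_of_real (x q)) * monomial k x) =
      (\<lambda>x. \<Sum>q\<in>I. ?c q * monomial (k(q := Suc (k q))) x)"
    by (simp add: sum_distrib_right mult.assoc coord_mult_monomial cong: sum.cong)
  have "mean (\<lambda>x. \<Sum>q\<in>I. ?c q * monomial (k(q := Suc (k q))) x) =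
      (\<Sum>q\<in>I. ?c q * mean (monomial (k(q := Suc (k q)))))"
    by (subst mean_sum) (auto simp only: mean_scale intro!: has_mean_scale has_mean_monomial)
  also have "\<dots> = (\<Sum>q\<in>I. v q * of_nat (k q) * mean (monomial (k(q := k q - 1))))"
  proof (rule sum.cong[OF refl])
    fix q assume "q \<in> I"
    then show "?c q * mean (monomial (k(q := Suc (k q)))) = v q * of_nat (k q) * mean (monomial (k(q := k q - 1)))"
      using \<sigma>_pos[of q] by (simp add: mean_monomial_Suc)
  qed
  also have "\<dots> = mean (monomial_deriv v k)"
    unfolding monomial_deriv_def
    by (subst mean_sum) (auto simp only: mean_scale intro!: has_mean_scale has_mean_monomial)
  finally have "mean (\<lambda>x. \<Sum>q\<in>I. ?c q * monomial (k(q := Suc (k q))) x) = mean (monomial_deriv v k)" .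
  moreover have "has_mean (monomial_deriv v k)"
    unfolding monomial_deriv_def by (intro has_mean_sum has_mean_scale has_mean_monomial)
  moreover have "has_mean (\<lambda>x. \<Sum>q\<in>I. ?c q * monomial (k(q := Suc (k q))) x)"
    by (intro has_mean_sum has_mean_scale has_mean_monomial)
  ultimately show ?case unfolding eq by blast
next
  case (scale f f' c)
  let ?l = "\<lambda>x. \<Sum>q\<in>I. v q / complex_of_real ((\<sigma> q)\<^sup>2) * complex_of_real (x q)"
  have "(\<lambda>x. ?l x * (c * f x)) = (\<lambda>x. c * (?l x * f x))" by (simp add: mult.left_commute)
  then show ?case using scale by (simp only: mean_scale has_mean_scale)
next
  case (add f f' g g')
  let ?l = "\<lambda>x. \<Sum>q\<in>I. v q / complex_of_real ((\<sigma> q)\<^sup>2) * complex_of_real (x q)"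
  have "(\<lambda>x. ?l x * (f x + g x)) = (\<lambda>x. ?l x * f x + ?l x * g x)" by (simp add: distrib_left)
  then show ?case using add by (simp only: mean_add has_mean_add)
qed

end

section \<open>The loop equation of the Gaussian unitary ensemble\<close>

lemma mat_mult_entry:
  assumes "A \<in> carrier_mat N N" "B \<in> carrier_mat N N" "a < N" "b < N"
  shows "(A * B) $$ (a, b) = (\<Sum>c<N. A $$ (a, c) * B $$ (c, b))"
  using assms by (auto simp: scalar_prod_def lessThan_atLeast0 intro!: sum.cong)

lemma pow_mat_carrier: "A \<in> carrier_mat N N \<Longrightarrow> A ^\<^sub>m n \<in> carrier_mat N N"
  by (induction n) auto

lemma pow_mat_add:
  assumes "A \<in> carrier_mat N N"
  shows "A ^\<^sub>m (s + t) = A ^\<^sub>m s * A ^\<^sub>m t"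
proof (induction t)
  case 0
  have "A ^\<^sub>m s * 1\<^sub>m N = A ^\<^sub>m s" by (rule right_mult_one_mat[OF pow_mat_carrier[OF assms]])
  then show ?case using assms by auto
next
  case (Suc t)
  show ?case
    using assoc_mult_mat[OF pow_mat_carrier[OF assms] pow_mat_carrier[OF assms] assms, of s t] Suc by simp
qed

lemma mtrace_eq_sum: "A \<in> carrier_mat N N \<Longrightarrow> mtrace A = (\<Sum>i<N. A $$ (i, i))"
  by (auto simp: mtrace_def)

lemma mtrace_pow_add:
  assumes "A \<in> carrier_mat N N"
  shows "mtrace (A ^\<^sub>m (s + t)) = (\<Sum>a<N. \<Sum>b<N. (A ^\<^sub>m s) $$ (a, b) * (A ^\<^sub>m t) $$ (b, a))"
  unfolding pow_mat_add[OF assms]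
  using pow_mat_carrier[OF assms]
  by (subst mtrace_eq_sum[of _ N]) (auto simp: mat_mult_entry simp del: index_mult_mat(1) intro!: mult_carrier_mat sum.cong)

lemma mtrace_pow_0: "A \<in> carrier_mat N N \<Longrightarrow> mtrace (A ^\<^sub>m 0) = of_nat N"
  by (auto simp: mtrace_def)

text \<open>The part of a derivative of \<open>vertex_poly\<close> in which a trace of degree
  \<open>p\<close> is hit: \<open>c p\<close> times \<open>p\<close> stands for the derivative of
  that trace, and \<open>m - unit_midx p\<close> for the vertices left over.\<close>

definition vertex_term :: "nat \<Rightarrow> complex mat \<Rightarrow> (nat \<Rightarrow> complex) \<Rightarrow> midx \<Rightarrow> nat \<Rightarrow> complex" where
  "vertex_term N A c m p = (if p \<in> Poly_Mapping.keys m
     then trace_weight N p * of_nat p * c p * vertex_poly N A (m - unit_midx p) else 0)"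

text \<open>The product rule for the recursion \<open>vertex_poly_add_unit\<close>, sorted by the
  degree \<open>p\<close> of the trace that is differentiated: either the new trace or one of the
  old ones.\<close>

lemma vertex_term_add_unit:
  "of_nat (Suc (Poly_Mapping.lookup m n)) * vertex_term N A c (m + unit_midx n) p =
   trace_weight N n * ((if p = n then of_nat n * c n * vertex_poly N A m else 0) +
     mtrace (A ^\<^sub>m n) * vertex_term N A c m p)"
proof (cases "p = n")
  case False
  show ?thesis
  proof (cases "p \<in> Poly_Mapping.keys m")
    case True
    have eq: "m + unit_midx n - unit_midx p = (m - unit_midx p) + unit_midx n"
      using True by (intro poly_mapping_eqI) (auto simp: lookup_add lookup_minus lookup_unit_midx in_keys_iff)
    have "Poly_Mapping.lookup (m - unit_midx p) n = Poly_Mapping.lookup m n"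
      using False by (simp add: lookup_minus lookup_unit_midx)
    then have "of_nat (Suc (Poly_Mapping.lookup m n)) * vertex_poly N A (m + unit_midx n - unit_midx p) =
        trace_weight N n * mtrace (A ^\<^sub>m n) * vertex_poly N A (m - unit_midx p)"
      using vertex_poly_add_unit[of "m - unit_midx p" n N A] eq by simp
    moreover have "of_nat (Suc (Poly_Mapping.lookup m n)) * vertex_term N A c (m + unit_midx n) p =
       trace_weight N p * of_nat p * c p * (of_nat (Suc (Poly_Mapping.lookup m n)) * vertex_poly N A (m + unit_midx n - unit_midx p))"
      using True by (simp add: vertex_term_def keys_midx_add mult_ac del: of_nat_Suc)
    ultimately show ?thesis using True False by (simp add: vertex_term_def mult_ac del: of_nat_Suc)
  qed (use False in \<open>simp add: vertex_term_def keys_midx_add\<close>)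
next
  case True
  have eq: "m + unit_midx n - unit_midx n = m" by simp
  \<comment> \<open>If the vertex hit also has degree \<open>n\<close>, restoring a trace of degree
    \<open>n\<close> gives back \<open>vertex_poly N A m\<close> with its multiplicity. Adding the
    new trace raises the multiplicity by one.\<close>
  have *: "trace_weight N n * mtrace (A ^\<^sub>m n) * vertex_term N A c m n =
      trace_weight N n * of_nat n * c n * (of_nat (Poly_Mapping.lookup m n) * vertex_poly N A m)"
  proof (cases "n \<in> Poly_Mapping.keys m")
    case True
    have "Suc (Poly_Mapping.lookup (m - unit_midx n) n) = Poly_Mapping.lookup m n"
      using True by (simp add: lookup_minus lookup_unit_midx in_keys_iff)
    then have "of_nat (Poly_Mapping.lookup m n) * vertex_poly N A m =
        trace_weight N n * mtrace (A ^\<^sub>m n) * vertex_poly N A (m - unit_midx n)"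
      using vertex_poly_add_unit[of "m - unit_midx n" n N A] midx_add_diff_unit[OF True] by simp
    then show ?thesis using True by (simp add: vertex_term_def mult_ac)
  qed (simp add: vertex_term_def in_keys_iff)
  have "of_nat (Suc (Poly_Mapping.lookup m n)) * vertex_term N A c (m + unit_midx n) n =
      trace_weight N n * of_nat n * c n * vertex_poly N A m +
      trace_weight N n * of_nat n * c n * (of_nat (Poly_Mapping.lookup m n) * vertex_poly N A m)"
    by (simp add: vertex_term_def keys_midx_add eq algebra_simps)
  then show ?thesis
    unfolding True *[symmetric] by (simp add: distrib_left mult.assoc)
qed

locale gue =
  fixes N :: nat
  assumes N_pos: "N \<ge> 1"
begin

definition coords :: "(nat \<times> nat) set" where
  "coords = {..<N} \<times> {..<N}"

text \<open>An off-diagonal coordinate enters \<open>Tr (M ^ 2)\<close> twice, through both triangles of \<open>M\<close>.\<close>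

definition mult_coord :: "nat \<times> nat \<Rightarrow> real" where
  "mult_coord q = (if fst q = snd q then 1 else 2)"

text \<open>The variance for which the product density is proportional to exp(- N Tr(M^2) /
  2).\<close>

definition std :: "nat \<times> nat \<Rightarrow> real" where
  "std q = sqrt (1 / (real N * mult_coord q))"

lemma mult_coord_pos: "mult_coord q > 0"
  by (simp add: mult_coord_def)

sublocale gaussian_coordinates coords std
  using N_pos by unfold_locales (auto simp: coords_def std_def mult_coord_pos)

lemma std_sq: "(std q)\<^sup>2 = 1 / (real N * mult_coord q)"
  using N_pos mult_coord_pos[of q] by (simp add: std_def less_imp_le)

abbreviation H :: "(nat \<times> nat \<Rightarrow> real) \<Rightarrow> complex mat" where
  "H \<equiv> herm_mat N"

lemma H_carrier: "H x \<in> carrier_mat N N"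
  by (simp add: herm_mat_def)

text \<open>A matrix entry as a complex linear form in the real coordinates, the shape in which
  \<open>integration_by_parts\<close> consumes it.\<close>

definition entry_coeff :: "nat \<times> nat \<Rightarrow> nat \<times> nat \<Rightarrow> complex" where
  "entry_coeff = (\<lambda>(i, j) q. if i = j then of_bool (q = (i, j))
     else if i < j then of_bool (q = (i, j)) + \<i> * of_bool (q = (j, i))
     else of_bool (q = (j, i)) - \<i> * of_bool (q = (i, j)))"

lemma sum_entry_coeff:
  assumes "i < N" "j < N"
  shows "(\<Sum>q\<in>coords. entry_coeff (i, j) q * g q) =
    (if i = j then g (i, j) else if i < j then g (i, j) + \<i> * g (j, i) else g (j, i) - \<i> * g (i, j))"
proof -
  have d: "(\<Sum>q\<in>coords. of_bool (q = r) * g q) = g r" if "r \<in> coords" for r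
  proof -
    have "(\<Sum>q\<in>coords. of_bool (q = r) * g q) = (\<Sum>q\<in>{r}. of_bool (q = r) * g q)"
      using that finite_I by (intro sum.mono_neutral_right) auto
    then show ?thesis by simp
  qed
  have "(i, j) \<in> coords" "(j, i) \<in> coords" using assms by (auto simp: coords_def)
  note d' = this[THEN d]
  show ?thesis
    using d' by (auto simp: entry_coeff_def distrib_right left_diff_distrib sum.distrib sum_subtractf mult.assoc
        simp flip: sum_distrib_left)
qed

lemma H_entry:
  assumes "i < N" "j < N"
  shows "H x $$ (i, j) = (\<Sum>q\<in>coords. entry_coeff (i, j) q * complex_of_real (x q))"
  unfolding sum_entry_coeff[OF assms] using assms
  by (auto simp: herm_mat_def complex_eq_iff)

text \<open>The direction \<open>\<partial> / \<partial> M\<^sub>j\<^sub>i\<close>, dual to the entry \<open>M\<^sub>i\<^sub>j\<close> under the Gaussian covariance.\<close>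

definition direction :: "nat \<Rightarrow> nat \<Rightarrow> nat \<times> nat \<Rightarrow> complex" where
  "direction i j q = entry_coeff (i, j) q / complex_of_real (mult_coord q)"

text \<open>For \<open>i < j\<close> the direction is a Wirtinger operator: half of the derivative
  in \<open>x (i, j)\<close> plus the imaginary unit times that in \<open>x (j, i)\<close>. It
  annihilates the entry at \<open>(i, j)\<close> and sends the entry at \<open>(j, i)\<close> to
  1.\<close>

lemma poly_deriv_H:
  assumes "i < N" "j < N" "k < N" "l < N"
  shows "poly_deriv (direction i j) (\<lambda>x. H x $$ (k, l)) (\<lambda>_. of_bool (k = j \<and> l = i))"
proof -
  have "poly_deriv (direction i j) (\<lambda>x. \<Sum>q\<in>coords. entry_coeff (k, l) q * complex_of_real (x q))
      (\<lambda>_. \<Sum>q\<in>coords. entry_coeff (k, l) q * direction i j q)"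
    by (intro poly_deriv_sum poly_deriv.scale poly_deriv_coord)
  moreover have "(\<Sum>q\<in>coords. entry_coeff (k, l) q * direction i j q) = of_bool (k = j \<and> l = i)"
    unfolding sum_entry_coeff[OF assms(3,4)]
    by (cases k l rule: linorder_cases; cases i j rule: linorder_cases;
        cases "k = j"; cases "l = i"; cases "k = i"; cases "l = j")
       (simp_all add: direction_def entry_coeff_def mult_coord_def)
  moreover have "(\<lambda>x. H x $$ (k, l)) = (\<lambda>x. \<Sum>q\<in>coords. entry_coeff (k, l) q * complex_of_real (x q))"
    by (rule ext, rule H_entry[OF assms(3,4)])
  ultimately show ?thesis by (simp only:)
qed

text \<open>Product rule: the factor after the first \<open>s\<close> ones is replaced by the matrix
  unit at \<open>(j, i)\<close>, which cuts the power into two.\<close>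

lemma poly_deriv_H_pow:
  assumes "i < N" "j < N" "k < N" "l < N"
  shows "poly_deriv (direction i j) (\<lambda>x. (H x ^\<^sub>m n) $$ (k, l))
    (\<lambda>x. \<Sum>s<n. (H x ^\<^sub>m s) $$ (k, j) * (H x ^\<^sub>m (n - 1 - s)) $$ (i, l))"
  using assms(4)
proof (induction n arbitrary: l)
  case 0
  have "(\<lambda>x. (H x ^\<^sub>m 0) $$ (k, l)) = (\<lambda>_. of_bool (k = l))"
    using 0 assms by (simp add: herm_mat_def)
  then show ?case using poly_deriv_const by simp
next
  case (Suc n)
  have e: "(H x ^\<^sub>m Suc r) $$ (a, l) = (\<Sum>c<N. (H x ^\<^sub>m r) $$ (a, c) * H x $$ (c, l))" if "a < N" for x r a
    using mat_mult_entry[OF pow_mat_carrier[OF H_carrier] H_carrier that Suc.prems] by simp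
  have "poly_deriv (direction i j) (\<lambda>x. \<Sum>c<N. (H x ^\<^sub>m n) $$ (k, c) * H x $$ (c, l))
     (\<lambda>x. \<Sum>c<N. (\<Sum>s<n. (H x ^\<^sub>m s) $$ (k, j) * (H x ^\<^sub>m (n - 1 - s)) $$ (i, c)) * H x $$ (c, l) +
        (H x ^\<^sub>m n) $$ (k, c) * of_bool (c = j \<and> l = i))"
    using Suc assms by (intro poly_deriv_sum poly_deriv_mult Suc.IH poly_deriv_H) auto
  moreover have "(\<Sum>c<N. (\<Sum>s<n. (H x ^\<^sub>m s) $$ (k, j) * (H x ^\<^sub>m (n - 1 - s)) $$ (i, c)) * H x $$ (c, l) +
        (H x ^\<^sub>m n) $$ (k, c) * of_bool (c = j \<and> l = i)) =
      (\<Sum>s<Suc n. (H x ^\<^sub>m s) $$ (k, j) * (H x ^\<^sub>m (Suc n - 1 - s)) $$ (i, l))" for x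
  proof -
    have "(\<Sum>c<N. (\<Sum>s<n. (H x ^\<^sub>m s) $$ (k, j) * (H x ^\<^sub>m (n - 1 - s)) $$ (i, c)) * H x $$ (c, l)) =
        (\<Sum>s<n. (H x ^\<^sub>m s) $$ (k, j) * (\<Sum>c<N. (H x ^\<^sub>m (n - 1 - s)) $$ (i, c) * H x $$ (c, l)))"
      unfolding sum_distrib_left sum_distrib_right by (subst sum.swap) (simp add: mult.assoc)
    also have "\<dots> = (\<Sum>s<n. (H x ^\<^sub>m s) $$ (k, j) * (H x ^\<^sub>m (Suc n - 1 - s)) $$ (i, l))"
    proof (rule sum.cong[OF refl])
      fix s assume "s \<in> {..<n}"
      then have "Suc n - 1 - s = Suc (n - 1 - s)" by auto
      then show "(H x ^\<^sub>m s) $$ (k, j) * (\<Sum>c<N. (H x ^\<^sub>m (n - 1 - s)) $$ (i, c) * H x $$ (c, l)) =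
          (H x ^\<^sub>m s) $$ (k, j) * (H x ^\<^sub>m (Suc n - 1 - s)) $$ (i, l)"
        using e[OF assms(1), of x "n - 1 - s"] by simp
    qed
    finally have 1: "(\<Sum>c<N. (\<Sum>s<n. (H x ^\<^sub>m s) $$ (k, j) * (H x ^\<^sub>m (n - 1 - s)) $$ (i, c)) * H x $$ (c, l)) =
        (\<Sum>s<n. (H x ^\<^sub>m s) $$ (k, j) * (H x ^\<^sub>m (Suc n - 1 - s)) $$ (i, l))" .
    have "(\<Sum>c<N. (H x ^\<^sub>m n) $$ (k, c) * of_bool (c = j \<and> l = i)) =
        (\<Sum>c\<in>{j}. (H x ^\<^sub>m n) $$ (k, c) * of_bool (c = j \<and> l = i))"
      using assms by (intro sum.mono_neutral_right) auto
    moreover have "(H x ^\<^sub>m 0) $$ (i, l) = of_bool (l = i)"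
      using Suc.prems assms by (auto simp: herm_mat_def)
    ultimately have 2: "(\<Sum>c<N. (H x ^\<^sub>m n) $$ (k, c) * of_bool (c = j \<and> l = i)) =
        (H x ^\<^sub>m n) $$ (k, j) * (H x ^\<^sub>m (Suc n - 1 - n)) $$ (i, l)"
      by simp
    show ?thesis unfolding sum.distrib 1 2 by simp
  qed
  ultimately show ?case using e[OF assms(3)] by simp
qed

text \<open>Under the trace the two pieces of the cut power close up cyclically to the same entry
  for every position of the cut, whence the factor \<open>n\<close>.\<close>

lemma poly_deriv_trace_pow:
  assumes "i < N" "j < N"
  shows "poly_deriv (direction i j) (\<lambda>x. mtrace (H x ^\<^sub>m n)) (\<lambda>x. of_nat n * (H x ^\<^sub>m (n - 1)) $$ (i, j))"
proof -
  have "poly_deriv (direction i j) (\<lambda>x. \<Sum>c<N. (H x ^\<^sub>m n) $$ (c, c))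
     (\<lambda>x. \<Sum>c<N. \<Sum>s<n. (H x ^\<^sub>m s) $$ (c, j) * (H x ^\<^sub>m (n - 1 - s)) $$ (i, c))"
    using assms by (intro poly_deriv_sum poly_deriv_H_pow) auto
  moreover have "(\<Sum>c<N. \<Sum>s<n. (H x ^\<^sub>m s) $$ (c, j) * (H x ^\<^sub>m (n - 1 - s)) $$ (i, c)) =
      of_nat n * (H x ^\<^sub>m (n - 1)) $$ (i, j)" for x
  proof -
    have "(\<Sum>c<N. (H x ^\<^sub>m s) $$ (c, j) * (H x ^\<^sub>m (n - 1 - s)) $$ (i, c)) = (H x ^\<^sub>m (n - 1)) $$ (i, j)"
      if "s \<in> {..<n}" for s
    proof -
      have "(H x ^\<^sub>m (n - 1 - s + s)) $$ (i, j) = (\<Sum>c<N. (H x ^\<^sub>m (n - 1 - s)) $$ (i, c) * (H x ^\<^sub>m s) $$ (c, j))"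
        unfolding pow_mat_add[OF H_carrier] using assms by (intro mat_mult_entry pow_mat_carrier H_carrier)
      then show ?thesis using that by (simp add: mult.commute)
    qed
    then show ?thesis by (subst sum.swap) simp
  qed
  ultimately show ?thesis
    using mtrace_eq_sum[OF pow_mat_carrier[OF H_carrier]] by simp
qed

lemma poly_deriv_vertex_poly:
  assumes "i < N" "j < N"
  shows "poly_deriv (direction i j) (\<lambda>x. vertex_poly N (H x) m)
    (\<lambda>x. \<Sum>p\<in>Poly_Mapping.keys m. vertex_term N (H x) (\<lambda>p. (H x ^\<^sub>m (p - 1)) $$ (i, j)) m p)"
proof (induction m rule: midx_unit_induct)
  case zero
  show ?case using poly_deriv_const by simp
next
  case (add_unit m n)
  let ?c = "\<lambda>x p. (H x ^\<^sub>m (p - 1)) $$ (i, j)"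
  let ?a = "trace_weight N n / of_nat (Suc (Poly_Mapping.lookup m n))"
  let ?S = "Poly_Mapping.keys (m + unit_midx n)"
  have nz: "(of_nat (Suc (Poly_Mapping.lookup m n)) :: complex) \<noteq> 0"
    by (simp del: of_nat_Suc)
  have X: "vertex_poly N (H x) (m + unit_midx n) = ?a * (mtrace (H x ^\<^sub>m n) * vertex_poly N (H x) m)" for x
    using vertex_poly_add_unit[of m n N "H x"] nz by (simp add: field_simps del: of_nat_Suc)
  have "poly_deriv (direction i j) (\<lambda>x. ?a * (mtrace (H x ^\<^sub>m n) * vertex_poly N (H x) m))
     (\<lambda>x. ?a * (of_nat n * ?c x n * vertex_poly N (H x) m +
        mtrace (H x ^\<^sub>m n) * (\<Sum>p\<in>Poly_Mapping.keys m. vertex_term N (H x) (?c x) m p)))"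
    by (intro poly_deriv.scale poly_deriv_mult poly_deriv_trace_pow assms add_unit)
  moreover have "?a * (of_nat n * ?c x n * vertex_poly N (H x) m +
        mtrace (H x ^\<^sub>m n) * (\<Sum>p\<in>Poly_Mapping.keys m. vertex_term N (H x) (?c x) m p)) =
      (\<Sum>p\<in>?S. vertex_term N (H x) (?c x) (m + unit_midx n) p)" for x
  proof -
    define y where "y = of_nat n * ?c x n * vertex_poly N (H x) m"
    have 1: "(\<Sum>p\<in>Poly_Mapping.keys m. vertex_term N (H x) (?c x) m p) = (\<Sum>p\<in>?S. vertex_term N (H x) (?c x) m p)"
      by (rule sum.mono_neutral_left) (auto simp: keys_midx_add vertex_term_def)
    have 2: "(\<Sum>p\<in>?S. if p = n then y else 0) = y"
      by (simp add: keys_midx_add)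
    have 3: "vertex_term N (H x) (?c x) (m + unit_midx n) p =
        ?a * ((if p = n then y else 0) + mtrace (H x ^\<^sub>m n) * vertex_term N (H x) (?c x) m p)" for p
      using vertex_term_add_unit[of m n N "H x" "?c x" p] nz by (simp add: y_def field_simps del: of_nat_Suc)
    have "(\<Sum>p\<in>?S. vertex_term N (H x) (?c x) (m + unit_midx n) p) =
        ?a * ((\<Sum>p\<in>?S. if p = n then y else 0) + mtrace (H x ^\<^sub>m n) * (\<Sum>p\<in>?S. vertex_term N (H x) (?c x) m p))"
      by (simp only: 3 sum_distrib_left sum.distrib distrib_left)
    then show ?thesis unfolding 1 2 unfolding y_def by simp
  qed
  ultimately show ?case unfolding X by simp
qed

definition moment :: "(complex mat \<Rightarrow> complex) \<Rightarrow> complex" where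
  "moment f = mean (\<lambda>x. f (H x))"

text \<open>Dividing \<open>direction\<close> by the variance cancels \<open>mult_coord\<close> and
  leaves \<open>N\<close> times the linear form of the entry.\<close>

lemma entry_integration_by_parts:
  assumes "i < N" "j < N" "poly_deriv (direction i j) f f'"
  shows "has_mean f'" "has_mean (\<lambda>x. of_nat N * H x $$ (i, j) * f x)"
    "mean (\<lambda>x. of_nat N * H x $$ (i, j) * f x) = mean f'"
proof -
  have "(\<Sum>q\<in>coords. direction i j q / complex_of_real ((std q)\<^sup>2) * complex_of_real (x q)) = of_nat N * H x $$ (i, j)" for x
    unfolding H_entry[OF assms(1,2)] sum_distrib_left
    using mult_coord_pos by (intro sum.cong refl) (simp add: direction_def std_sq less_imp_neq[THEN not_sym])
  then show "has_mean f'" "has_mean (\<lambda>x. of_nat N * H x $$ (i, j) * f x)"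
    "mean (\<lambda>x. of_nat N * H x $$ (i, j) * f x) = mean f'"
    using integration_by_parts[OF assms(3)] by simp_all
qed

text \<open>Write N Tr(M^n) as the sum of N M_ab (M^(n-1))_ba and integrate each M_ab by parts. The
  derivative either hits the power, which splits its trace into two, or hits a vertex of degree
  \<open>p\<close>, which merges with it into a trace of degree \<open>n + p - 2\<close>.\<close>

theorem loop_equation:
  assumes "n \<ge> 1"
  shows "of_nat N * moment (\<lambda>A. mtrace (A ^\<^sub>m n) * vertex_poly N A m) =
    (\<Sum>s<n - 1. moment (\<lambda>A. mtrace (A ^\<^sub>m s) * mtrace (A ^\<^sub>m (n - 2 - s)) * vertex_poly N A m)) +
    of_nat N * (\<Sum>p\<in>Poly_Mapping.keys m - {0}. moment (\<lambda>A. mtrace (A ^\<^sub>m (n + p - 2)) * vertex_poly N A (m - unit_midx p)))"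
proof -
  let ?X = "\<lambda>x. vertex_poly N (H x)"
  let ?f = "\<lambda>a b x. (H x ^\<^sub>m (n - 1)) $$ (b, a) * ?X x m"
  let ?t = "\<lambda>a b x p. vertex_term N (H x) (\<lambda>p. (H x ^\<^sub>m (p - 1)) $$ (a, b)) m p"
  let ?f' = "\<lambda>a b x. (\<Sum>s<n - 1. (H x ^\<^sub>m s) $$ (b, b) * (H x ^\<^sub>m (n - 1 - 1 - s)) $$ (a, a)) * ?X x m +
     (H x ^\<^sub>m (n - 1)) $$ (b, a) * (\<Sum>p\<in>Poly_Mapping.keys m. ?t a b x p)"
  have pd: "poly_deriv (direction a b) (?f a b) (?f' a b)" if "a < N" "b < N" for a b
    by (intro poly_deriv_mult poly_deriv_H_pow poly_deriv_vertex_poly that)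
  note ibp = entry_integration_by_parts[OF _ _ pd]
  \<comment> \<open>Any direction certifies that a function is polynomial, hence integrable;
    \<open>(0, 0)\<close> is available because \<open>N\<close> is positive.\<close>
  have hm: "has_mean (\<lambda>x. mtrace (H x ^\<^sub>m k) * ?X x m)" for k m
    using N_pos by (intro poly_deriv_has_mean[OF poly_deriv_mult[OF poly_deriv_trace_pow[of 0 0] poly_deriv_vertex_poly[of 0 0]]]) auto
  have hm2: "has_mean (\<lambda>x. mtrace (H x ^\<^sub>m k) * mtrace (H x ^\<^sub>m l) * ?X x m)" for k l m
    using N_pos by (intro poly_deriv_has_mean[OF poly_deriv_mult[OF poly_deriv_mult[OF poly_deriv_trace_pow[of 0 0] poly_deriv_trace_pow[of 0 0]]
      poly_deriv_vertex_poly[of 0 0]]]) auto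
  have lhs: "of_nat N * (mtrace (H x ^\<^sub>m n) * ?X x m) = (\<Sum>a<N. \<Sum>b<N. of_nat N * H x $$ (a, b) * ?f a b x)" for x
  proof -
    have "mtrace (H x ^\<^sub>m (1 + (n - 1))) = (\<Sum>a<N. \<Sum>b<N. (H x ^\<^sub>m 1) $$ (a, b) * (H x ^\<^sub>m (n - 1)) $$ (b, a))"
      by (rule mtrace_pow_add[OF H_carrier])
    moreover have "H x ^\<^sub>m 1 = H x" using H_carrier[of x] by simp
    ultimately show ?thesis
      using assms by (simp add: sum_distrib_left sum_distrib_right mult.assoc)
  qed
  have rhs: "(\<Sum>a<N. \<Sum>b<N. ?f' a b x) =
      (\<Sum>s<n - 1. mtrace (H x ^\<^sub>m s) * mtrace (H x ^\<^sub>m (n - 2 - s)) * ?X x m) +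
      (\<Sum>p\<in>Poly_Mapping.keys m - {0}. of_nat N * (mtrace (H x ^\<^sub>m (n + p - 2)) * ?X x (m - unit_midx p)))" for x
  proof -
    note tr = mtrace_eq_sum[OF pow_mat_carrier[OF H_carrier]]
    have "(\<Sum>a<N. \<Sum>b<N. (\<Sum>s<n - 1. (H x ^\<^sub>m s) $$ (b, b) * (H x ^\<^sub>m (n - 1 - 1 - s)) $$ (a, a)) * ?X x m) =
        (\<Sum>a<N. \<Sum>s<n - 1. mtrace (H x ^\<^sub>m s) * (H x ^\<^sub>m (n - 1 - 1 - s)) $$ (a, a) * ?X x m)"
      unfolding sum_distrib_right tr by (rule sum.cong[OF refl], subst sum.swap, rule refl)
    also have "\<dots> = (\<Sum>s<n - 1. mtrace (H x ^\<^sub>m s) * mtrace (H x ^\<^sub>m (n - 1 - 1 - s)) * ?X x m)"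
      by (subst sum.swap) (simp only: tr[of _ "n - 1 - 1 - _"] sum_distrib_left sum_distrib_right)
    finally have 1: "(\<Sum>a<N. \<Sum>b<N. (\<Sum>s<n - 1. (H x ^\<^sub>m s) $$ (b, b) * (H x ^\<^sub>m (n - 1 - 1 - s)) $$ (a, a)) * ?X x m) =
        (\<Sum>s<n - 1. mtrace (H x ^\<^sub>m s) * mtrace (H x ^\<^sub>m (n - 2 - s)) * ?X x m)"
      by (simp add: numeral_2_eq_2)
    have "(\<Sum>a<N. \<Sum>b<N. (H x ^\<^sub>m (n - 1)) $$ (b, a) * (\<Sum>p\<in>Poly_Mapping.keys m. ?t a b x p)) =
        (\<Sum>p\<in>Poly_Mapping.keys m. \<Sum>a<N. \<Sum>b<N. (H x ^\<^sub>m (n - 1)) $$ (b, a) * ?t a b x p)"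
      unfolding sum_distrib_left by (subst (2) sum.swap, subst (1) sum.swap, rule refl)
    also have "\<dots> = (\<Sum>p\<in>Poly_Mapping.keys m - {0}. \<Sum>a<N. \<Sum>b<N. (H x ^\<^sub>m (n - 1)) $$ (b, a) * ?t a b x p)"
      by (rule sum.mono_neutral_right) (auto simp: vertex_term_def)
    also have "\<dots> = (\<Sum>p\<in>Poly_Mapping.keys m - {0}. of_nat N * (mtrace (H x ^\<^sub>m (n + p - 2)) * ?X x (m - unit_midx p)))"
    proof (rule sum.cong[OF refl])
      fix p assume p: "p \<in> Poly_Mapping.keys m - {0}"
      have "mtrace (H x ^\<^sub>m ((p - 1) + (n - 1))) =
          (\<Sum>a<N. \<Sum>b<N. (H x ^\<^sub>m (p - 1)) $$ (a, b) * (H x ^\<^sub>m (n - 1)) $$ (b, a))"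
        by (rule mtrace_pow_add[OF H_carrier])
      moreover have "p - 1 + (n - 1) = n + p - 2" using p assms by auto
      moreover have "?t a b x p = of_nat N * (H x ^\<^sub>m (p - 1)) $$ (a, b) * ?X x (m - unit_midx p)" for a b
        using p by (auto simp: vertex_term_def trace_weight_def)
      ultimately show "(\<Sum>a<N. \<Sum>b<N. (H x ^\<^sub>m (n - 1)) $$ (b, a) * ?t a b x p) =
          of_nat N * (mtrace (H x ^\<^sub>m (n + p - 2)) * ?X x (m - unit_midx p))"
        by (simp add: sum_distrib_left sum_distrib_right mult_ac)
    qed
    finally show ?thesis using 1 by (simp only: sum.distrib)
  qed
  have "of_nat N * mean (\<lambda>x. mtrace (H x ^\<^sub>m n) * ?X x m) =
      mean (\<lambda>x. \<Sum>a<N. \<Sum>b<N. of_nat N * H x $$ (a, b) * ?f a b x)"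
    unfolding lhs[symmetric] by (rule mean_scale[symmetric])
  also have "\<dots> = (\<Sum>a<N. \<Sum>b<N. mean (\<lambda>x. of_nat N * H x $$ (a, b) * ?f a b x))"
    by (rule mean_sum_sum) (simp only: ibp(2) lessThan_iff)
  also have "\<dots> = (\<Sum>a<N. \<Sum>b<N. mean (?f' a b))"
    by (intro sum.cong refl ibp(3)) simp_all
  also have "\<dots> = mean (\<lambda>x. \<Sum>a<N. \<Sum>b<N. ?f' a b x)"
    by (rule mean_sum_sum[symmetric]) (simp only: ibp(1) lessThan_iff)
  also have "\<dots> = (\<Sum>s<n - 1. mean (\<lambda>x. mtrace (H x ^\<^sub>m s) * mtrace (H x ^\<^sub>m (n - 2 - s)) * ?X x m)) +
      (\<Sum>p\<in>Poly_Mapping.keys m - {0}. of_nat N * mean (\<lambda>x. mtrace (H x ^\<^sub>m (n + p - 2)) * ?X x (m - unit_midx p)))"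
    unfolding rhs by (simp add: mean_add mean_sum has_mean_sum has_mean_scale hm hm2 mean_scale)
  finally show ?thesis unfolding moment_def sum_distrib_left .
qed

end

section \<open>Recursion for the derivatives of the free energy\<close>

text \<open>The series of sum a_p G_(n+p-2) over all p >= 1. The sum is infinite, but each
  coefficient sees only the finitely many p in its monomial.\<close>

definition sshift :: "nat \<Rightarrow> (nat \<Rightarrow> ser) \<Rightarrow> ser" where
  "sshift n G = Ser (\<lambda>m. \<Sum>p\<in>Poly_Mapping.keys m - {0}. coef (G (n + p - 2)) (m - unit_midx p))"

lemma coef_sshift:
  "coef (sshift n G) m = (\<Sum>p\<in>Poly_Mapping.keys m - {0}. coef (G (n + p - 2)) (m - unit_midx p))"
  by (simp add: sshift_def)

lemma midx_add_diff_assoc: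
  fixes u v :: midx
  assumes "p \<in> Poly_Mapping.keys v"
  shows "u + v - unit_midx p = u + (v - unit_midx p)"
proof -
  have "u + v = u + (v - unit_midx p) + unit_midx p"
    using midx_add_diff_unit[OF assms] by (simp add: add.assoc)
  then show ?thesis by simp
qed

text \<open>Multiplication by \<open>z\<close> commutes with multiplication by each variable. It
  serves to pull the partition function out of the vertex term of the loop equation.\<close>

lemma mult_sshift: "z * sshift n G = sshift n (\<lambda>k. z * G k)"
proof (rule ser_eqI)
  fix m
  let ?S = "\<lambda>m :: midx. {(u, v). u + v = m}"
  let ?K = "\<lambda>v :: midx. Poly_Mapping.keys v - {0}"
  have "coef (z * sshift n G) m =
      (\<Sum>y\<in>?S m. \<Sum>p\<in>?K (snd y). coef z (fst y) * coef (G (n + p - 2)) (snd y - unit_midx p))"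
    by (simp add: coef_mult coef_sshift sum_distrib_left case_prod_unfold)
  also have "\<dots> = (\<Sum>(y, p)\<in>Sigma (?S m) (\<lambda>y. ?K (snd y)). coef z (fst y) * coef (G (n + p - 2)) (snd y - unit_midx p))"
    by (rule sum.Sigma) (auto simp: finite_midx_splits)
  also have "\<dots> = (\<Sum>(p, y)\<in>Sigma (?K m) (\<lambda>p. ?S (m - unit_midx p)). coef z (fst y) * coef (G (n + p - 2)) (snd y))"
    by (rule sum.reindex_bij_witness[where j = "\<lambda>((u, v), p). (p, (u, v - unit_midx p))" and
          i = "\<lambda>(p, (u, v)). ((u, v + unit_midx p), p)"])
       (auto simp: midx_add_diff_unit midx_add_diff_assoc keys_midx_add add.assoc[symmetric])
  also have "\<dots> = (\<Sum>p\<in>?K m. \<Sum>y\<in>?S (m - unit_midx p). coef z (fst y) * coef (G (n + p - 2)) (snd y))"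
    by (rule sum.Sigma[symmetric]) (auto simp: finite_midx_splits)
  also have "\<dots> = coef (sshift n (\<lambda>k. z * G k)) m"
    by (simp add: coef_mult coef_sshift case_prod_unfold)
  finally show "coef (z * sshift n G) m = coef (sshift n (\<lambda>k. z * G k)) m" .
qed

section \<open>The Gaussian weight and the series of trace insertions\<close>

context gue
begin

lemma mtrace_H_square:
  "mtrace (H x ^\<^sub>m 2) = complex_of_real (\<Sum>q\<in>coords. mult_coord q * (x q)\<^sup>2)"
proof -
  \<comment> \<open>The diagonal is halved so that \<open>h a b + h b a\<close> is right both on and
    off the diagonal.\<close>
  define h where "h a b = (if a = b then (x (a, b))\<^sup>2 / 2 else (x (a, b))\<^sup>2)" for a b
  have "H x $$ (a, b) * H x $$ (b, a) = complex_of_real (h a b + h b a)" if "a < N" "b < N" for a b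
    using that by (auto simp: herm_mat_def h_def complex_eq_iff power2_eq_square)
  then have "(\<Sum>a<N. \<Sum>b<N. H x $$ (a, b) * H x $$ (b, a)) = complex_of_real (\<Sum>a<N. \<Sum>b<N. h a b + h b a)"
    by simp
  also have "(\<Sum>a<N. \<Sum>b<N. h a b + h b a) = (\<Sum>a<N. \<Sum>b<N. h a b) + (\<Sum>a<N. \<Sum>b<N. h a b)"
    unfolding sum.distrib by (subst (2) sum.swap) (rule refl)
  also have "\<dots> = (\<Sum>a<N. \<Sum>b<N. mult_coord (a, b) * (x (a, b))\<^sup>2)"
    unfolding sum.distrib[symmetric] by (intro sum.cong refl) (simp add: h_def mult_coord_def)
  also have "\<dots> = (\<Sum>q\<in>coords. mult_coord q * (x q)\<^sup>2)"
    by (simp add: sum.cartesian_product coords_def case_prod_unfold)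
  finally have "(\<Sum>a<N. \<Sum>b<N. H x $$ (a, b) * H x $$ (b, a)) = complex_of_real (\<Sum>q\<in>coords. mult_coord q * (x q)\<^sup>2)" .
  moreover have "mtrace (H x ^\<^sub>m (1 + 1)) = (\<Sum>a<N. \<Sum>b<N. (H x ^\<^sub>m 1) $$ (a, b) * (H x ^\<^sub>m 1) $$ (b, a))"
    by (rule mtrace_pow_add[OF H_carrier])
  moreover have "H x ^\<^sub>m 1 = H x" using H_carrier[of x] by simp
  ultimately show ?thesis by (simp only: one_add_one)
qed

definition gauss_norm :: real where
  "gauss_norm = (\<Prod>q\<in>coords. sqrt (2 * pi * (std q)\<^sup>2))"

lemma gauss_norm_pos: "gauss_norm > 0"
  unfolding gauss_norm_def
proof (rule prod_pos)
  fix q assume "q \<in> coords"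
  from \<sigma>_pos[OF this] show "0 < sqrt (2 * pi * (std q)\<^sup>2)" by simp
qed

lemma gauss_weight_H: "gauss_weight N (H x) = complex_of_real (gauss_norm * density x)"
proof -
  have "gauss_norm * density x = (\<Prod>q\<in>coords. sqrt (2 * pi * (std q)\<^sup>2) * normal_density 0 (std q) (x q))"
    by (simp add: gauss_norm_def density_def prod.distrib)
  also have "\<dots> = (\<Prod>q\<in>coords. exp (- (real N * (mult_coord q * (x q)\<^sup>2) / 2)))"
  proof (rule prod.cong[OF refl])
    fix q assume "q \<in> coords"
    then have "std q > 0" by (rule \<sigma>_pos)
    then have "sqrt (2 * pi * (std q)\<^sup>2) * normal_density 0 (std q) (x q) = exp (- ((x q)\<^sup>2 / (2 * (std q)\<^sup>2)))"
      by (simp add: normal_density_def)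
    also have "(x q)\<^sup>2 / (2 * (std q)\<^sup>2) = real N * (mult_coord q * (x q)\<^sup>2) / 2"
      using N_pos mult_coord_pos[of q] by (simp add: std_sq)
    finally show "sqrt (2 * pi * (std q)\<^sup>2) * normal_density 0 (std q) (x q) = exp (- (real N * (mult_coord q * (x q)\<^sup>2) / 2))" .
  qed
  also have "\<dots> = exp (- (real N * (\<Sum>q\<in>coords. mult_coord q * (x q)\<^sup>2) / 2))"
    using finite_I by (simp add: exp_sum[symmetric] sum_distrib_left sum_divide_distrib sum_negf[symmetric])
  finally have "complex_of_real (gauss_norm * density x) =
      exp (complex_of_real (- (real N * (\<Sum>q\<in>coords. mult_coord q * (x q)\<^sup>2) / 2)))"
    by (simp only: exp_of_real)
  then show ?thesis by (simp add: gauss_weight_def mtrace_H_square del: of_real_sum)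
qed

lemma herm_integral_gauss: "herm_integral N (\<lambda>A. f A * gauss_weight N A) = complex_of_real gauss_norm * moment f"
proof -
  have "(\<lambda>x. f (H x) * gauss_weight N (H x)) =
      (\<lambda>x. complex_of_real gauss_norm * (complex_of_real (density x) * f (H x)))"
    by (simp add: gauss_weight_H mult_ac)
  then show ?thesis
    unfolding herm_integral_def coords_def[symmetric] moment_def mean_def by simp
qed

lemma partition_series_eq: "partition_series N m = moment (\<lambda>A. vertex_poly N A m)"
proof -
  have "herm_integral N (gauss_weight N) = complex_of_real gauss_norm"
    using herm_integral_gauss[of "\<lambda>_. 1"] by (simp add: moment_def mean_const)
  then show ?thesis
    using herm_integral_gauss[of "\<lambda>A. vertex_poly N A m"] gauss_norm_pos
    by (simp add: partition_series_def vertex_poly_def)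
qed

definition Z :: ser where
  "Z = Ser (partition_series N)"

definition Z1 :: "nat \<Rightarrow> ser" where
  "Z1 n = Ser (\<lambda>m. moment (\<lambda>A. mtrace (A ^\<^sub>m n) * vertex_poly N A m))"

definition Z2 :: "nat \<Rightarrow> nat \<Rightarrow> ser" where
  "Z2 j l = Ser (\<lambda>m. moment (\<lambda>A. mtrace (A ^\<^sub>m j) * mtrace (A ^\<^sub>m l) * vertex_poly N A m))"

lemma moment_scale: "moment (\<lambda>A. c * f A) = c * moment f"
  by (simp add: moment_def mean_scale)

lemma moment_vertex_poly_add_unit:
  "of_nat (Suc (Poly_Mapping.lookup m n)) * moment (\<lambda>A. f A * vertex_poly N A (m + unit_midx n)) =
   trace_weight N n * moment (\<lambda>A. f A * mtrace (A ^\<^sub>m n) * vertex_poly N A m)"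
proof -
  have "(\<lambda>A. of_nat (Suc (Poly_Mapping.lookup m n)) * (f A * vertex_poly N A (m + unit_midx n))) =
      (\<lambda>A. trace_weight N n * (f A * mtrace (A ^\<^sub>m n) * vertex_poly N A m))"
  proof
    fix A
    show "of_nat (Suc (Poly_Mapping.lookup m n)) * (f A * vertex_poly N A (m + unit_midx n)) =
        trace_weight N n * (f A * mtrace (A ^\<^sub>m n) * vertex_poly N A m)"
      using vertex_poly_add_unit[of m n N A] by (simp only: mult.left_commute mult.assoc)
  qed
  then show ?thesis by (simp only: moment_scale[symmetric])
qed

lemma coef_Z_0: "coef Z 0 = 1"
  by (simp add: Z_def partition_series_eq moment_def mean_const)

lemma sderiv_Z: "sderiv n Z = sconst (trace_weight N n) * Z1 n"
  using moment_vertex_poly_add_unit[of _ n "\<lambda>_. 1"]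
  by (intro ser_eqI) (simp add: coef_sderiv Z_def Z1_def partition_series_eq)

lemma sderiv_Z1: "sderiv l (Z1 j) = sconst (trace_weight N l) * Z2 j l"
  using moment_vertex_poly_add_unit[of _ l]
  by (intro ser_eqI) (simp add: coef_sderiv Z1_def Z2_def)

lemma moment_trace_pow_0: "moment (\<lambda>A. f A * mtrace (A ^\<^sub>m 0) * g A) = of_nat N * moment (\<lambda>A. f A * g A)"
proof -
  have "(\<lambda>x. f (H x) * mtrace (H x ^\<^sub>m 0) * g (H x)) = (\<lambda>x. of_nat N * (f (H x) * g (H x)))"
    by (simp add: mtrace_pow_0[OF H_carrier] mult_ac del: pow_mat.simps)
  then show ?thesis by (simp add: moment_def mean_scale)
qed

lemma Z1_0: "Z1 0 = sconst (of_nat N) * Z"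
  using moment_trace_pow_0[of "\<lambda>_. 1"]
  by (intro ser_eqI) (simp add: Z1_def Z_def partition_series_eq del: pow_mat.simps)

lemma Z2_0: "Z2 j 0 = sconst (of_nat N) * Z1 j"
  using moment_trace_pow_0[of "\<lambda>A. mtrace (A ^\<^sub>m j)"]
  by (intro ser_eqI) (simp add: Z1_def Z2_def del: pow_mat.simps)

definition free_energy :: ser where
  "free_energy = Ser (mps_log (partition_series N))"

text \<open>The normalised insertion of \<open>Tr (M ^ n)\<close>: this is \<open>V\<^sub>n\<close>, and \<open>Z1 n = N * Z * V\<^sub>n\<close>.\<close>

definition disk :: "nat \<Rightarrow> ser" where
  "disk n = (if n = 0 then 1 else sconst (of_nat n / (of_nat N)\<^sup>2) * sderiv n free_energy)"

lemma Z_mult_sderiv_free_energy: "Z * sderiv n free_energy = sderiv n Z"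
  using mult_sderiv_mps_log[OF coef_Z_0, of n] by (simp add: free_energy_def Z_def)

lemma N_nonzero: "(of_nat N :: complex) \<noteq> 0"
  using N_pos by simp

lemma Z_mult_disk: "Z * disk n = sconst (1 / of_nat N) * Z1 n"
proof (cases "n = 0")
  case True
  then show ?thesis using N_nonzero by (simp add: disk_def Z1_0 sconst_mult_sconst)
next
  case False
  then have "Z * disk n = sconst (of_nat n / (of_nat N)\<^sup>2) * (Z * sderiv n free_energy)"
    by (simp add: disk_def mult.left_commute)
  also have "\<dots> = sconst (of_nat n / (of_nat N)\<^sup>2 * trace_weight N n) * Z1 n"
    by (simp only: Z_mult_sderiv_free_energy sderiv_Z sconst_mult_sconst)
  also have "of_nat n / (of_nat N)\<^sup>2 * trace_weight N n = 1 / of_nat N"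
    using False N_nonzero by (simp add: trace_weight_def power2_eq_square)
  finally show ?thesis .
qed

lemma Z1_eq: "Z1 n = sconst (of_nat N) * (Z * disk n)"
  using N_nonzero by (simp add: Z_mult_disk sconst_mult_sconst)

text \<open>Differentiating \<open>Z1 j = N * Z * disk j\<close> in the \<open>l\<close>-th variable
  inserts a second trace. The derivative of \<open>Z\<close> yields the factorised part, that of
  \<open>disk j\<close> the connected part, which lacks the factor \<open>N\<close> squared. At
  \<open>l = 0\<close> there is no variable to differentiate in, and the second trace is the
  constant \<open>N\<close>.\<close>

lemma Z2_eq: "Z2 j l = Z * (sconst ((of_nat N)\<^sup>2) * (disk j * disk l) + sconst (of_nat l) * sderiv l (disk j))"
proof (cases "l = 0")
  case True
  have "sconst 0 = 0" by (rule ser_eqI) (simp add: coef_sconst)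
  then show ?thesis
    using True by (simp add: Z2_0 Z1_eq disk_def sconst_mult_sconst power2_eq_square mult.left_commute)
next
  case False
  have "Z2 j l = sconst (of_nat l / of_nat N) * sderiv l (Z1 j)"
    using False N_nonzero by (simp add: sderiv_Z1 sconst_mult_sconst trace_weight_def)
  also have "\<dots> = sconst (of_nat l) * (sderiv l Z * disk j + Z * sderiv l (disk j))"
    using N_nonzero by (simp add: Z1_eq sderiv_mult sconst_mult_sconst)
  also have "\<dots> = Z * ((sconst (of_nat l) * sderiv l free_energy) * disk j + sconst (of_nat l) * sderiv l (disk j))"
    by (simp add: Z_mult_sderiv_free_energy[symmetric] algebra_simps)
  also have "sconst (of_nat l) * sderiv l free_energy = sconst ((of_nat N)\<^sup>2) * disk l"
    using False N_nonzero by (simp add: disk_def sconst_mult_sconst)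
  finally show ?thesis by (simp add: mult_ac)
qed

text \<open>The loop equation divided by \<open>N\<close> squared and by \<open>Z\<close>; after
  this division the connected part carries the factor 1 / N^2.\<close>

theorem disk_recursion:
  assumes "n \<ge> 1"
  shows "coef (disk n) m =
    (\<Sum>s<n - 1. coef (disk s * disk (n - 2 - s)) m +
       1 / (of_nat N)\<^sup>2 * (of_nat (n - 2 - s) * of_nat (Suc (Poly_Mapping.lookup m (n - 2 - s))) *
         coef (disk s) (m + unit_midx (n - 2 - s)))) +
    (\<Sum>p\<in>Poly_Mapping.keys m - {0}. coef (disk (n + p - 2)) (m - unit_midx p))"
proof -
  let ?R = "\<lambda>s. sconst ((of_nat N)\<^sup>2) * (disk s * disk (n - 2 - s)) +
      sconst (of_nat (n - 2 - s)) * sderiv (n - 2 - s) (disk s)"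
  have "sconst (of_nat N) * Z1 n = (\<Sum>s<n - 1. Z2 s (n - 2 - s)) + sconst (of_nat N) * sshift n Z1"
    using loop_equation[OF assms] by (intro ser_eqI) (simp add: Z1_def Z2_def coef_sshift)
  also have "sshift n Z1 = sconst (of_nat N) * (Z * sshift n disk)"
    unfolding Z1_eq[abs_def] mult_sshift ..
  finally have "Z * (sconst ((of_nat N)\<^sup>2) * disk n) = Z * ((\<Sum>s<n - 1. ?R s) + sconst ((of_nat N)\<^sup>2) * sshift n disk)"
    unfolding Z1_eq Z2_eq by (simp add: sconst_mult_sconst power2_eq_square distrib_left sum_distrib_left mult.left_commute[of Z])
  then have "sconst ((of_nat N)\<^sup>2) * disk n = (\<Sum>s<n - 1. ?R s) + sconst ((of_nat N)\<^sup>2) * sshift n disk"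
    using ser_mult_left_cancel[of Z] coef_Z_0 by simp
  then have "coef (sconst ((of_nat N)\<^sup>2) * disk n) m = coef ((\<Sum>s<n - 1. ?R s) + sconst ((of_nat N)\<^sup>2) * sshift n disk) m"
    by simp
  then have "(of_nat N)\<^sup>2 * coef (disk n) m = (of_nat N)\<^sup>2 * ((\<Sum>s<n - 1. coef (disk s * disk (n - 2 - s)) m +
       1 / (of_nat N)\<^sup>2 * (of_nat (n - 2 - s) * of_nat (Suc (Poly_Mapping.lookup m (n - 2 - s))) *
         coef (disk s) (m + unit_midx (n - 2 - s)))) +
    (\<Sum>p\<in>Poly_Mapping.keys m - {0}. coef (disk (n + p - 2)) (m - unit_midx p)))"
    using N_nonzero
    by (simp add: coef_sderiv coef_sshift distrib_left sum_distrib_left del: of_nat_Suc)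
       (simp add: mult.assoc del: of_nat_Suc)
  then show ?thesis using N_nonzero by (simp del: of_nat_Suc)
qed

lemma coef_disk_0: "coef (disk 0) m = (if m = 0 then 1 else 0)"
  by (simp add: disk_def coef_one)

lemma free_energy_coef:
  assumes "n \<in> Poly_Mapping.keys m" "n \<noteq> 0"
  shows "mps_log (partition_series N) m =
    (of_nat N)\<^sup>2 / (of_nat n * of_nat (Poly_Mapping.lookup m n)) * coef (disk n) (m - unit_midx n)"
proof -
  have "Suc (Poly_Mapping.lookup (m - unit_midx n) n) = Poly_Mapping.lookup m n"
    using assms by (simp add: lookup_minus lookup_unit_midx in_keys_iff)
  then have "coef (disk n) (m - unit_midx n) =
      of_nat n / (of_nat N)\<^sup>2 * (of_nat (Poly_Mapping.lookup m n) * mps_log (partition_series N) m)"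
    using assms midx_add_diff_unit[OF assms(1)]
    by (simp add: disk_def coef_sderiv free_energy_def del: of_nat_Suc)
  then show ?thesis using assms N_nonzero by (simp add: in_keys_iff)
qed

text \<open>The phantom variable has trace weight 0, so the derivative of log Z in it
  vanishes.\<close>

lemma free_energy_coef_0:
  assumes "Poly_Mapping.keys m \<subseteq> {0}"
  shows "mps_log (partition_series N) m = 0"
proof (cases "m = 0")
  case True
  then show ?thesis by (simp add: mps_log_def)
next
  case False
  then have 0: "0 \<in> Poly_Mapping.keys m" using assms by (metis keys_eq_empty subset_singleton_iff singletonI)
  have "Z * sderiv 0 free_energy = Z * 0"
    unfolding Z_mult_sderiv_free_energy sderiv_Z by (rule ser_eqI) (simp add: trace_weight_def)
  then have "sderiv 0 free_energy = 0"
    using ser_mult_left_cancel[of Z] coef_Z_0 by simp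
  then have "coef (sderiv 0 free_energy) (m - unit_midx 0) = 0" by simp
  then show ?thesis using midx_add_diff_unit[OF 0] by (simp add: coef_sderiv free_energy_def del: of_nat_Suc)
qed

end

section \<open>The genus expansion\<close>

text \<open>Counts half-edges at the vertices. In the recursion the measure
  \<open>n + wdeg m\<close> decreases, whereas \<open>mdeg\<close> can grow, since the derivative
  term adds a variable.\<close>

definition wdeg :: "midx \<Rightarrow> nat" where
  "wdeg m = (\<Sum>n\<in>Poly_Mapping.keys m. n * Poly_Mapping.lookup m n)"

lemma wdeg_eq_sum:
  assumes "finite S" "Poly_Mapping.keys m \<subseteq> S"
  shows "wdeg m = (\<Sum>n\<in>S. n * Poly_Mapping.lookup m n)"
  unfolding wdeg_def using assms by (intro sum.mono_neutral_left) (auto simp: in_keys_iff)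

lemma wdeg_add: "wdeg (p + q) = wdeg p + wdeg q"
proof -
  let ?S = "Poly_Mapping.keys p \<union> Poly_Mapping.keys q"
  have "wdeg (p + q) = (\<Sum>n\<in>?S. n * Poly_Mapping.lookup (p + q) n)"
    by (rule wdeg_eq_sum) (auto simp: keys_midx_add)
  also have "\<dots> = wdeg p + wdeg q"
    by (subst (1 2) wdeg_eq_sum[where S = ?S]) (auto simp: lookup_add sum.distrib distrib_left)
  finally show ?thesis .
qed

lemma wdeg_unit [simp]: "wdeg (unit_midx n) = n"
  by (simp add: wdeg_def lookup_unit_midx)

lemma wdeg_diff_unit:
  assumes "p \<in> Poly_Mapping.keys m"
  shows "wdeg (m - unit_midx p) + p = wdeg m"
  using wdeg_add[of "m - unit_midx p" "unit_midx p"] midx_add_diff_unit[OF assms] by simp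

section \<open>Rational polynomials in 1 / N^2\<close>

abbreviation rat_poly :: "rat poly \<Rightarrow> complex poly" where
  "rat_poly P \<equiv> map_poly of_rat P"

lemma rat_poly_0 [simp]: "rat_poly 0 = 0"
  and rat_poly_add [simp]: "rat_poly (P + Q) = rat_poly P + rat_poly Q"
  and rat_poly_mult [simp]: "rat_poly (P * Q) = rat_poly P * rat_poly Q"
  and rat_poly_const [simp]: "rat_poly [:c:] = [:of_rat c:]"
  and rat_poly_smult [simp]: "rat_poly (Polynomial.smult c P) = Polynomial.smult (of_rat c) (rat_poly P)"
  and rat_poly_pCons_0 [simp]: "rat_poly (pCons 0 P) = pCons 0 (rat_poly P)"
  by (simp_all add: poly_eq_iff coeff_map_poly of_rat_add coeff_mult of_rat_sum of_rat_mult coeff_pCons split: nat.splits)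

lemma rat_poly_sum: "rat_poly (\<Sum>a\<in>A. P a) = (\<Sum>a\<in>A. rat_poly (P a))"
  by (induction A rule: infinite_finite_induct) auto

lemma inj_inverse_square: "inj_on (\<lambda>N :: nat. 1 / (of_nat N :: complex)\<^sup>2) {1..}"
proof (rule inj_onI)
  fix x y :: nat
  assume *: "x \<in> {1..}" "y \<in> {1..}" "1 / (of_nat x :: complex)\<^sup>2 = 1 / (of_nat y)\<^sup>2"
  then have "(of_nat (x\<^sup>2) :: complex) = of_nat (y\<^sup>2)" by (simp add: divide_simps)
  then have "x\<^sup>2 = y\<^sup>2" by (simp only: of_nat_eq_iff)
  then show "x = y" by simp
qed

text \<open>1 / N^2 takes infinitely many values, more than a nonzero polynomial has roots.
  Uniqueness of the genus expansion rests on this.\<close>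

lemma rat_poly_unique:
  assumes "\<And>N. N \<ge> 1 \<Longrightarrow> poly (rat_poly P) (1 / (of_nat N)\<^sup>2) = poly (rat_poly Q) (1 / (of_nat N)\<^sup>2)"
  shows "P = Q"
proof -
  let ?h = "\<lambda>N :: nat. 1 / (of_nat N :: complex)\<^sup>2"
  have "rat_poly P = rat_poly Q"
  proof (rule ccontr)
    assume "rat_poly P \<noteq> rat_poly Q"
    then have "finite {x. poly (rat_poly P - rat_poly Q) x = 0}"
      by (intro poly_roots_finite) simp
    moreover have "?h ` {1..} \<subseteq> {x. poly (rat_poly P - rat_poly Q) x = 0}"
      using assms by auto
    ultimately have "finite (?h ` {1..})" by (rule finite_subset[rotated])
    then have "finite {1 :: nat..}" using inj_inverse_square finite_image_iff by blast
    then show False using infinite_Ici by blast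
  qed
  then show ?thesis
    by (simp add: poly_eq_iff coeff_map_poly)
qed

text \<open>The polynomial variable stands for 1 / N^2, so its exponent is the genus.\<close>

definition represents :: "(nat \<Rightarrow> complex) \<Rightarrow> rat poly \<Rightarrow> bool" where
  "represents f P \<longleftrightarrow> (\<forall>N\<ge>1. f N = poly (rat_poly P) (1 / (of_nat N)\<^sup>2))"

lemma represents_unique: "represents f P \<Longrightarrow> represents f Q \<Longrightarrow> P = Q"
  unfolding represents_def by (rule rat_poly_unique) metis

lemma represents_add: "represents f P \<Longrightarrow> represents g Q \<Longrightarrow> represents (\<lambda>N. f N + g N) (P + Q)"
  by (simp add: represents_def)

lemma represents_mult: "represents f P \<Longrightarrow> represents g Q \<Longrightarrow> represents (\<lambda>N. f N * g N) (P * Q)"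
  by (simp add: represents_def)

lemma represents_const: "represents (\<lambda>_. of_rat c) [:c:]"
  by (simp add: represents_def)

lemma represents_of_nat: "represents (\<lambda>_. of_nat k) [:of_nat k:]"
  by (simp add: represents_def of_rat_of_nat_eq)

lemma represents_inverse_square: "represents f P \<Longrightarrow> represents (\<lambda>N. 1 / (of_nat N)\<^sup>2 * f N) (pCons 0 P)"
  by (simp add: represents_def)

lemma represents_sum:
  "(\<And>a. a \<in> A \<Longrightarrow> represents (f a) (P a)) \<Longrightarrow> represents (\<lambda>N. \<Sum>a\<in>A. f a N) (\<Sum>a\<in>A. P a)"
  by (simp add: represents_def rat_poly_sum poly_sum)

lemma represents_cong: "represents f P \<Longrightarrow> (\<And>N. N \<ge> 1 \<Longrightarrow> f N = g N) \<Longrightarrow> represents g P"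
  by (simp add: represents_def)

definition disk_poly :: "nat \<Rightarrow> midx \<Rightarrow> rat poly" where
  "disk_poly n m = (SOME P. represents (\<lambda>N. coef (gue.disk N n) m) P)"

text \<open>The right side of \<open>disk_recursion\<close> at the level of polynomials;
  \<open>pCons 0\<close> is multiplication by 1 / N^2 and raises the genus by one.\<close>

definition disk_step :: "(nat \<Rightarrow> midx \<Rightarrow> rat poly) \<Rightarrow> nat \<Rightarrow> midx \<Rightarrow> rat poly" where
  "disk_step P n m =
    (\<Sum>s<n - 1. (\<Sum>(p, q)\<in>{(p, q). p + q = m}. P s p * P (n - 2 - s) q) +
       pCons 0 ([:of_nat ((n - 2 - s) * Suc (Poly_Mapping.lookup m (n - 2 - s))):] *
         P s (m + unit_midx (n - 2 - s)))) +
    (\<Sum>p\<in>Poly_Mapping.keys m - {0}. P (n + p - 2) (m - unit_midx p))"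

lemma represents_disk_step:
  assumes "n \<ge> 1"
    and IH: "\<And>k q. k + wdeg q < n + wdeg m \<Longrightarrow> represents (\<lambda>N. coef (gue.disk N k) q) (P k q)"
  shows "represents (\<lambda>N. coef (gue.disk N n) m) (disk_step P n m)"
proof (rule represents_cong)
  show "represents (\<lambda>N. (\<Sum>s<n - 1.
       (\<Sum>y\<in>{(p, q). p + q = m}. coef (gue.disk N s) (fst y) * coef (gue.disk N (n - 2 - s)) (snd y)) +
       1 / (of_nat N)\<^sup>2 * (of_nat ((n - 2 - s) * Suc (Poly_Mapping.lookup m (n - 2 - s))) *
         coef (gue.disk N s) (m + unit_midx (n - 2 - s)))) +
    (\<Sum>p\<in>Poly_Mapping.keys m - {0}. coef (gue.disk N (n + p - 2)) (m - unit_midx p))) (disk_step P n m)"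
    unfolding disk_step_def case_prod_unfold
  proof (intro represents_add represents_sum represents_mult represents_inverse_square represents_of_nat IH)
    fix s y assume "s \<in> {..<n - 1}" "y \<in> {y :: midx \<times> midx. fst y + snd y = m}"
    then show "s + wdeg (fst y) < n + wdeg m" "n - 2 - s + wdeg (snd y) < n + wdeg m"
      by (auto simp: wdeg_add)
  next
    fix s assume "s \<in> {..<n - 1}"
    then show "s + wdeg (m + unit_midx (n - 2 - s)) < n + wdeg m" by (auto simp: wdeg_add)
  next
    fix p assume "p \<in> Poly_Mapping.keys m - {0}"
    then show "n + p - 2 + wdeg (m - unit_midx p) < n + wdeg m"
      using wdeg_diff_unit[of p m] assms(1) by auto
  qed
next
  fix N :: nat assume "N \<ge> 1"
  then interpret gue N by unfold_locales
  show "(\<Sum>s<n - 1.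
       (\<Sum>y\<in>{(p, q). p + q = m}. coef (gue.disk N s) (fst y) * coef (gue.disk N (n - 2 - s)) (snd y)) +
       1 / (of_nat N)\<^sup>2 * (of_nat ((n - 2 - s) * Suc (Poly_Mapping.lookup m (n - 2 - s))) *
         coef (gue.disk N s) (m + unit_midx (n - 2 - s)))) +
    (\<Sum>p\<in>Poly_Mapping.keys m - {0}. coef (gue.disk N (n + p - 2)) (m - unit_midx p)) =
    coef (gue.disk N n) m"
    unfolding disk_recursion[OF assms(1), of m] coef_mult case_prod_unfold of_nat_mult ..
qed

text \<open>\<open>disk_poly\<close> is a choice, so existence is what needs proof. The induction
  hypothesis says that the earlier choices are good, and \<open>disk_step\<close> builds a witness
  from them.\<close>

lemma represents_disk: "represents (\<lambda>N. coef (gue.disk N n) m) (disk_poly n m)"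
proof (induction "n + wdeg m" arbitrary: n m rule: less_induct)
  case less
  have "\<exists>P. represents (\<lambda>N. coef (gue.disk N n) m) P"
  proof (cases "n = 0")
    case True
    have "represents (\<lambda>N. coef (gue.disk N 0) m) [:of_bool (m = 0):]"
      by (rule represents_cong[OF represents_const]) (auto simp: gue.coef_disk_0 gue_def)
    then show ?thesis using True by blast
  next
    case False
    then have "represents (\<lambda>N. coef (gue.disk N n) m) (disk_step disk_poly n m)"
      using less by (intro represents_disk_step) auto
    then show ?thesis by blast
  qed
  then show ?case unfolding disk_poly_def by (rule someI_ex)
qed

lemma disk_poly_0: "disk_poly 0 m = [:of_bool (m = 0):]"
  by (rule represents_unique[OF represents_disk], rule represents_cong[OF represents_const])
     (auto simp: gue.coef_disk_0 gue_def)

lemma disk_poly_rec: "n \<ge> 1 \<Longrightarrow> disk_poly n m = disk_step disk_poly n m"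
  by (rule represents_unique[OF represents_disk represents_disk_step]) (auto intro: represents_disk)

definition planar_disk :: "nat \<Rightarrow> midx \<Rightarrow> rat" where
  "planar_disk n m = coeff (disk_poly n m) 0"

lemma planar_disk_0: "planar_disk 0 m = of_bool (m = 0)"
  by (simp add: planar_disk_def disk_poly_0)

text \<open>Tutte's recursion for rooted planar maps with a root face of degree \<open>n\<close>.\<close>

lemma planar_disk_rec:
  assumes "n \<ge> 1"
  shows "planar_disk n m =
    (\<Sum>s<n - 1. \<Sum>(p, q)\<in>{(p, q). p + q = m}. planar_disk s p * planar_disk (n - 2 - s) q) +
    (\<Sum>p\<in>Poly_Mapping.keys m - {0}. planar_disk (n + p - 2) (m - unit_midx p))"
proof -
  \<comment> \<open>Evaluation at 0 respects sums and products and removes the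
    \<open>pCons 0\<close> term.\<close>
  have "planar_disk n m = poly (disk_step disk_poly n m) 0"
    using assms by (simp add: planar_disk_def poly_0_coeff_0 disk_poly_rec)
  also have "\<dots> = (\<Sum>s<n - 1. \<Sum>(p, q)\<in>{(p, q). p + q = m}. planar_disk s p * planar_disk (n - 2 - s) q) +
    (\<Sum>p\<in>Poly_Mapping.keys m - {0}. planar_disk (n + p - 2) (m - unit_midx p))"
    unfolding disk_step_def planar_disk_def poly_0_coeff_0[symmetric]
    by (simp add: poly_sum case_prod_unfold)
  finally show ?thesis .
qed

lemma planar_disk_nonneg: "planar_disk n m \<ge> 0"
proof (induction "n + wdeg m" arbitrary: n m rule: less_induct)
  case less
  show ?case
  proof (cases "n = 0")
    case False
    have "planar_disk s p * planar_disk (n - 2 - s) q \<ge> 0" if "s < n - 1" "p + q = m" for s p q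
      using that by (intro mult_nonneg_nonneg less) (auto simp: wdeg_add)
    moreover have "planar_disk (n + p - 2) (m - unit_midx p) \<ge> 0" if "p \<in> Poly_Mapping.keys m - {0}" for p
      using that False wdeg_diff_unit[of p m] by (intro less) auto
    ultimately have "0 \<le> (\<Sum>s<n - 1. \<Sum>(p, q)\<in>{(p, q). p + q = m}. planar_disk s p * planar_disk (n - 2 - s) q) +
        (\<Sum>p\<in>Poly_Mapping.keys m - {0}. planar_disk (n + p - 2) (m - unit_midx p))"
      by (intro add_nonneg_nonneg sum_nonneg) (auto simp only: lessThan_iff mem_Collect_eq split: prod.splits)
    then show ?thesis using False planar_disk_rec[of n m] by simp
  qed (simp add: planar_disk_0)
qed

text \<open>The maximum is an arbitrary choice: by \<open>free_energy_coef\<close> every nonzero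
  index in the support gives the same coefficient of log Z.\<close>

definition free_energy_poly :: "midx \<Rightarrow> rat poly" where
  "free_energy_poly m = (if Poly_Mapping.keys m \<subseteq> {0} then 0 else
     let n = Max (Poly_Mapping.keys m) in
       [:1 / of_nat (n * Poly_Mapping.lookup m n):] * disk_poly n (m - unit_midx n))"

lemma Max_keys:
  assumes "\<not> Poly_Mapping.keys (m :: midx) \<subseteq> {0}"
  shows "Max (Poly_Mapping.keys m) \<in> Poly_Mapping.keys m" "Max (Poly_Mapping.keys m) \<noteq> 0"
proof -
  obtain k where k: "k \<in> Poly_Mapping.keys m" "k \<noteq> 0" using assms by auto
  then show "Max (Poly_Mapping.keys m) \<in> Poly_Mapping.keys m" by (intro Max_in) auto
  have "k \<le> Max (Poly_Mapping.keys m)" using k by (intro Max_ge) auto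
  then show "Max (Poly_Mapping.keys m) \<noteq> 0" using k(2) by linarith
qed

lemma free_energy_poly_eval:
  assumes "N \<ge> 1"
  shows "mps_log (partition_series N) m = (of_nat N)\<^sup>2 * poly (rat_poly (free_energy_poly m)) (1 / (of_nat N)\<^sup>2)"
proof -
  interpret gue N using assms by unfold_locales
  show ?thesis
  proof (cases "Poly_Mapping.keys m \<subseteq> {0}")
    case True
    then show ?thesis by (simp add: free_energy_poly_def free_energy_coef_0)
  next
    case False
    have "coef (disk n) q = poly (rat_poly (disk_poly n q)) (1 / (of_nat N)\<^sup>2)" for n q
      using represents_disk[of n q] assms by (simp add: represents_def)
    then show ?thesis
      using False Max_keys[OF False] unfolding free_energy_poly_def
      by (simp add: free_energy_coef[of "Max (Poly_Mapping.keys m)"] Let_def of_rat_divide of_rat_mult of_rat_of_nat_eq)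
  qed
qed

lemma genus_sum_eq_poly:
  assumes "finite {g. c g \<noteq> (0 :: rat)}" "N \<ge> 1"
  shows "(\<Sum>g\<in>{g. c g \<noteq> 0}. of_nat N powi (2 - 2 * int g) * of_rat (c g)) =
    (of_nat N)\<^sup>2 * poly (rat_poly (\<Sum>g\<in>{g. c g \<noteq> 0}. monom (c g) g)) (1 / (of_nat N)\<^sup>2 :: complex)"
proof -
  have "(of_nat N :: complex) powi (2 - 2 * int g) = (of_nat N)\<^sup>2 * (1 / (of_nat N)\<^sup>2) ^ g" for g
    using assms(2) by (simp add: power_int_diff power_int_mult power_divide)
  moreover have "rat_poly (monom a g) = monom (of_rat a) g" for a g
    by (simp add: poly_eq_iff coeff_map_poly)
  ultimately show ?thesis
    by (simp add: rat_poly_sum poly_sum poly_monom sum_distrib_left mult_ac)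
qed

lemma coeff_sum_monom:
  assumes "finite {g. c g \<noteq> (0 :: rat)}"
  shows "coeff (\<Sum>g\<in>{g. c g \<noteq> 0}. monom (c g) g) k = c k"
  using assms by (simp add: coeff_sum)

text \<open>For fixed \<open>m\<close> both expansions are polynomials in 1 / N^2 that agree for all
  N >= 1. This gives the existence and the uniqueness that \<open>THE\<close> in
  \<open>genus_series\<close> requires.\<close>

lemma genus_expansion_iff: "genus_expansion F \<longleftrightarrow> (\<forall>g m. F g m = coeff (free_energy_poly m) g)"
proof
  assume F: "genus_expansion F"
  show "\<forall>g m. F g m = coeff (free_energy_poly m) g"
  proof (intro allI)
    fix g m
    let ?S = "{g. F g m \<noteq> 0}"
    have fin: "finite ?S" using F by (simp add: genus_expansion_def)
    have "(\<Sum>g\<in>?S. monom (F g m) g) = free_energy_poly m"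
    proof (rule rat_poly_unique)
      fix N :: nat assume N: "N \<ge> 1"
      then have "mps_log (partition_series N) m = (\<Sum>g\<in>?S. of_nat N powi (2 - 2 * int g) * of_rat (F g m))"
        using F by (simp add: genus_expansion_def)
      then show "poly (rat_poly (\<Sum>g\<in>?S. monom (F g m) g)) (1 / (of_nat N)\<^sup>2) =
          poly (rat_poly (free_energy_poly m)) (1 / (of_nat N)\<^sup>2)"
        unfolding free_energy_poly_eval[OF N] genus_sum_eq_poly[OF fin N] using N by simp
    qed
    then show "F g m = coeff (free_energy_poly m) g"
      using coeff_sum_monom[OF fin, of g] by simp
  qed
next
  assume F: "\<forall>g m. F g m = coeff (free_energy_poly m) g"
  show "genus_expansion F"
    unfolding genus_expansion_def
  proof (intro allI conjI impI)
    fix m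
    have "{g. F g m \<noteq> 0} \<subseteq> {..degree (free_energy_poly m)}"
      using F by (auto intro: le_degree)
    then show fin: "finite {g. F g m \<noteq> 0}" by (rule finite_subset) simp
    fix N :: nat assume N: "N \<ge> 1"
    have "(\<Sum>g\<in>{g. F g m \<noteq> 0}. monom (F g m) g) = free_energy_poly m"
      using coeff_sum_monom[OF fin] F by (simp add: poly_eq_iff)
    then show "mps_log (partition_series N) m =
        (\<Sum>g\<in>{g. F g m \<noteq> 0}. of_nat N powi (2 - 2 * int g) * of_rat (F g m))"
      unfolding genus_sum_eq_poly[OF fin N] free_energy_poly_eval[OF N] by simp
  qed
qed

lemma planar_limit_eq: "planar_limit m = coeff (free_energy_poly m) 0"
proof -
  have "genus_series = (\<lambda>g m. coeff (free_energy_poly m) g)"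
    unfolding genus_series_def by (rule the_equality) (auto simp: genus_expansion_iff fun_eq_iff)
  from fun_cong[OF fun_cong[OF this], of 0 m] show ?thesis unfolding planar_limit_def .
qed

text \<open>A coefficient of F_0 is one of V_n divided by a positive integer. Tutte's recursion at
  \<open>n = 2\<close> contains the sum of a_p V_p over all p, so V_2 dominates each of these terms
  with no shift of the monomial.\<close>

theorem planar_limit_bounds: "0 \<le> planar_limit m" "planar_limit m \<le> planar_disk 2 m"
proof -
  have "0 \<le> planar_limit m \<and> planar_limit m \<le> planar_disk 2 m"
  proof (cases "Poly_Mapping.keys m \<subseteq> {0}")
    case True
    then show ?thesis by (simp add: planar_limit_eq free_energy_poly_def planar_disk_nonneg)
  next
    case False
    define n where "n = Max (Poly_Mapping.keys m)"
    define k where "k = n * Poly_Mapping.lookup m n"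
    have n: "n \<in> Poly_Mapping.keys m" "n \<noteq> 0" using Max_keys[OF False] by (auto simp: n_def)
    have eq: "planar_limit m = planar_disk n (m - unit_midx n) / of_nat k"
      using False by (simp add: planar_limit_eq free_energy_poly_def planar_disk_def k_def n_def Let_def)
    have "k \<ge> 1" using n by (simp add: k_def in_keys_iff)
    then have "planar_disk n (m - unit_midx n) / of_nat k \<le> planar_disk n (m - unit_midx n) / 1"
      by (intro divide_left_mono planar_disk_nonneg) auto
    also have "\<dots> \<le> (\<Sum>p\<in>Poly_Mapping.keys m - {0}. planar_disk p (m - unit_midx p))"
      unfolding div_by_1 using n by (intro member_le_sum[where f = "\<lambda>p. planar_disk p (m - unit_midx p)"]) (auto simp: planar_disk_nonneg)
    also have "\<dots> \<le> planar_disk 2 m"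
      by (subst planar_disk_rec[of 2])
         (auto intro!: sum_nonneg mult_nonneg_nonneg planar_disk_nonneg)
    finally show ?thesis unfolding eq using planar_disk_nonneg by simp
  qed
  then show "0 \<le> planar_limit m" "planar_limit m \<le> planar_disk 2 m" by simp_all
qed

section \<open>Supersolutions of Tutte's recursion\<close>

definition rmonom :: "(nat \<Rightarrow> real) \<Rightarrow> midx \<Rightarrow> real" where
  "rmonom b m = (\<Prod>n\<in>Poly_Mapping.keys m. b n ^ Poly_Mapping.lookup m n)"

lemma rmonom_eq_prod:
  assumes "finite S" "Poly_Mapping.keys m \<subseteq> S"
  shows "rmonom b m = (\<Prod>n\<in>S. b n ^ Poly_Mapping.lookup m n)"
  unfolding rmonom_def using assms by (intro prod.mono_neutral_left) (auto simp: in_keys_iff)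

lemma rmonom_add: "rmonom b (p + q) = rmonom b p * rmonom b q"
proof -
  let ?S = "Poly_Mapping.keys p \<union> Poly_Mapping.keys q"
  have "rmonom b (p + q) = (\<Prod>n\<in>?S. b n ^ Poly_Mapping.lookup (p + q) n)"
    by (rule rmonom_eq_prod) (auto simp: keys_midx_add)
  also have "\<dots> = rmonom b p * rmonom b q"
    by (subst (1 2) rmonom_eq_prod[where S = ?S]) (auto simp: lookup_add prod.distrib power_add)
  finally show ?thesis .
qed

lemma rmonom_0 [simp]: "rmonom b 0 = 1"
  by (simp add: rmonom_def)

lemma rmonom_diff_unit:
  assumes "p \<in> Poly_Mapping.keys m"
  shows "rmonom b m = b p * rmonom b (m - unit_midx p)"
  using rmonom_add[of b "m - unit_midx p" "unit_midx p"] midx_add_diff_unit[OF assms]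
  by (simp add: rmonom_def[of _ "unit_midx p"] lookup_unit_midx)

lemma rmonom_nonneg: "(\<And>n. b n \<ge> 0) \<Longrightarrow> rmonom b m \<ge> 0"
  unfolding rmonom_def by (intro prod_nonneg) auto

text \<open>Testing finite sets \<open>P\<close> avoids any summability condition; finitely many
  monomials involve only finitely many variables.\<close>

definition tutte_supersolution :: "(nat \<Rightarrow> real) \<Rightarrow> (nat \<Rightarrow> real) \<Rightarrow> bool" where
  "tutte_supersolution b h \<longleftrightarrow> (\<forall>n. h n \<ge> 0) \<and> h 0 \<ge> 1 \<and>
     (\<forall>n\<ge>1. \<forall>P. finite P \<longrightarrow> P \<subseteq> {1..} \<longrightarrow>
        (\<Sum>s<n - 1. h s * h (n - 2 - s)) + (\<Sum>p\<in>P. b p * h (n + p - 2)) \<le> h n)"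

text \<open>All terms of the recursion are nonnegative, so finite partial sums may be enlarged until
  the recursion for V_n turns into the inequality for \<open>h\<close>.\<close>

lemma planar_disk_le_supersolution:
  assumes b: "\<And>n. b n \<ge> 0" and h: "tutte_supersolution b h"
    and "finite A"
  shows "(\<Sum>m\<in>A. of_rat (planar_disk n m) * rmonom b m) \<le> h n"
proof -
  define f where "f n m = of_rat (planar_disk n m) * rmonom b m" for n m
  have f_nonneg: "f n m \<ge> 0" for n m
    by (simp add: f_def planar_disk_nonneg rmonom_nonneg b)
  \<comment> \<open>The induction is on a common bound \<open>K\<close> for the measure over all of
    \<open>A\<close>, since the recursion replaces \<open>A\<close> by other finite sets.\<close>
  have "(\<Sum>m\<in>A. f n m) \<le> h n" if "finite A" "\<And>m. m \<in> A \<Longrightarrow> n + wdeg m < K" for A n K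
    using that
  proof (induction K arbitrary: A n)
    case 0
    then have "A = {}" by auto
    then show ?case using h by (simp add: tutte_supersolution_def)
  next
    case (Suc K)
    show ?case
    proof (cases "n = 0")
      case True
      have "(\<Sum>m\<in>A. f n m) = (\<Sum>m\<in>A \<inter> {0}. f n m)"
        using Suc.prems(1) True by (intro sum.mono_neutral_right) (auto simp: f_def planar_disk_0)
      also have "\<dots> \<le> (\<Sum>m\<in>{0}. f n m)" by (rule sum_mono2) (auto simp: f_nonneg)
      also have "\<dots> = 1" using True by (simp add: f_def planar_disk_0)
      also have "\<dots> \<le> h n" using h True by (simp add: tutte_supersolution_def)
      finally show ?thesis .
    next
      case False
      let ?S = "\<lambda>m. {(p :: midx, q). p + q = m}"
      define B where "B = (\<Union>m\<in>A. fst ` ?S m \<union> snd ` ?S m)"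
      have B: "finite B" using Suc.prems(1) by (auto simp: B_def finite_midx_splits)
      have wB: "\<exists>m\<in>A. wdeg p \<le> wdeg m" if pB: "p \<in> B" for p
      proof -
        obtain m z where z: "m \<in> A" "z \<in> ?S m" "p = fst z \<or> p = snd z"
          using pB unfolding B_def by blast
        then have "wdeg m = wdeg (fst z) + wdeg (snd z)" using wdeg_add[of "fst z" "snd z"] by auto
        then show ?thesis using z by (intro bexI[of _ m]) auto
      qed
      define P where "P = (\<Union>m\<in>A. Poly_Mapping.keys m - {0})"
      have P: "finite P" "P \<subseteq> {1..}" using Suc.prems(1) by (auto simp: P_def Suc_le_eq)
      define C where "C p = (\<lambda>m. m - unit_midx p) ` {m \<in> A. p \<in> Poly_Mapping.keys m}" for p
      have rec: "f n m = (\<Sum>s<n - 1. \<Sum>(p, q)\<in>?S m. f s p * f (n - 2 - s) q) +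
          (\<Sum>p\<in>Poly_Mapping.keys m - {0}. b p * f (n + p - 2) (m - unit_midx p))" for m
      proof -
        have "of_rat (planar_disk n m) * rmonom b m =
          (\<Sum>s<n - 1. \<Sum>y\<in>?S m. of_rat (planar_disk s (fst y)) * of_rat (planar_disk (n - 2 - s) (snd y)) * rmonom b m) +
          (\<Sum>p\<in>Poly_Mapping.keys m - {0}. of_rat (planar_disk (n + p - 2) (m - unit_midx p)) * rmonom b m)"
          using False by (simp add: planar_disk_rec[of n] of_rat_add of_rat_sum of_rat_mult
              distrib_right sum_distrib_right case_prod_unfold)
        also have "(\<Sum>s<n - 1. \<Sum>y\<in>?S m. of_rat (planar_disk s (fst y)) * of_rat (planar_disk (n - 2 - s) (snd y)) * rmonom b m) =
            (\<Sum>s<n - 1. \<Sum>(p, q)\<in>?S m. f s p * f (n - 2 - s) q)"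
          by (intro sum.cong refl) (auto simp: f_def rmonom_add mult_ac)
        also have "(\<Sum>p\<in>Poly_Mapping.keys m - {0}. of_rat (planar_disk (n + p - 2) (m - unit_midx p)) * rmonom b m) =
            (\<Sum>p\<in>Poly_Mapping.keys m - {0}. b p * f (n + p - 2) (m - unit_midx p))"
          by (intro sum.cong refl) (simp add: f_def rmonom_diff_unit[of _ m] mult_ac)
        finally show ?thesis by (simp add: f_def)
      qed
      \<comment> \<open>The pairs that sum to an element of \<open>A\<close> all lie in
        \<open>B \<times> B\<close>; over that product the sum factorises, and the induction
        hypothesis bounds both factors.\<close>
      have split: "(\<Sum>m\<in>A. \<Sum>(p, q)\<in>?S m. f s p * f (n - 2 - s) q) \<le> h s * h (n - 2 - s)" if s: "s < n - 1" for s
      proof -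
        have "(\<Sum>m\<in>A. \<Sum>(p, q)\<in>?S m. f s p * f (n - 2 - s) q) =
            (\<Sum>(p, q)\<in>(\<Union>m\<in>A. ?S m). f s p * f (n - 2 - s) q)"
          using Suc.prems(1) finite_midx_splits by (intro sum.UNION_disjoint[symmetric]) auto
        also have "\<dots> \<le> (\<Sum>(p, q)\<in>B \<times> B. f s p * f (n - 2 - s) q)"
          using B by (intro sum_mono2) (auto simp: B_def f_nonneg image_iff)
        also have "\<dots> = (\<Sum>p\<in>B. f s p) * (\<Sum>q\<in>B. f (n - 2 - s) q)"
          by (simp add: sum_product sum.cartesian_product)
        also have "\<dots> \<le> h s * h (n - 2 - s)"
        proof (intro mult_mono Suc.IH sum_nonneg f_nonneg B)
          show "0 \<le> h s" using h by (simp add: tutte_supersolution_def)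
        next
          fix p assume "p \<in> B"
          then obtain m where m: "m \<in> A" "wdeg p \<le> wdeg m" using wB by blast
          then have "n + wdeg m < Suc K" using Suc.prems(2) by blast
          then show "s + wdeg p < K" "n - 2 - s + wdeg p < K" using m s by auto
        qed
        finally show ?thesis .
      qed
      \<comment> \<open>Taking a unit off is injective on monomials containing \<open>p\<close>, so
        this is again a sum over a finite set of monomials.\<close>
      have shift: "(\<Sum>m\<in>{m \<in> A. p \<in> Poly_Mapping.keys m}. f (n + p - 2) (m - unit_midx p)) \<le> h (n + p - 2)"
        if p: "p \<in> P" for p
      proof -
        have "inj_on (\<lambda>m. m - unit_midx p) {m \<in> A. p \<in> Poly_Mapping.keys m}"
          by (rule inj_onI) (metis (mono_tags, lifting) mem_Collect_eq midx_add_diff_unit)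
        then have "(\<Sum>m\<in>{m \<in> A. p \<in> Poly_Mapping.keys m}. f (n + p - 2) (m - unit_midx p)) = (\<Sum>m\<in>C p. f (n + p - 2) m)"
          by (simp add: C_def sum.reindex)
        also have "\<dots> \<le> h (n + p - 2)"
        proof (rule Suc.IH)
          show "finite (C p)" using Suc.prems(1) by (simp add: C_def)
          fix q assume "q \<in> C p"
          then obtain m where m: "m \<in> A" "p \<in> Poly_Mapping.keys m" "q = m - unit_midx p" by (auto simp: C_def)
          then have "wdeg q + p = wdeg m" "n + wdeg m < Suc K" using wdeg_diff_unit Suc.prems(2) by auto
          then show "n + p - 2 + wdeg q < K" using False p P by auto
        qed
        finally show ?thesis .
      qed
      have "(\<Sum>m\<in>A. f n m) = (\<Sum>s<n - 1. \<Sum>m\<in>A. \<Sum>(p, q)\<in>?S m. f s p * f (n - 2 - s) q) +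
          (\<Sum>m\<in>A. \<Sum>p\<in>Poly_Mapping.keys m - {0}. b p * f (n + p - 2) (m - unit_midx p))"
        unfolding rec sum.distrib by (subst sum.swap) (rule refl)
      also have "(\<Sum>m\<in>A. \<Sum>p\<in>Poly_Mapping.keys m - {0}. b p * f (n + p - 2) (m - unit_midx p)) =
          (\<Sum>m\<in>A. \<Sum>p\<in>P. if p \<in> Poly_Mapping.keys m then b p * f (n + p - 2) (m - unit_midx p) else 0)"
        using P by (intro sum.cong refl sum.mono_neutral_cong_left) (auto simp: P_def)
      also have "\<dots> = (\<Sum>p\<in>P. b p * (\<Sum>m\<in>{m \<in> A. p \<in> Poly_Mapping.keys m}. f (n + p - 2) (m - unit_midx p)))"
        using Suc.prems(1) by (subst sum.swap) (auto simp: sum_distrib_left sum.inter_filter intro!: sum.cong)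
      also have "(\<Sum>s<n - 1. \<Sum>m\<in>A. \<Sum>(p, q)\<in>?S m. f s p * f (n - 2 - s) q) + \<dots> \<le>
          (\<Sum>s<n - 1. h s * h (n - 2 - s)) + (\<Sum>p\<in>P. b p * h (n + p - 2))"
        by (intro add_mono sum_mono mult_left_mono split shift b) auto
      also have "\<dots> \<le> h n"
        using h False P by (simp add: tutte_supersolution_def)
      finally show ?thesis .
    qed
  qed
  note * = this[OF assms(3), of n "Suc (n + Max (wdeg ` A))"]
  have "n + wdeg m < Suc (n + Max (wdeg ` A))" if "m \<in> A" for m
    using that assms(3) by (simp add: less_Suc_eq_le)
  then show ?thesis using * by (simp add: f_def)
qed

lemma of_real_of_rat: "complex_of_real (of_rat q) = of_rat q"
  by (cases q) (simp add: of_rat_rat)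

text \<open>\<open>F\<close> is any series below the planar limit, to cover the even case too. The
  monomials are compared only on the support of \<open>F\<close>, so \<open>b\<close> may vanish at
  indices that do not occur there.\<close>

theorem planar_limit_abs_convergent:
  assumes h: "tutte_supersolution b h" and b: "\<And>n. b n \<ge> 0"
    and F: "\<And>m. \<bar>F m\<bar> \<le> planar_limit m"
    and a: "\<And>m. F m \<noteq> 0 \<Longrightarrow> cmod (monom_at a m) \<le> rmonom b m"
  shows "abs_convergent_at (rat_mps F) a"
  unfolding abs_convergent_at_def
proof (rule nonneg_bdd_above_summable_on)
  show "bdd_above (sum (\<lambda>m. cmod (rat_mps F m * monom_at a m)) ` {A. A \<subseteq> UNIV \<and> finite A})"
  proof (rule bdd_aboveI2)
    fix A :: "midx set" assume "A \<in> {A. A \<subseteq> UNIV \<and> finite A}"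
    then have A: "finite A" by simp
    have "cmod (rat_mps F m * monom_at a m) \<le> of_rat (planar_disk 2 m) * rmonom b m" for m
    proof (cases "F m = 0")
      case True
      then show ?thesis by (simp add: rat_mps_def planar_disk_nonneg rmonom_nonneg b)
    next
      case False
      have "cmod (rat_mps F m) = \<bar>of_rat (F m)\<bar>"
        unfolding rat_mps_def by (metis norm_of_real of_real_of_rat)
      also have "\<dots> = of_rat \<bar>F m\<bar>" by simp
      also have "\<dots> \<le> of_rat (planar_disk 2 m)"
        using F[of m] planar_limit_bounds(2)[of m] by (simp only: of_rat_less_eq)
      finally show ?thesis
        unfolding norm_mult using a[OF False] by (intro mult_mono) (auto simp: planar_disk_nonneg)
    qed
    then have "(\<Sum>m\<in>A. cmod (rat_mps F m * monom_at a m)) \<le> (\<Sum>m\<in>A. of_rat (planar_disk 2 m) * rmonom b m)"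
      by (rule sum_mono)
    also have "\<dots> \<le> h 2" by (rule planar_disk_le_supersolution[OF b h A])
    finally show "(\<Sum>m\<in>A. cmod (rat_mps F m * monom_at a m)) \<le> h 2" .
  qed
qed simp

section \<open>The critical solutions\<close>

text \<open>By the recursion the remainder is \<open>K * c (n + s)\<close> minus a term of a Cauchy
  product, and both tend to 0. Since it decreases to this limit, it is nonnegative
  throughout.\<close>

lemma remainder_nonneg:
  fixes c :: "nat \<Rightarrow> real"
  assumes c: "\<And>n. c n \<ge> 0" "summable c"
    and rec: "\<And>n. K * c (n + s) = (\<Sum>i\<le>n. c i * c (n - i)) + (S - (\<Sum>i\<le>n. c i))"
  shows "(\<Sum>i\<le>n. c i) \<le> S"
proof -
  have nc: "summable (\<lambda>n. norm (c n))" using c by simp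
  have "(\<lambda>n. \<Sum>i\<le>n. c i * c (n - i)) \<longlonglongrightarrow> 0"
    by (rule summable_LIMSEQ_zero, rule summable_Cauchy_product[OF nc nc])
  moreover have "(\<lambda>n. K * c (n + s)) \<longlonglongrightarrow> K * 0"
    by (intro tendsto_mult_left LIMSEQ_ignore_initial_segment summable_LIMSEQ_zero c)
  ultimately have "(\<lambda>n. K * c (n + s) - (\<Sum>i\<le>n. c i * c (n - i))) \<longlonglongrightarrow> K * 0 - 0"
    by (intro tendsto_diff)
  then have "(\<lambda>n. S - (\<Sum>i\<le>n. c i)) \<longlonglongrightarrow> 0"
    by (simp add: rec)
  moreover have "decseq (\<lambda>n. S - (\<Sum>i\<le>n. c i))"
    by (intro decseq_SucI) (simp add: c)
  ultimately have "0 \<le> S - (\<Sum>i\<le>n. c i)" by (rule decseq_ge[rotated])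
  then show ?thesis by simp
qed

text \<open>Compare lowest terms: if \<open>T\<close> starts in degree \<open>d > 0\<close>, the
  left side starts in degree \<open>d - 1\<close> and the right side no earlier than
  \<open>d\<close>.\<close>

lemma fps_linear_ode_unique:
  fixes A B T :: "real fps"
  assumes "A * fps_deriv T = B * T" "fps_nth A 0 \<noteq> 0" "fps_nth T 0 = 0"
  shows "T = 0"
proof (rule ccontr)
  assume T: "T \<noteq> 0"
  define d where "d = subdegree T"
  have d: "fps_nth T d \<noteq> 0" unfolding d_def by (rule nth_subdegree_nonzero[OF T])
  have d': "fps_nth T i = 0" if "i < d" for i
    using that unfolding d_def by (rule nth_less_subdegree_zero)
  then obtain k where k: "d = Suc k" using assms(3) d by (cases d) auto
  have "fps_nth (A * fps_deriv T) k = (\<Sum>i\<in>{0..k}. fps_nth A i * fps_nth (fps_deriv T) (k - i))"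
    by (rule fps_mult_nth)
  also have "\<dots> = (\<Sum>i\<in>{0}. fps_nth A i * fps_nth (fps_deriv T) (k - i))"
    using d' k by (intro sum.mono_neutral_right) auto
  also have "\<dots> = fps_nth A 0 * (of_nat d * fps_nth T d)" by (simp add: k del: of_nat_Suc)
  finally have "fps_nth (A * fps_deriv T) k \<noteq> 0" using assms(2) d k by simp
  moreover have "fps_nth (B * T) k = 0" unfolding fps_mult_nth using d' k by (intro sum.neutral) auto
  ultimately show False using assms(1) by simp
qed

text \<open>The square fixes the sum of \<open>e\<close> up to its sign; positivity of the tail selects \<open>v\<close>.\<close>

lemma tail_sums:
  fixes e :: "nat \<Rightarrow> real"
  assumes e: "\<And>n. n \<ge> k \<Longrightarrow> 0 \<le> e n" "\<And>n. n \<ge> k \<Longrightarrow> e n \<le> \<rho> ^ n" "0 < e k"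
    and \<rho>: "0 < \<rho>" "\<rho> < 1"
    and sq: "Abs_fps e * Abs_fps e = fps_of_poly R" "poly R 1 = v\<^sup>2"
    and init: "(\<Sum>i<k. e i) = - v"
  shows "(\<lambda>i. e (i + k)) sums (2 * v)"
proof -
  have "summable (\<lambda>n. norm (e n))"
  proof (rule summable_comparison_test_ev)
    show "\<forall>\<^sub>F n in sequentially. norm (norm (e n)) \<le> \<rho> ^ n"
      using eventually_ge_at_top[of k] by eventually_elim (use e in auto)
    show "summable (\<lambda>n. \<rho> ^ n)" using \<rho> by (simp add: summable_geometric)
  qed
  note s = this summable_norm_cancel[OF this]
  \<comment> \<open>The Cauchy product evaluates the square of the series at 1, so the square root
    function itself never enters.\<close>
  have "(\<lambda>n. \<Sum>i\<le>n. e i * e (n - i)) sums (suminf e * suminf e)"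
    by (rule Cauchy_product_sums[OF s(1) s(1)])
  moreover have "(\<Sum>i\<le>n. e i * e (n - i)) = coeff R n" for n
    using arg_cong[OF sq(1), of "\<lambda>f. fps_nth f n"] by (simp add: fps_mult_nth atLeast0AtMost)
  moreover have "(\<lambda>n. coeff R n) sums (\<Sum>n\<le>degree R. coeff R n)"
    by (rule sums_finite) (auto simp: coeff_eq_0)
  moreover have "(\<Sum>n\<le>degree R. coeff R n) = v\<^sup>2"
    using sq(2) by (simp add: poly_altdef)
  ultimately have "(suminf e)\<^sup>2 = v\<^sup>2"
    by (metis (no_types, lifting) ext power2_eq_square sums_unique2)
  then have pm: "suminf e = v \<or> suminf e = - v" by (simp add: power2_eq_iff)
  have tail: "summable (\<lambda>i. e (i + k))" using s(2) by simp
  have "0 < (suminf (\<lambda>i. e (i + k)))"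
    by (rule suminf_pos2[OF tail, of 0]) (use e in auto)
  moreover have "suminf e = (suminf (\<lambda>i. e (i + k))) + (\<Sum>i<k. e i)"
    by (rule suminf_split_initial_segment[OF s(2)])
  ultimately have "(suminf (\<lambda>i. e (i + k))) = 2 * v" using init pm by auto
  then show ?thesis using tail by (metis summable_sums)
qed

text \<open>The value of the full sum makes \<open>c n\<close> equal to \<open>a\<close> times the
  tail from \<open>n\<close> on, hence nonnegative and again geometrically small.\<close>

lemma tail_sequence:
  fixes e :: "nat \<Rightarrow> real"
  assumes e: "\<And>n. n \<ge> k \<Longrightarrow> 0 \<le> e n" "\<And>n. n \<ge> k \<Longrightarrow> e n \<le> \<rho> ^ n"
    and \<rho>: "0 < \<rho>" "\<rho> < 1" and a: "a > 0"
    and sums: "(\<lambda>i. e (i + k)) sums (1 / a)"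
  defines "c n \<equiv> 1 - a * (\<Sum>i<n. e (i + k))"
  shows "0 \<le> c n" "summable c"
proof -
  have summable: "summable (\<lambda>i. e (i + k))" using sums by (rule sums_summable)
  have c: "c n = a * (suminf (\<lambda>i. e (i + n + k)))" for n
    using suminf_split_initial_segment[OF summable, of n] sums_unique[OF sums] a
    by (simp add: c_def field_simps)
  have nonneg: "0 \<le> c n" for n
    unfolding c using a e summable_ignore_initial_segment[OF summable, of n]
    by (intro mult_nonneg_nonneg suminf_nonneg) auto
  then show "0 \<le> c n" .
  show "summable c"
  proof (rule summable_comparison_test)
    have "c n \<le> a / (1 - \<rho>) * \<rho> ^ n" for n
    proof -
      have "e (i + n + k) \<le> \<rho> ^ n * \<rho> ^ i" for i
      proof -
        have "e (i + n + k) \<le> \<rho> ^ (i + n + k)" using e by simp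
        also have "\<dots> = \<rho> ^ n * \<rho> ^ i * \<rho> ^ k" by (simp add: power_add mult_ac)
        also have "\<dots> \<le> \<rho> ^ n * \<rho> ^ i * 1" using \<rho> by (intro mult_left_mono) (auto simp: power_le_one)
        finally show ?thesis by simp
      qed
      then have "(suminf (\<lambda>i. e (i + n + k))) \<le> (suminf (\<lambda>i. \<rho> ^ n * \<rho> ^ i))"
        using summable_ignore_initial_segment[OF summable, of n] \<rho>
        by (intro suminf_le) (auto simp: summable_geometric intro: summable_mult)
      also have "\<dots> = \<rho> ^ n / (1 - \<rho>)"
        using \<rho> by (simp add: suminf_mult summable_geometric suminf_geometric)
      finally show ?thesis unfolding c using a mult_left_mono[of _ _ a] by fastforce
    qed
    then show "\<exists>N. \<forall>n\<ge>N. norm (c n) \<le> a / (1 - \<rho>) * \<rho> ^ n" using nonneg by auto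
    show "summable (\<lambda>n. a / (1 - \<rho>) * \<rho> ^ n)" using \<rho> by (simp add: summable_geometric summable_mult)
  qed
qed

text \<open>Partial sums are division by \<open>1 - fps_X\<close>. This removes the remainders from
  the functional equation and leaves a quadratic equation.\<close>

lemma sum_fps_one_minus_X:
  fixes c :: "nat \<Rightarrow> real"
  shows "(1 - fps_X) * Abs_fps (\<lambda>n. S - (\<Sum>i\<le>n. c i)) = fps_const S - Abs_fps c"
proof (rule fps_ext)
  fix n
  show "fps_nth ((1 - fps_X) * Abs_fps (\<lambda>n. S - (\<Sum>i\<le>n. c i))) n = fps_nth (fps_const S - Abs_fps c) n"
    by (cases n) (simp_all add: left_diff_distrib)
qed

text \<open>The coefficients of \<open>(1 - 5 x / 6) powr (3 / 2) * (1 + x / 2) powr (1 / 2)\<close>, by the linear differential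
  equation of this function.\<close>

fun sqrt_coeff :: "nat \<Rightarrow> real" where
  "sqrt_coeff 0 = 1"
| "sqrt_coeff (Suc 0) = - 1"
| "sqrt_coeff (Suc (Suc n)) = (((real n + 1) / 3 - 1) * sqrt_coeff (Suc n) + 5 / 12 * (real n - 2) * sqrt_coeff n) / (real n + 2)"

lemma sqrt_coeff_rec:
  "12 * ((real n + 2) * sqrt_coeff (Suc (Suc n))) = 4 * ((real n - 2) * sqrt_coeff (Suc n)) + 5 * ((real n - 2) * sqrt_coeff n)"
proof -
  have "real n + 2 \<noteq> 0" by linarith
  then show ?thesis by (simp add: field_simps)
qed

declare sqrt_coeff.simps(3) [simp del]

lemma sqrt_coeff_2: "sqrt_coeff 2 = - 1 / 12"
  using sqrt_coeff_rec[of 0] by (simp add: numeral_2_eq_2)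

lemma sqrt_coeff_3: "sqrt_coeff 3 = 4 / 27"
  using sqrt_coeff_rec[of 1] sqrt_coeff_2 by (simp add: numeral_2_eq_2 numeral_3_eq_3)

lemma sqrt_coeff_4: "sqrt_coeff 4 = 0"
  using sqrt_coeff_rec[of 2] by (simp add: numeral_2_eq_2 numeral_eq_Suc)

text \<open>From index 3 on, the recursion has nonnegative coefficients, at most 1/3 and 5/12. The
  rate 5/6 solves t^2 = t / 3 + 5/12; it is the reciprocal of the triple root 6/5 of the
  discriminant.\<close>

lemma sqrt_coeff_bounds: "0 \<le> sqrt_coeff (n + 3) \<and> sqrt_coeff (n + 3) \<le> (5 / 6) ^ (n + 3)"
proof (induction n rule: less_induct)
  case (less n)
  consider "n = 0" | "n = 1" | k where "n = Suc (Suc k)" by (metis One_nat_def old.nat.exhaust)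
  then show ?case
  proof cases
    case 1
    then show ?thesis by (simp add: sqrt_coeff_3 power3_eq_cube)
  next
    case 2
    then show ?thesis by (simp add: sqrt_coeff_4)
  next
    case (3 k)
    define x y where "x = sqrt_coeff (Suc (k + 3))" and "y = sqrt_coeff (k + 3)"
    have "Suc k + 3 = Suc (k + 3)" by simp
    then have xy: "0 \<le> x" "x \<le> (5 / 6) ^ Suc (k + 3)" "0 \<le> y" "y \<le> (5 / 6) ^ (k + 3)"
      using less[of "Suc k"] less[of k] 3 unfolding x_def y_def by (metis less_Suc_eq less_SucI)+
    have n3: "n + 3 = Suc (Suc (k + 3))" using 3 by simp
    then have "12 * ((real k + 5) * sqrt_coeff (n + 3)) = 4 * ((real k + 1) * x) + 5 * ((real k + 1) * y)"
      using sqrt_coeff_rec[of "k + 3"] by (simp only: x_def y_def) (simp add: algebra_simps)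
    moreover have "real k + 5 \<noteq> 0" by linarith
    moreover have "s = u / (3 * d) * x + 5 * u / (12 * d) * y"
      if "d \<noteq> 0" "12 * (d * s) = 4 * (u * x) + 5 * (u * y)" for s u d :: real
      using that by (simp add: field_simps)
    ultimately have eq: "sqrt_coeff (n + 3) = (real k + 1) / (3 * (real k + 5)) * x + 5 * (real k + 1) / (12 * (real k + 5)) * y"
      by blast
    have "(real k + 1) / (3 * (real k + 5)) * x \<le> 1 / 3 * (5 / 6) ^ Suc (k + 3)"
      using xy by (intro mult_mono) (auto simp: divide_simps)
    moreover have "5 * (real k + 1) / (12 * (real k + 5)) * y \<le> 5 / 12 * (5 / 6) ^ (k + 3)"
      using xy by (intro mult_mono) (auto simp: divide_simps)
    moreover have "1 / 3 * (5 / 6) ^ Suc (k + 3) + 5 / 12 * (5 / 6) ^ (k + 3) = (5 / 6 :: real) ^ (n + 3)"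
      unfolding n3 power_Suc by (simp add: algebra_simps)
    moreover have "0 \<le> sqrt_coeff (n + 3)" unfolding eq using xy by simp
    ultimately show ?thesis unfolding eq by simp
  qed
qed

lemma sqrt_fps_square:
  "fps_const 432 * (Abs_fps sqrt_coeff * Abs_fps sqrt_coeff) = (6 - 5 * fps_X) ^ 3 * (2 + fps_X)"
proof -
  define E where "E = Abs_fps sqrt_coeff"
  define R :: "real fps" where "R = (6 - 5 * fps_X) ^ 3 * (2 + fps_X)"
  \<comment> \<open>The factor is \<open>(6 - 5 * fps_X) * (2 + fps_X)\<close>. The right side of
    this equation doubles for \<open>R\<close>, so \<open>432 * (E * E) - R\<close> solves a
    homogeneous linear equation with initial value 0.\<close>
  have ode: "(12 - 4 * fps_X - 5 * fps_X ^ 2) * fps_deriv E = - ((12 + 10 * fps_X) * E)"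
  proof (rule fps_ext)
    fix n
    consider "n = 0" | "n = 1" | k where "n = Suc (Suc k)" by (metis One_nat_def old.nat.exhaust)
    then show "fps_nth ((12 - 4 * fps_X - 5 * fps_X ^ 2) * fps_deriv E) n = fps_nth (- ((12 + 10 * fps_X) * E)) n"
    proof cases
      case (3 k)
      then show ?thesis using sqrt_coeff_rec[of "Suc k"]
        by (simp add: E_def left_diff_distrib distrib_right mult.assoc power2_eq_square numeral_fps_const
            del: of_nat_Suc) (simp add: algebra_simps)
    next
      case 2
      then show ?thesis
        using sqrt_coeff_2 by (simp add: E_def left_diff_distrib distrib_right mult.assoc power2_eq_square numeral_fps_const numeral_2_eq_2)
    qed (simp add: E_def left_diff_distrib distrib_right mult.assoc power2_eq_square numeral_fps_const)
  qed
  have dR: "(12 - 4 * fps_X - 5 * fps_X ^ 2) * fps_deriv R = - (2 * (12 + 10 * fps_X) * R)"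
    unfolding R_def by (simp add: fps_deriv_power' numeral_3_eq_3 algebra_simps power2_eq_square)
  define T where "T = 432 * (E * E) - R"
  have "fps_deriv T = 864 * (E * fps_deriv E) - fps_deriv R"
    unfolding T_def by (simp add: mult.commute)
  \<comment> \<open>Stated for a general factor \<open>a\<close>, so that the polynomial stays
    intact until \<open>ode\<close> and \<open>dR\<close> are inserted.\<close>
  moreover have ring: "a * (864 * (E * fps_deriv E) - fps_deriv R) = 864 * E * (a * fps_deriv E) - a * fps_deriv R" for a
    by (simp add: algebra_simps)
  ultimately have "(12 - 4 * fps_X - 5 * fps_X ^ 2) * fps_deriv T =
      864 * E * ((12 - 4 * fps_X - 5 * fps_X ^ 2) * fps_deriv E) - (12 - 4 * fps_X - 5 * fps_X ^ 2) * fps_deriv R"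
    using ring[of "12 - 4 * fps_X - 5 * fps_X ^ 2"] by (simp only:)
  also have "\<dots> = - (2 * (12 + 10 * fps_X)) * T"
    unfolding ode dR T_def by (simp add: algebra_simps)
  finally have "(12 - 4 * fps_X - 5 * fps_X ^ 2) * fps_deriv T = - (2 * (12 + 10 * fps_X)) * T" .
  then have "T = 0"
    by (rule fps_linear_ode_unique) (simp_all add: T_def R_def E_def power3_eq_cube)
  then show ?thesis by (simp add: T_def R_def E_def numeral_fps_const)
qed

text \<open>The critical solution, scaled: \<open>crit n = h n / sqrt 12 ^ n\<close>.  The value \<open>4 / 3\<close> below is the sum of all
  \<open>crit n\<close>; it is fixed by requiring a triple root of the discriminant.\<close>

definition crit :: "nat \<Rightarrow> real" where
  "crit n = 1 - 6 * (\<Sum>i<n. sqrt_coeff (i + 3))"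

lemma crit_nonneg: "0 \<le> crit n" and summable_crit: "summable crit"
proof -
  have b: "0 \<le> sqrt_coeff n" "sqrt_coeff n \<le> (5 / 6) ^ n" if "n \<ge> 3" for n
    using sqrt_coeff_bounds[of "n - 3"] that by auto
  \<comment> \<open>(6 - 5 x)^3 (2 + x) / 432 multiplied out, as a polynomial that can be evaluated
    at 1.\<close>
  let ?R = "[:1, -2, 5 / 6, 25 / 54, -125 / 432:] :: real poly"
  have "fps_const 432 * fps_of_poly ?R = (6 - 5 * fps_X) ^ 3 * (2 + fps_X)"
  proof -
    have "fps_const 432 * fps_of_poly ?R = fps_of_poly ([:6, -5:] ^ 3 * [:2, 1:])"
      by (simp add: fps_of_poly_smult[symmetric] power3_eq_cube del: fps_of_poly_smult)
    also have "\<dots> = (6 - 5 * fps_X) ^ 3 * (2 + fps_X)"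
      by (simp add: fps_of_poly_mult fps_of_poly_power fps_of_poly_pCons numeral_fps_const fps_const_neg[symmetric] mult.commute del: fps_const_neg)
    finally show ?thesis .
  qed
  then have "fps_const 432 * (Abs_fps sqrt_coeff * Abs_fps sqrt_coeff) = fps_const 432 * fps_of_poly ?R"
    by (simp only: sqrt_fps_square)
  then have sq: "Abs_fps sqrt_coeff * Abs_fps sqrt_coeff = fps_of_poly ?R"
    by simp
  \<comment> \<open>1/12 is the value of the square root at 1. The tail sum 1/6 makes
    \<open>crit\<close> six times a tail of \<open>sqrt_coeff\<close>.\<close>
  have "(\<lambda>i. sqrt_coeff (i + 3)) sums (2 * (1 / 12))"
  proof (rule tail_sums[OF b _ _ _ sq])
    show "poly ?R 1 = (1 / 12)\<^sup>2" by (simp add: power2_eq_square)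
    show "(\<Sum>i<3. sqrt_coeff i) = - (1 / 12)"
      using sqrt_coeff_2 by (simp add: numeral_3_eq_3 numeral_2_eq_2)
  qed (auto simp: sqrt_coeff_3)
  then have sums: "(\<lambda>i. sqrt_coeff (i + 3)) sums (1 / 6)" by simp
  show "0 \<le> crit n" "summable crit"
    using tail_sequence[OF b _ _ _ sums] by (simp_all add: crit_def[abs_def])
qed

text \<open>All is tripled to clear the denominator of 4/3. The linear term is the equation for
  index 1, whose quadratic part is empty and whose sum over p is the whole total.\<close>

lemma crit_fps: "36 * Abs_fps crit = 36 + 4 * fps_X +
    3 * fps_X ^ 2 * (Abs_fps crit ^ 2 + Abs_fps (\<lambda>n. 4 / 3 - (\<Sum>i\<le>n. crit i)))"
proof -
  define C where "C = Abs_fps crit"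
  define E where "E = Abs_fps sqrt_coeff"
  define D where "D = Abs_fps (\<lambda>n. 4 / 3 - (\<Sum>i\<le>n. crit i))"
  define Q where "Q = 2 * fps_X ^ 2 * (1 - fps_X) * C"
  \<comment> \<open>The quadratic formula read backwards: \<open>12 * E\<close> is the square root
    of the discriminant, with the sign that makes \<open>C\<close> a power series.\<close>
  have E: "12 * E = 12 * (1 - fps_X) + fps_X ^ 2 - Q"
  proof (rule fps_ext)
    fix n
    consider "n = 0" | "n = 1" | "n = 2" | k where "n = Suc (Suc (Suc k))"
      by (metis One_nat_def numeral_2_eq_2 old.nat.exhaust)
    then show "fps_nth (12 * E) n = fps_nth (12 * (1 - fps_X) + fps_X ^ 2 - Q) n"
    proof cases
      case (4 k)
      have "crit (Suc k) = crit k - 6 * sqrt_coeff (Suc (Suc (Suc k)))"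
        by (simp add: crit_def numeral_3_eq_3 algebra_simps)
      then show ?thesis using 4
        by (simp add: E_def Q_def C_def power2_eq_square left_diff_distrib right_diff_distrib mult.assoc numeral_fps_const)
    qed (use sqrt_coeff_2 in \<open>simp_all add: E_def Q_def C_def power2_eq_square left_diff_distrib right_diff_distrib mult.assoc
        numeral_fps_const numeral_2_eq_2 crit_def\<close>)
  qed
  have "432 * (E * E) = (6 - 5 * fps_X) ^ 3 * (2 + fps_X)"
    using sqrt_fps_square by (simp add: E_def numeral_fps_const)
  then have "3 * ((12 * (1 - fps_X) + fps_X ^ 2 - Q) ^ 2) = (6 - 5 * fps_X) ^ 3 * (2 + fps_X)"
    unfolding E[symmetric] by (simp add: power2_eq_square algebra_simps)
  \<comment> \<open>Completing the square in \<open>C\<close>.\<close>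
  moreover have "(4 * (x ^ 2 * (1 - x))) * (3 * x ^ 2 * (1 - x) * C ^ 2 - 3 * (12 * (1 - x) + x ^ 2) * C + 36 - 32 * x) =
      3 * ((12 * (1 - x) + x ^ 2 - 2 * x ^ 2 * (1 - x) * C) ^ 2) - (6 - 5 * x) ^ 3 * (2 + x)" for x
    by (simp add: algebra_simps power2_eq_square power3_eq_cube)
  ultimately have "(4 * (fps_X ^ 2 * (1 - fps_X))) * (3 * fps_X ^ 2 * (1 - fps_X) * C ^ 2 - 3 * (12 * (1 - fps_X) + fps_X ^ 2) * C + 36 - 32 * fps_X) = 0"
    unfolding Q_def by simp
  moreover have nz: "(1 - fps_X :: real fps) \<noteq> 0"
    by (metis fps_X_neq_one right_minus_eq)
  ultimately have *: "3 * fps_X ^ 2 * (1 - fps_X) * C ^ 2 - 3 * (12 * (1 - fps_X) + fps_X ^ 2) * C + 36 - 32 * fps_X = 0"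
    by (simp only: mult_eq_0_iff power_not_zero fps_X_neq_zero) simp
  have "(1 - fps_X) * D = fps_const (4 / 3) - C"
    unfolding D_def C_def by (rule sum_fps_one_minus_X)
  then have "fps_const 3 * ((1 - fps_X) * D) = fps_const 3 * (fps_const (4 / 3) - C)" by simp
  then have D: "3 * ((1 - fps_X) * D) = 4 - 3 * C" by (simp add: right_diff_distrib numeral_fps_const)
  have "(1 - x) * (36 + 4 * x + 3 * x ^ 2 * (C ^ 2 + D)) - (1 - x) * (36 * C) =
      (3 * x ^ 2 * (1 - x) * C ^ 2 - 3 * (12 * (1 - x) + x ^ 2) * C + 36 - 32 * x) +
      x ^ 2 * (3 * ((1 - x) * D) - (4 - 3 * C))" for x
    by (simp add: algebra_simps power2_eq_square)
  from this[of fps_X] have "(1 - fps_X) * (36 * C) = (1 - fps_X) * (36 + 4 * fps_X + 3 * fps_X ^ 2 * (C ^ 2 + D))"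
    unfolding * D by simp
  then have "36 * C = 36 + 4 * fps_X + 3 * fps_X ^ 2 * (C ^ 2 + D)"
    using nz by simp
  then show ?thesis by (simp only: C_def D_def)
qed

lemma crit_0: "crit 0 = 1" and crit_1: "crit 1 = 1 / 9"
  by (simp_all add: crit_def sqrt_coeff_3)

lemma crit_rec: "12 * crit (n + 2) = (\<Sum>i\<le>n. crit i * crit (n - i)) + (4 / 3 - (\<Sum>i\<le>n. crit i))"
proof -
  have "fps_nth (36 * Abs_fps crit) (n + 2) = 36 * crit (n + 2)"
    by (simp add: numeral_fps_const)
  moreover have "fps_nth (36 * Abs_fps crit) (n + 2) =
      3 * ((\<Sum>i\<le>n. crit i * crit (n - i)) + (4 / 3 - (\<Sum>i\<le>n. crit i)))"
    unfolding crit_fps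
    by (simp add: numeral_fps_const power2_eq_square mult.assoc fps_mult_nth[of "Abs_fps crit"] atLeast0AtMost)
  ultimately show ?thesis by simp
qed

lemma sum_crit_le: "(\<Sum>i\<le>n. crit i) \<le> 4 / 3"
  by (rule remainder_nonneg[OF crit_nonneg summable_crit crit_rec])

text \<open>The same for even potentials, where the square root is \<open>(1 - 3 x / 4) powr (3 / 2)\<close> and only even
  indices of \<open>h\<close> occur.\<close>

fun sqrt_coeff_even :: "nat \<Rightarrow> real" where
  "sqrt_coeff_even 0 = 1"
| "sqrt_coeff_even (Suc n) = 3 / 4 * (real n - 3 / 2) / (real n + 1) * sqrt_coeff_even n"

lemma sqrt_coeff_even_rec:
  "8 * ((real n + 1) * sqrt_coeff_even (Suc n)) = 6 * (real n * sqrt_coeff_even n) - 9 * sqrt_coeff_even n"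
proof -
  have "real n + 1 \<noteq> 0" by linarith
  then show ?thesis by (simp add: field_simps)
qed

lemma sqrt_coeff_even_1: "sqrt_coeff_even 1 = - 9 / 8"
  and sqrt_coeff_even_2: "sqrt_coeff_even 2 = 27 / 128"
  by (simp_all add: numeral_2_eq_2)

declare sqrt_coeff_even.simps(2) [simp del]

lemma sqrt_coeff_even_bounds: "0 \<le> sqrt_coeff_even (n + 2) \<and> sqrt_coeff_even (n + 2) \<le> (3 / 4) ^ (n + 2)"
proof (induction n)
  case 0
  then show ?case using sqrt_coeff_even_2 by (simp add: numeral_2_eq_2)
next
  case (Suc n)
  define q where "q = (real (n + 2) - 3 / 2) / (real (n + 2) + 1)"
  have q: "0 \<le> q" "q \<le> 1" by (auto simp: q_def divide_simps)
  have "sqrt_coeff_even (Suc n + 2) = 3 / 4 * (q * sqrt_coeff_even (n + 2))"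
    by (simp add: sqrt_coeff_even.simps(2)[of "n + 2", simplified] q_def)
  moreover have "q * sqrt_coeff_even (n + 2) \<le> 1 * (3 / 4) ^ (n + 2)"
    using Suc q by (intro mult_mono) auto
  moreover have "0 \<le> q * sqrt_coeff_even (n + 2)" using Suc q by simp
  ultimately show ?case by simp
qed

lemma sqrt_fps_even_square:
  "fps_const 64 * (Abs_fps sqrt_coeff_even * Abs_fps sqrt_coeff_even) = (4 - 3 * fps_X) ^ 3"
proof -
  define E where "E = Abs_fps sqrt_coeff_even"
  define R :: "real fps" where "R = (4 - 3 * fps_X) ^ 3"
  have ode: "(8 - 6 * fps_X) * fps_deriv E = - (9 * E)"
  proof (rule fps_ext)
    fix n
    show "fps_nth ((8 - 6 * fps_X) * fps_deriv E) n = fps_nth (- (9 * E)) n"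
      using sqrt_coeff_even_rec[of n]
      by (cases n) (simp_all add: E_def left_diff_distrib mult.assoc numeral_fps_const add.commute)
  qed
  have dR: "(8 - 6 * fps_X) * fps_deriv R = - (18 * R)"
    unfolding R_def by (simp add: fps_deriv_power' numeral_3_eq_3 algebra_simps power2_eq_square)
  define T where "T = 64 * (E * E) - R"
  have "fps_deriv T = 128 * (E * fps_deriv E) - fps_deriv R"
    unfolding T_def by (simp add: mult.commute)
  moreover have ring: "a * (128 * (E * fps_deriv E) - fps_deriv R) = 128 * E * (a * fps_deriv E) - a * fps_deriv R" for a
    by (simp add: algebra_simps)
  ultimately have "(8 - 6 * fps_X) * fps_deriv T =
      128 * E * ((8 - 6 * fps_X) * fps_deriv E) - (8 - 6 * fps_X) * fps_deriv R"
    using ring[of "8 - 6 * fps_X"] by (simp only:)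
  also have "\<dots> = - 18 * T"
    unfolding ode dR T_def by (simp add: algebra_simps)
  finally have "(8 - 6 * fps_X) * fps_deriv T = - 18 * T" .
  then have "T = 0"
    by (rule fps_linear_ode_unique) (simp_all add: T_def R_def E_def power3_eq_cube)
  then show ?thesis by (simp add: T_def R_def E_def numeral_fps_const)
qed

definition crit_even :: "nat \<Rightarrow> real" where
  "crit_even n = 1 - 4 * (\<Sum>i<n. sqrt_coeff_even (i + 2))"

lemma crit_even_nonneg: "0 \<le> crit_even n" and summable_crit_even: "summable crit_even"
proof -
  have b: "0 \<le> sqrt_coeff_even n" "sqrt_coeff_even n \<le> (3 / 4) ^ n" if "n \<ge> 2" for n
    using sqrt_coeff_even_bounds[of "n - 2"] unfolding le_add_diff_inverse2[OF that] by auto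
  let ?R = "[:1, -9 / 4, 27 / 16, -27 / 64:] :: real poly"
  have "fps_const 64 * fps_of_poly ?R = (4 - 3 * fps_X) ^ 3"
  proof -
    have "fps_const 64 * fps_of_poly ?R = fps_of_poly ([:4, -3:] ^ 3)"
      by (simp add: fps_of_poly_smult[symmetric] power3_eq_cube del: fps_of_poly_smult)
    also have "\<dots> = (4 - 3 * fps_X) ^ 3"
      by (simp add: fps_of_poly_mult fps_of_poly_power fps_of_poly_pCons numeral_fps_const fps_const_neg[symmetric] mult.commute del: fps_const_neg)
    finally show ?thesis .
  qed
  then have "fps_const 64 * (Abs_fps sqrt_coeff_even * Abs_fps sqrt_coeff_even) = fps_const 64 * fps_of_poly ?R"
    by (simp only: sqrt_fps_even_square)
  then have sq: "Abs_fps sqrt_coeff_even * Abs_fps sqrt_coeff_even = fps_of_poly ?R"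
    by simp
  \<comment> \<open>1/8 is the value of the square root at 1, and \<open>crit_even\<close> is four
    times a tail of \<open>sqrt_coeff_even\<close>.\<close>
  have "(\<lambda>i. sqrt_coeff_even (i + 2)) sums (2 * (1 / 8))"
  proof (rule tail_sums[OF b _ _ _ sq])
    show "poly ?R 1 = (1 / 8)\<^sup>2" by (simp add: power2_eq_square)
    show "(\<Sum>i<2. sqrt_coeff_even i) = - (1 / 8)"
      using sqrt_coeff_even_1 by (simp add: numeral_2_eq_2)
  qed (auto simp: sqrt_coeff_even_2)
  then have sums: "(\<lambda>i. sqrt_coeff_even (i + 2)) sums (1 / 4)" by simp
  show "0 \<le> crit_even n" "summable crit_even"
    using tail_sequence[OF b _ _ _ sums] by (simp_all add: crit_even_def[abs_def])
qed

text \<open>\<open>crit_even n\<close> belongs to index \<open>2 * n\<close> of the supersolution,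
  so there is no index-1 equation and no separate linear term.\<close>

lemma crit_even_fps: "8 * Abs_fps crit_even = 8 +
    fps_X * (Abs_fps crit_even ^ 2 + Abs_fps (\<lambda>n. 5 / 4 - (\<Sum>i\<le>n. crit_even i)))"
proof -
  define C where "C = Abs_fps crit_even"
  define E where "E = Abs_fps sqrt_coeff_even"
  define D where "D = Abs_fps (\<lambda>n. 5 / 4 - (\<Sum>i\<le>n. crit_even i))"
  define Q where "Q = 2 * fps_X * (1 - fps_X) * C"
  have E: "8 * E = 8 - 7 * fps_X - Q"
  proof (rule fps_ext)
    fix n
    consider "n = 0" | "n = 1" | k where "n = Suc (Suc k)"
      by (metis One_nat_def old.nat.exhaust)
    then show "fps_nth (8 * E) n = fps_nth (8 - 7 * fps_X - Q) n"
    proof cases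
      case (3 k)
      have "crit_even (Suc k) = crit_even k - 4 * sqrt_coeff_even (Suc (Suc k))"
        by (simp add: crit_even_def numeral_2_eq_2 algebra_simps)
      then show ?thesis using 3
        by (simp add: E_def Q_def C_def left_diff_distrib right_diff_distrib mult.assoc numeral_fps_const)
    qed (use sqrt_coeff_even_1 in \<open>simp_all add: E_def Q_def C_def left_diff_distrib right_diff_distrib mult.assoc
        numeral_fps_const crit_even_def\<close>)
  qed
  have "64 * (E * E) = (4 - 3 * fps_X) ^ 3"
    using sqrt_fps_even_square by (simp add: E_def numeral_fps_const)
  then have "(8 - 7 * fps_X - Q) ^ 2 = (4 - 3 * fps_X) ^ 3"
    unfolding E[symmetric] by (simp add: power2_eq_square algebra_simps)
  moreover have "(x * (1 - x)) * (4 * x * (1 - x) * C ^ 2 - 4 * (8 - 7 * x) * C + 32 - 27 * x) =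
      (8 - 7 * x - 2 * x * (1 - x) * C) ^ 2 - (4 - 3 * x) ^ 3" for x
    by (simp add: algebra_simps power2_eq_square power3_eq_cube)
  ultimately have "(fps_X * (1 - fps_X)) * (4 * fps_X * (1 - fps_X) * C ^ 2 - 4 * (8 - 7 * fps_X) * C + 32 - 27 * fps_X) = 0"
    unfolding Q_def by simp
  moreover have nz: "(1 - fps_X :: real fps) \<noteq> 0"
    by (metis fps_X_neq_one right_minus_eq)
  ultimately have *: "4 * fps_X * (1 - fps_X) * C ^ 2 - 4 * (8 - 7 * fps_X) * C + 32 - 27 * fps_X = 0"
    by (simp only: mult_eq_0_iff fps_X_neq_zero) simp
  have "(1 - fps_X) * D = fps_const (5 / 4) - C"
    unfolding D_def C_def by (rule sum_fps_one_minus_X)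
  then have "fps_const 4 * ((1 - fps_X) * D) = fps_const 4 * (fps_const (5 / 4) - C)" by simp
  then have D: "4 * ((1 - fps_X) * D) = 5 - 4 * C" by (simp add: right_diff_distrib numeral_fps_const)
  have "4 * ((1 - x) * (8 + x * (C ^ 2 + D))) - 4 * ((1 - x) * (8 * C)) =
      (4 * x * (1 - x) * C ^ 2 - 4 * (8 - 7 * x) * C + 32 - 27 * x) +
      x * (4 * ((1 - x) * D) - (5 - 4 * C))" for x
    by (simp add: algebra_simps power2_eq_square)
  from this[of fps_X] have "4 * ((1 - fps_X) * (8 * C)) = 4 * ((1 - fps_X) * (8 + fps_X * (C ^ 2 + D)))"
    unfolding * D by simp
  then have "4 * (1 - fps_X) * (8 * C) = 4 * (1 - fps_X) * (8 + fps_X * (C ^ 2 + D))"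
    by (simp only: mult.assoc)
  moreover have "4 * (1 - fps_X :: real fps) \<noteq> 0" using nz by simp
  ultimately have "8 * C = 8 + fps_X * (C ^ 2 + D)"
    using mult_left_cancel by blast
  then show ?thesis by (simp only: C_def D_def)
qed

lemma crit_even_0: "crit_even 0 = 1"
  by (simp add: crit_even_def)

lemma crit_even_rec:
  "8 * crit_even (n + 1) = (\<Sum>i\<le>n. crit_even i * crit_even (n - i)) + (5 / 4 - (\<Sum>i\<le>n. crit_even i))"
proof -
  have "fps_nth (8 * Abs_fps crit_even) (n + 1) = 8 * crit_even (n + 1)"
    by (simp add: numeral_fps_const)
  moreover have "fps_nth (8 * Abs_fps crit_even) (n + 1) =
      (\<Sum>i\<le>n. crit_even i * crit_even (n - i)) + (5 / 4 - (\<Sum>i\<le>n. crit_even i))"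
    unfolding crit_even_fps
    by (simp add: numeral_fps_const power2_eq_square fps_mult_nth[of "Abs_fps crit_even"] atLeast0AtMost)
  ultimately show ?thesis by simp
qed

lemma sum_crit_even_le: "(\<Sum>i\<le>n. crit_even i) \<le> 5 / 4"
  by (rule remainder_nonneg[OF crit_even_nonneg summable_crit_even crit_even_rec])

text \<open>The indices \<open>k + p\<close> are distinct and exceed \<open>k\<close>, so together
  with \<open>{..k}\<close> they fit into one initial segment.\<close>

lemma sum_shifted_le_remainder:
  fixes c :: "nat \<Rightarrow> real"
  assumes c: "\<And>i. 0 \<le> c i" "\<And>n. (\<Sum>i\<le>n. c i) \<le> S" and P: "finite P" "P \<subseteq> {1..}"
  shows "(\<Sum>p\<in>P. c (k + p)) \<le> S - (\<Sum>i\<le>k. c i)"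
proof -
  have "(\<Sum>p\<in>P. c (k + p)) + (\<Sum>i\<le>k. c i) = (\<Sum>i\<in>(+) k ` P. c i) + (\<Sum>i\<le>k. c i)"
    by (simp add: sum.reindex)
  also have "\<dots> = (\<Sum>i\<in>(+) k ` P \<union> {..k}. c i)"
    using P by (intro sum.union_disjoint[symmetric]) auto
  also have "\<dots> \<le> (\<Sum>i\<le>k + Max (insert 0 P). c i)"
    using P by (intro sum_mono2 c) auto
  also have "\<dots> \<le> S" by (rule c)
  finally show ?thesis by simp
qed

lemma sum_even_indices:
  fixes f :: "nat \<Rightarrow> real"
  assumes "\<And>s. odd s \<Longrightarrow> f s = 0"
  shows "(\<Sum>s<2 * k + 1. f s) = (\<Sum>i\<le>k. f (2 * i))"
  using assms by (induction k) (simp_all add: sum.lessThan_Suc)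

text \<open>Each term carries the same power of sqrt 12, and what remains is
  \<open>crit_rec\<close>. The index 1 is separate, because there \<open>n - 2\<close>
  truncates.\<close>

lemma tutte_supersolution_crit:
  "tutte_supersolution (\<lambda>n. (1 / sqrt 12) ^ n) (\<lambda>n. sqrt 12 ^ n * crit n)"
  unfolding tutte_supersolution_def
proof (intro conjI allI impI)
  fix n show "0 \<le> sqrt 12 ^ n * crit n" by (simp add: crit_nonneg)
next
  show "1 \<le> sqrt 12 ^ 0 * crit 0" by (simp add: crit_0)
next
  fix n :: nat and P :: "nat set"
  assume n: "n \<ge> 1" and P: "finite P" "P \<subseteq> {1..}"
  define y where "y = sqrt 12"
  have y: "y > 0" "y * y = 12" by (simp_all add: y_def)
  show "(\<Sum>s<n - 1. sqrt 12 ^ s * crit s * (sqrt 12 ^ (n - 2 - s) * crit (n - 2 - s))) +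
      (\<Sum>p\<in>P. (1 / sqrt 12) ^ p * (sqrt 12 ^ (n + p - 2) * crit (n + p - 2))) \<le> sqrt 12 ^ n * crit n"
    unfolding y_def[symmetric]
  proof (cases "n = 1")
    case True
    have "(1 / y) ^ p * (y ^ (n + p - 2) * crit (n + p - 2)) = 1 / y * crit (p - 1)" if pP: "p \<in> P" for p
    proof -
      obtain q where "p = Suc q" using pP P by (cases p) auto
      then show ?thesis using True y by (simp add: power_divide)
    qed
    then have "(\<Sum>p\<in>P. (1 / y) ^ p * (y ^ (n + p - 2) * crit (n + p - 2))) = 1 / y * (\<Sum>p\<in>P. crit (p - 1))"
      by (simp add: sum_distrib_left)
    also have "(\<Sum>p\<in>P. crit (p - 1)) = (\<Sum>q\<in>(\<lambda>p. p - 1) ` P. crit q)"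
    proof (intro sum.reindex[symmetric, unfolded o_def] inj_onI)
      fix p q assume "p \<in> P" "q \<in> P" "p - 1 = q - 1"
      moreover from this have "p \<ge> 1" "q \<ge> 1" using P by auto
      ultimately show "p = q" by linarith
    qed
    also have "\<dots> \<le> (\<Sum>q\<le>Max (insert 0 ((\<lambda>p. p - 1) ` P)). crit q)"
      using P by (intro sum_mono2 crit_nonneg) auto
    also have "\<dots> \<le> 4 / 3" by (rule sum_crit_le)
    finally have "(\<Sum>p\<in>P. (1 / y) ^ p * (y ^ (n + p - 2) * crit (n + p - 2))) \<le> 1 / y * (4 / 3)"
      using y by (simp add: divide_right_mono)
    \<comment> \<open>By \<open>y * y = 12\<close>; the value \<open>crit 1 = 1 / 9\<close> is
      exactly what the total 4/3 demands.\<close>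
    also have "1 / y * (4 / 3) = y * (1 / 9)"
      using y by (simp add: field_simps)
    also have "\<dots> = y ^ n * crit n"
      unfolding True crit_1 by (simp only: power_one_right)
    finally show "(\<Sum>s<n - 1. y ^ s * crit s * (y ^ (n - 2 - s) * crit (n - 2 - s))) +
      (\<Sum>p\<in>P. (1 / y) ^ p * (y ^ (n + p - 2) * crit (n + p - 2))) \<le> y ^ n * crit n"
      using True by simp
  next
    case False
    then obtain k where k: "n = k + 2" using n by (metis One_nat_def Suc_le_D add_2_eq_Suc' not0_implies_Suc)
    have "(\<Sum>s<n - 1. y ^ s * crit s * (y ^ (n - 2 - s) * crit (n - 2 - s))) = y ^ k * (\<Sum>s\<le>k. crit s * crit (k - s))"
      unfolding sum_distrib_left k by (intro sum.cong) (auto simp: power_add[symmetric] mult_ac)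
    moreover have "(\<Sum>p\<in>P. (1 / y) ^ p * (y ^ (n + p - 2) * crit (n + p - 2))) = y ^ k * (\<Sum>p\<in>P. crit (k + p))"
      unfolding sum_distrib_left k using y by (intro sum.cong) (auto simp: power_add power_divide)
    moreover have "y ^ n * crit n = y ^ k * (12 * crit (k + 2))"
      using y by (simp add: k power_add power2_eq_square)
    moreover have "(\<Sum>p\<in>P. crit (k + p)) \<le> 4 / 3 - (\<Sum>i\<le>k. crit i)"
      by (rule sum_shifted_le_remainder[OF crit_nonneg sum_crit_le P])
    ultimately show "(\<Sum>s<n - 1. y ^ s * crit s * (y ^ (n - 2 - s) * crit (n - 2 - s))) +
      (\<Sum>p\<in>P. (1 / y) ^ p * (y ^ (n + p - 2) * crit (n + p - 2))) \<le> y ^ n * crit n"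
      using y by (simp only: crit_rec distrib_left[symmetric]) (simp add: mult_left_mono)
  qed
qed

lemma tutte_supersolution_crit_even:
  "tutte_supersolution (\<lambda>n. if even n then (1 / sqrt 8) ^ n else 0)
    (\<lambda>n. if even n then sqrt 8 ^ n * crit_even (n div 2) else 0)"
  (is "tutte_supersolution ?b ?h")
  unfolding tutte_supersolution_def
proof (intro conjI allI impI)
  fix n show "0 \<le> ?h n" by (simp add: crit_even_nonneg)
next
  show "1 \<le> ?h 0" by (simp add: crit_even_0)
next
  fix n :: nat and P :: "nat set"
  assume n: "n \<ge> 1" and P: "finite P" "P \<subseteq> {1..}"
  define y where "y = sqrt 8"
  have y: "y > 0" "y * y = 8" by (simp_all add: y_def)
  show "(\<Sum>s<n - 1. ?h s * ?h (n - 2 - s)) + (\<Sum>p\<in>P. ?b p * ?h (n + p - 2)) \<le> ?h n"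
  proof (cases "odd n")
    case True
    \<comment> \<open>For odd \<open>n\<close> both sides vanish by parity: the two indices add up
      to an odd number, so one of the factors is 0.\<close>
    have 1: "?h s * ?h (n - 2 - s) = 0" if "s < n - 1" for s
    proof -
      have "s + (n - 2 - s) + 2 = n" using that by simp
      then have "odd (s + (n - 2 - s))" using True by (metis even_add even_numeral)
      then show ?thesis by auto
    qed
    have 2: "?b p * ?h (n + p - 2) = 0" if "p \<in> P" for p
    proof -
      have "n + p - 2 + 2 = n + p" using that P n by auto
      then have "even (n + p - 2) \<longleftrightarrow> even (n + p)" by (metis even_add even_numeral)
      then show ?thesis using True by (cases "even p") simp_all
    qed
    have "(\<Sum>s<n - 1. ?h s * ?h (n - 2 - s)) = 0" "(\<Sum>p\<in>P. ?b p * ?h (n + p - 2)) = 0"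
      by (rule sum.neutral, rule ballI, rule 1, simp) (rule sum.neutral, rule ballI, rule 2)
    then show ?thesis using True by (simp only: if_False)
  next
    case False
    then obtain j where "n = 2 * j" by (auto elim: evenE)
    then obtain k where k: "n = 2 * k + 2" using n by (cases j) auto
    have "(\<Sum>s<n - 1. ?h s * ?h (n - 2 - s)) = (\<Sum>s<2 * k + 1. ?h s * ?h (2 * k - s))"
    proof -
      have "n - 1 = 2 * k + 1" "n - 2 = 2 * k" using k by auto
      then show ?thesis by (simp only:)
    qed
    also have "\<dots> = (\<Sum>i\<le>k. ?h (2 * i) * ?h (2 * k - 2 * i))"
      by (rule sum_even_indices) simp
    also have "\<dots> = y ^ (2 * k) * (\<Sum>i\<le>k. crit_even i * crit_even (k - i))"
      unfolding sum_distrib_left y_def[symmetric]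
    proof (rule sum.cong[OF refl])
      fix i assume "i \<in> {..k}"
      then have "2 * k = 2 * i + 2 * (k - i)" "2 * k - 2 * i = 2 * (k - i)" by auto
      then show "(if even (2 * i) then y ^ (2 * i) * crit_even (2 * i div 2) else 0) *
          (if even (2 * k - 2 * i) then y ^ (2 * k - 2 * i) * crit_even ((2 * k - 2 * i) div 2) else 0) =
          y ^ (2 * k) * (crit_even i * crit_even (k - i))"
        by (simp add: power_add[symmetric] mult_ac)
    qed
    finally have 1: "(\<Sum>s<n - 1. ?h s * ?h (n - 2 - s)) = y ^ (2 * k) * (\<Sum>i\<le>k. crit_even i * crit_even (k - i))" .
    define P' where "P' = {q. 2 * q \<in> P}"
    have P': "finite P'" "P' \<subseteq> {1..}"
      using P finite_vimageI[of P "\<lambda>q. 2 * q"] by (auto simp: P'_def vimage_def inj_def)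
    have "(\<Sum>p\<in>P. ?b p * ?h (n + p - 2)) = (\<Sum>p\<in>(\<lambda>q. 2 * q) ` P'. ?b p * ?h (n + p - 2))"
      using P by (intro sum.mono_neutral_right) (auto simp: P'_def elim!: evenE)
    also have "\<dots> = (\<Sum>q\<in>P'. ?b (2 * q) * ?h (n + 2 * q - 2))"
      by (simp add: sum.reindex inj_on_def)
    also have "\<dots> = y ^ (2 * k) * (\<Sum>q\<in>P'. crit_even (k + q))"
      unfolding sum_distrib_left y_def[symmetric] k using y
      by (intro sum.cong) (auto simp: power_add power_divide)
    finally have 2: "(\<Sum>p\<in>P. ?b p * ?h (n + p - 2)) = y ^ (2 * k) * (\<Sum>q\<in>P'. crit_even (k + q))" .
    have 3: "?h n = y ^ (2 * k) * (8 * crit_even (k + 1))"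
      using y by (simp add: k y_def[symmetric] power_add power2_eq_square)
    have "(\<Sum>q\<in>P'. crit_even (k + q)) \<le> 5 / 4 - (\<Sum>i\<le>k. crit_even i)"
      by (rule sum_shifted_le_remainder[OF crit_even_nonneg sum_crit_even_le P'])
    then show ?thesis
      unfolding 1 2 3 crit_even_rec distrib_left[symmetric] using y by simp
  qed
qed

section \<open>Re-expansion of power series\<close>

definition midx_binom :: "midx \<Rightarrow> midx \<Rightarrow> nat" where
  "midx_binom p q = (\<Prod>n\<in>Poly_Mapping.keys (p + q). Poly_Mapping.lookup (p + q) n choose Poly_Mapping.lookup p n)"

lemma monom_at_eq_prod:
  assumes "finite S" "Poly_Mapping.keys m \<subseteq> S"
  shows "monom_at a m = (\<Prod>n\<in>S. a n ^ Poly_Mapping.lookup m n)"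
  unfolding monom_at_def using assms by (intro prod.mono_neutral_left) (auto simp: in_keys_iff)

lemma ex_midx:
  assumes "g \<in> (\<Pi>\<^sub>E n\<in>Poly_Mapping.keys m. {..Poly_Mapping.lookup m n})"
  obtains p where "\<And>n. n \<in> Poly_Mapping.keys m \<Longrightarrow> Poly_Mapping.lookup p n = g n"
    "\<And>n. n \<notin> Poly_Mapping.keys m \<Longrightarrow> Poly_Mapping.lookup p n = 0"
proof -
  let ?f = "\<lambda>n. if n \<in> Poly_Mapping.keys m then g n else 0"
  have "finite {n. ?f n \<noteq> 0}"
    by (rule finite_subset[of _ "Poly_Mapping.keys m"]) auto
  then have "Poly_Mapping.lookup (Abs_poly_mapping ?f) n = ?f n" for n
    by (simp add: lookup_Abs_poly_mapping)
  then show thesis using that[of "Abs_poly_mapping ?f"] by simp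
qed

text \<open>The binomial theorem in each variable, multiplied out: a choice of one exponent per
  variable is the same as a splitting of \<open>m\<close>.\<close>

lemma monom_at_add:
  "monom_at (\<lambda>n. h n + a n) m =
   (\<Sum>(p, q)\<in>{(p, q). p + q = m}. of_nat (midx_binom p q) * monom_at h p * monom_at a q)"
proof -
  let ?K = "Poly_Mapping.keys m"
  let ?l = "Poly_Mapping.lookup m"
  let ?S = "{(p, q). p + q = m}"
  let ?t = "\<lambda>n i. of_nat (?l n choose i) * h n ^ i * a n ^ (?l n - i)"
  let ?\<phi> = "\<lambda>(p :: midx, q :: midx). restrict (Poly_Mapping.lookup p) ?K"
  have "monom_at (\<lambda>n. h n + a n) m = (\<Prod>n\<in>?K. \<Sum>i\<in>{..?l n}. ?t n i)"
    unfolding monom_at_def by (intro prod.cong refl) (rule binomial_ring)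
  also have "\<dots> = (\<Sum>g\<in>Pi\<^sub>E ?K (\<lambda>n. {..?l n}). \<Prod>n\<in>?K. ?t n (g n))"
    by (rule prod_sum_PiE) auto
  also have "\<dots> = (\<Sum>z\<in>?S. \<Prod>n\<in>?K. ?t n (?\<phi> z n))"
  proof (rule sum.reindex_bij_betw[symmetric])
    show "bij_betw ?\<phi> ?S (Pi\<^sub>E ?K (\<lambda>n. {..?l n}))"
      unfolding bij_betw_def
    proof
      show "inj_on ?\<phi> ?S"
      proof (rule inj_onI)
        fix z z' assume z: "z \<in> ?S" "z' \<in> ?S" and eq: "?\<phi> z = ?\<phi> z'"
        obtain p q p' q' where pq: "z = (p, q)" "z' = (p', q')" by fastforce
        have m: "p + q = m" "p' + q' = m" using z pq by auto
        have "p = p'"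
        proof (rule poly_mapping_eqI)
          fix n
          show "Poly_Mapping.lookup p n = Poly_Mapping.lookup p' n"
          proof (cases "n \<in> ?K")
            case True
            then show ?thesis using fun_cong[OF eq, of n] pq by simp
          next
            case False
            then have "n \<notin> Poly_Mapping.keys p" "n \<notin> Poly_Mapping.keys p'"
              using keys_midx_add[of p q] keys_midx_add[of p' q'] m by auto
            then show ?thesis by (simp add: in_keys_iff)
          qed
        qed
        moreover from this have "q = q'" using m by (metis add_left_cancel)
        ultimately show "z = z'" using pq by simp
      qed
      show "?\<phi> ` ?S = Pi\<^sub>E ?K (\<lambda>n. {..?l n})"
      proof
        show "?\<phi> ` ?S \<subseteq> Pi\<^sub>E ?K (\<lambda>n. {..?l n})" by (auto simp: lookup_add)
        show "Pi\<^sub>E ?K (\<lambda>n. {..?l n}) \<subseteq> ?\<phi> ` ?S"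
        proof
          fix g assume g: "g \<in> Pi\<^sub>E ?K (\<lambda>n. {..?l n})"
          from ex_midx[OF this] obtain p where p: "\<And>n. n \<in> ?K \<Longrightarrow> Poly_Mapping.lookup p n = g n"
            "\<And>n. n \<notin> ?K \<Longrightarrow> Poly_Mapping.lookup p n = 0"
            by metis
          have "p + (m - p) = m"
          proof (rule poly_mapping_eqI)
            fix n
            have "Poly_Mapping.lookup p n \<le> ?l n"
              using g p by (cases "n \<in> ?K") (auto simp: PiE_iff)
            then show "Poly_Mapping.lookup (p + (m - p)) n = ?l n"
              by (simp add: lookup_add lookup_minus)
          qed
          moreover have "g = ?\<phi> (p, m - p)"
            using g p by (auto simp: PiE_iff extensional_def restrict_def fun_eq_iff)
          ultimately show "g \<in> ?\<phi> ` ?S" by blast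
        qed
      qed
    qed
  qed
  also have "\<dots> = (\<Sum>(p, q)\<in>?S. of_nat (midx_binom p q) * monom_at h p * monom_at a q)"
  proof (rule sum.cong[OF refl])
    fix z assume "z \<in> ?S"
    then obtain p q where z: "z = (p, q)" and m: "p + q = m" by auto
    have K: "Poly_Mapping.keys p \<subseteq> ?K" "Poly_Mapping.keys q \<subseteq> ?K" using keys_midx_add[of p q] m by auto
    have "?l n - Poly_Mapping.lookup p n = Poly_Mapping.lookup q n" for n
      unfolding m[symmetric] by (simp add: lookup_add)
    then have "(\<Prod>n\<in>?K. ?t n (?\<phi> z n)) = (\<Prod>n\<in>?K. of_nat (?l n choose Poly_Mapping.lookup p n) *
        h n ^ Poly_Mapping.lookup p n * a n ^ Poly_Mapping.lookup q n)"
      by (intro prod.cong) (simp_all add: z)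
    also have "\<dots> = of_nat (midx_binom p q) * monom_at h p * monom_at a q"
      by (simp add: midx_binom_def m monom_at_eq_prod[OF _ K(1)] monom_at_eq_prod[OF _ K(2)] prod.distrib)
    finally show "(\<Prod>n\<in>?K. ?t n (?\<phi> z n)) =
        (case z of (p, q) \<Rightarrow> of_nat (midx_binom p q) * monom_at h p * monom_at a q)"
      by (simp add: z)
  qed
  finally show ?thesis .
qed

lemma norm_monom_at: "cmod (monom_at a m) = monom_at (\<lambda>n. complex_of_real (cmod (a n))) m"
  by (simp add: monom_at_def prod_norm[symmetric] norm_power)

text \<open>The Taylor coefficients of \<open>F\<close> at \<open>a\<close>.\<close>

definition recenter :: "complex mps \<Rightarrow> (nat \<Rightarrow> complex) \<Rightarrow> complex mps" where
  "recenter F a p = infsum (\<lambda>q. F (p + q) * of_nat (midx_binom p q) * monom_at a q) UNIV"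

text \<open>Evaluating the binomial expansion at absolute values shows that the hypothesis is
  absolute summability of the double series over \<open>(p, q)\<close>. That series may then be
  summed along \<open>p + q = m\<close>, giving \<open>F\<close>, or first over \<open>q\<close>,
  giving \<open>recenter F a\<close>.\<close>

theorem recenter_expansion:
  assumes "abs_convergent_at F (\<lambda>n. complex_of_real (cmod (h n) + cmod (a n)))"
  shows "abs_convergent_at (recenter F a) h"
    and "mps_eval F (\<lambda>n. h n + a n) = mps_eval (recenter F a) h"
proof -
  let ?S = "\<lambda>m :: midx. {(p, q). p + q = m}"
  define T where "T = (\<lambda>(p, q). F (p + q) * of_nat (midx_binom p q) * monom_at a q * monom_at h p)"
  have bij: "bij_betw snd (Sigma UNIV ?S) (UNIV \<times> UNIV)"
    by (rule bij_betwI[where g = "\<lambda>(p, q). (p + q, (p, q))"]) auto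
  have fiber: "(\<Sum>z\<in>?S m. norm (T z)) = cmod (F m * monom_at (\<lambda>n. complex_of_real (cmod (h n) + cmod (a n))) m)" for m
  proof -
    have "complex_of_real (\<Sum>z\<in>?S m. norm (T z)) =
        complex_of_real (cmod (F m)) * (\<Sum>(p, q)\<in>?S m. of_nat (midx_binom p q) *
          monom_at (\<lambda>n. complex_of_real (cmod (h n))) p * monom_at (\<lambda>n. complex_of_real (cmod (a n))) q)"
      unfolding of_real_sum sum_distrib_left
      by (intro sum.cong refl) (auto simp: T_def norm_mult norm_monom_at mult_ac)
    also have "\<dots> = complex_of_real (cmod (F m)) * monom_at (\<lambda>n. complex_of_real (cmod (h n)) + complex_of_real (cmod (a n))) m"
      by (simp only: monom_at_add)
    finally have eq: "complex_of_real (\<Sum>z\<in>?S m. norm (T z)) =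
        complex_of_real (cmod (F m)) * monom_at (\<lambda>n. complex_of_real (cmod (h n) + cmod (a n))) m"
      by simp
    have "(\<Sum>z\<in>?S m. norm (T z)) = cmod (complex_of_real (\<Sum>z\<in>?S m. norm (T z)))"
      by (simp add: sum_nonneg del: of_real_sum)
    then show ?thesis unfolding eq by (simp add: norm_mult)
  qed
  have fin: "finite (?S m)" for m by (rule finite_midx_splits)
  have abs: "(\<lambda>z. norm (T (snd z))) summable_on Sigma UNIV ?S"
    unfolding Infinite_Sum.abs_summable_on_Sigma_iff
  proof
    show "\<forall>m\<in>UNIV. (\<lambda>z. norm (T (snd (m, z)))) summable_on ?S m"
      using fin by (simp add: summable_on_finite)
    have "(\<lambda>m. cmod (F m * monom_at (\<lambda>n. complex_of_real (cmod (h n) + cmod (a n))) m)) summable_on UNIV"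
      using assms by (simp only: abs_convergent_at_def)
    then show "(\<lambda>m. norm (\<Sum>\<^sub>\<infinity>z\<in>?S m. norm (T (snd (m, z))))) summable_on UNIV"
      using fin by (simp add: infsum_finite fiber)
  qed
  then have absT: "(\<lambda>z. norm (T z)) summable_on UNIV \<times> UNIV"
    by (simp only: summable_on_reindex_bij_betw[OF bij, of "\<lambda>z. norm (T z)"])
  have sumT: "T summable_on UNIV \<times> UNIV" by (rule abs_summable_summable[OF absT])
  have rec: "recenter F a p * monom_at h p = (\<Sum>\<^sub>\<infinity>q. T (p, q))" for p
    unfolding recenter_def T_def by (simp add: infsum_cmult_left')
  show "abs_convergent_at (recenter F a) h"
    unfolding abs_convergent_at_def rec
  proof (rule Infinite_Sum.abs_summable_on_comparison_test')
    show "(\<lambda>p. \<Sum>\<^sub>\<infinity>q. norm (T (p, q))) summable_on UNIV"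
      using absT unfolding Infinite_Sum.abs_summable_on_Sigma_iff by (simp add: infsum_nonneg)
    fix p :: midx
    show "norm (\<Sum>\<^sub>\<infinity>q. T (p, q)) \<le> (\<Sum>\<^sub>\<infinity>q. norm (T (p, q)))"
      using absT unfolding Infinite_Sum.abs_summable_on_Sigma_iff by (intro norm_infsum_bound) auto
  qed
  have "mps_eval F (\<lambda>n. h n + a n) = (\<Sum>\<^sub>\<infinity>m. \<Sum>\<^sub>\<infinity>z\<in>?S m. T (snd (m, z)))"
    unfolding mps_eval_def
  proof (rule infsum_cong)
    fix m :: midx
    have "F m * monom_at (\<lambda>n. h n + a n) m = (\<Sum>z\<in>?S m. T z)"
      unfolding monom_at_add sum_distrib_left
      by (intro sum.cong refl) (auto simp: T_def mult_ac)
    then show "F m * monom_at (\<lambda>n. h n + a n) m = (\<Sum>\<^sub>\<infinity>z\<in>?S m. T (snd (m, z)))"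
      using fin by (simp add: infsum_finite)
  qed
  also have "\<dots> = (\<Sum>\<^sub>\<infinity>z\<in>Sigma UNIV ?S. T (snd z))"
    by (rule infsum_Sigma_banach[OF abs_summable_summable[OF abs]])
  also have "\<dots> = (\<Sum>\<^sub>\<infinity>z\<in>UNIV \<times> UNIV. T z)"
    by (rule infsum_reindex_bij_betw[OF bij])
  also have "\<dots> = (\<Sum>\<^sub>\<infinity>p. \<Sum>\<^sub>\<infinity>q. T (p, q))"
    by (rule infsum_Sigma_banach[OF sumT, symmetric])
  also have "\<dots> = mps_eval (recenter F a) h"
    unfolding mps_eval_def rec ..
  finally show "mps_eval F (\<lambda>n. h n + a n) = mps_eval (recenter F a) h" .
qed

lemma ell1_diff_norm:
  assumes "r > 0" "a \<in> ell1 r" "b \<in> ell1 r"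
  shows "summable (\<lambda>n. cmod (b n - a n) * r ^ n)"
proof (rule summable_comparison_test')
  show "summable (\<lambda>n. cmod (b n) * r ^ n + cmod (a n) * r ^ n)"
    using assms by (intro summable_add) (auto simp: ell1_def)
  show "norm (cmod (b n - a n) * r ^ n) \<le> cmod (b n) * r ^ n + cmod (a n) * r ^ n" for n
    using assms(1) norm_triangle_ineq4[of "b n" "a n"]
    by (simp add: distrib_right[symmetric] mult_right_mono)
qed

text \<open>\<open>conv\<close> asks only for a bound on each coordinate, which the norm controls; a
  centre \<open>a\<close> therefore has room \<open>1 - ell1_norm r a\<close> around it.\<close>

theorem analytic_series_on_unit_ball:
  assumes r: "r > 0" and U: "U \<subseteq> unit_ball r"
    and conv: "\<And>a. (\<And>n. cmod (a n) * r ^ n \<le> 1) \<Longrightarrow> (\<And>n. (\<forall>u\<in>U. u n = 0) \<Longrightarrow> a n = 0) \<Longrightarrow> abs_convergent_at F a"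
  shows "analytic_series_on r F U"
  unfolding analytic_series_on_def analytic_fun_on_def
proof (intro conjI ballI)
  have ell: "u \<in> ell1 r" "summable (\<lambda>n. cmod (u n) * r ^ n)" "(suminf (\<lambda>n. cmod (u n) * r ^ n)) < 1" if "u \<in> U" for u
    using that U by (auto simp: unit_ball_def ell1_def ell1_norm_def)
  have term_le: "g n \<le> suminf g" if "summable g" "\<And>n. g n \<ge> (0 :: real)" for g n
    using sum_le_suminf[OF that(1), of "{n}"] that(2) by simp
  fix a assume a: "a \<in> U"
  show "abs_convergent_at F a"
  proof (rule conv)
    show "cmod (a n) * r ^ n \<le> 1" for n
      using term_le[OF ell(2)[OF a], of n] ell(3)[OF a] r by simp
  qed (use a in auto)
  show "\<exists>\<delta>>0. \<exists>G. \<forall>b\<in>U. ell1_norm r (\<lambda>n. b n - a n) < \<delta> \<longrightarrow>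
      abs_convergent_at G (\<lambda>n. b n - a n) \<and> mps_eval F b = mps_eval G (\<lambda>n. b n - a n)"
  proof (intro exI[of _ "1 - ell1_norm r a"] exI[of _ "recenter F a"] conjI ballI impI)
    show "0 < 1 - ell1_norm r a" using ell(3)[OF a] by (simp add: ell1_norm_def)
    fix b assume b: "b \<in> U" and less: "ell1_norm r (\<lambda>n. b n - a n) < 1 - ell1_norm r a"
    have "abs_convergent_at F (\<lambda>n. complex_of_real (cmod (b n - a n) + cmod (a n)))"
    proof (rule conv)
      fix n
      have "cmod (b n - a n) * r ^ n \<le> ell1_norm r (\<lambda>n. b n - a n)"
        unfolding ell1_norm_def using r ell1_diff_norm[OF r ell(1)[OF a] ell(1)[OF b]]
        by (intro term_le) auto
      moreover have "cmod (a n) * r ^ n \<le> ell1_norm r a"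
        unfolding ell1_norm_def using r ell(2)[OF a] by (intro term_le) auto
      ultimately have "(cmod (b n - a n) + cmod (a n)) * r ^ n \<le> 1"
        using less by (simp add: distrib_right)
      moreover have "cmod (complex_of_real (cmod (b n - a n) + cmod (a n))) = cmod (b n - a n) + cmod (a n)"
        by (simp only: norm_of_real abs_of_nonneg add_nonneg_nonneg norm_ge_zero)
      ultimately show "cmod (complex_of_real (cmod (b n - a n) + cmod (a n))) * r ^ n \<le> 1"
        by (simp only:)
    next
      fix n assume "\<forall>u\<in>U. u n = 0"
      then have "a n = 0" "b n = 0" using a b by auto
      then show "complex_of_real (cmod (b n - a n) + cmod (a n)) = 0" by simp
    qed
    from recenter_expansion[OF this]
    show "abs_convergent_at (recenter F a) (\<lambda>n. b n - a n)"
      "mps_eval F b = mps_eval (recenter F a) (\<lambda>n. b n - a n)"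
      by simp_all
  qed
qed

section \<open>Convergence and analyticity of the planar limit\<close>

lemma cmod_monom_at_le:
  assumes "\<And>n. n \<in> Poly_Mapping.keys m \<Longrightarrow> cmod (a n) \<le> b n"
  shows "cmod (monom_at a m) \<le> rmonom b m"
  unfolding monom_at_def rmonom_def prod_norm[symmetric] norm_power
  using assms by (intro prod_mono) (auto intro: power_mono)

lemma planar_limit_converges:
  assumes "\<And>n. cmod (a n) * sqrt 12 ^ n \<le> 1"
  shows "abs_convergent_at (rat_mps planar_limit) a"
proof (rule planar_limit_abs_convergent[OF tutte_supersolution_crit])
  show "\<bar>planar_limit m\<bar> \<le> planar_limit m" for m
    using planar_limit_bounds(1)[of m] by simp
  show "cmod (monom_at a m) \<le> rmonom (\<lambda>n. (1 / sqrt 12) ^ n) m" for m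
    using assms by (intro cmod_monom_at_le) (simp add: power_divide pos_le_divide_eq)
qed simp

text \<open>Odd variables occur in no surviving monomial, so the majorant with zero odd part
  applies.\<close>

lemma planar_limit_even_converges:
  assumes "\<And>n. cmod (a n) * sqrt 8 ^ n \<le> 1"
  shows "abs_convergent_at (rat_mps planar_limit_even) a"
proof (rule planar_limit_abs_convergent[OF tutte_supersolution_crit_even])
  show "\<bar>planar_limit_even m\<bar> \<le> planar_limit m" for m
    using planar_limit_bounds(1)[of m] by (simp add: planar_limit_even_def)
  show "cmod (monom_at a m) \<le> rmonom (\<lambda>n. if even n then (1 / sqrt 8) ^ n else 0) m"
    if "planar_limit_even m \<noteq> 0" for m
  proof (rule cmod_monom_at_le)
    fix n assume "n \<in> Poly_Mapping.keys m"
    then have "even n" using that by (auto simp: planar_limit_even_def split: if_splits)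
    then show "cmod (a n) \<le> (if even n then (1 / sqrt 8) ^ n else 0)"
      using assms[of n] by (simp add: power_divide pos_le_divide_eq)
  qed
qed simp

text \<open>A real supremum is informative only over a bounded set; membership in some
  \<open>ell1 r\<close> supplies the bound, whatever \<open>r\<close> is.\<close>

lemma alpha_less_imp:
  assumes r: "r > 0" and a: "a \<in> ell1 r" and y: "y > 0" and less: "alpha a < 1 / y"
  shows "cmod (a n) * y ^ n \<le> 1"
proof (cases "n = 0")
  case True
  then show ?thesis using a by (simp add: ell1_def)
next
  case False
  have s: "summable (\<lambda>n. cmod (a n) * r ^ n)" using a by (simp add: ell1_def)
  define B where "B = max 1 (suminf (\<lambda>n. cmod (a n) * r ^ n))"
  have "bdd_above ((\<lambda>n. root n (cmod (a n))) ` {1..})"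
  proof (rule bdd_aboveI2)
    fix k :: nat assume k: "k \<in> {1..}"
    have "cmod (a k) * r ^ k \<le> B"
      using sum_le_suminf[OF s, of "{k}"] r by (simp add: B_def)
    \<comment> \<open>This is why \<open>B\<close> is taken to be at least 1: the
      \<open>k\<close>-th root of the bound must not depend on \<open>k\<close>.\<close>
    also have "B \<le> B ^ k" using k by (intro self_le_power) (auto simp: B_def)
    finally have "cmod (a k) \<le> (B / r) ^ k" using r by (simp add: power_divide pos_le_divide_eq)
    then have "root k (cmod (a k)) \<le> root k ((B / r) ^ k)" using k by simp
    also have "\<dots> = B / r" using k r by (intro real_root_power_cancel) (auto simp: B_def)
    finally show "root k (cmod (a k)) \<le> B / r" .
  qed
  then have "root n (cmod (a n)) \<le> alpha a"
    unfolding alpha_def using False by (intro cSUP_upper) auto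
  then have "root n (cmod (a n)) ^ n \<le> (1 / y) ^ n"
    using less by (intro power_mono) (auto simp: real_root_ge_zero)
  then show ?thesis using False y by (simp add: power_divide pos_le_divide_eq)
qed

theorem theorem11p1:
  shows "((\<forall>r>0. \<forall>a\<in>ell1_even r. alpha a < 1 / sqrt 8 \<longrightarrow>
             abs_convergent_at (rat_mps planar_limit_even) a) \<and>
          analytic_series_on (sqrt 8) (rat_mps planar_limit_even) (unit_ball_even (sqrt 8))) \<and>
         ((\<forall>r>0. \<forall>a\<in>ell1 r. alpha a < 1 / sqrt 12 \<longrightarrow>
             abs_convergent_at (rat_mps planar_limit) a) \<and>
          analytic_series_on (sqrt 12) (rat_mps planar_limit) (unit_ball (sqrt 12)))"
proof (intro conjI allI ballI impI)
  fix r :: real and a assume "r > 0" "a \<in> ell1_even r" "alpha a < 1 / sqrt 8"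
  then show "abs_convergent_at (rat_mps planar_limit_even) a"
    using alpha_less_imp[of r a "sqrt 8"] by (intro planar_limit_even_converges) (simp add: ell1_even_def)
next
  show "analytic_series_on (sqrt 8) (rat_mps planar_limit_even) (unit_ball_even (sqrt 8))"
    by (rule analytic_series_on_unit_ball)
       (auto simp: unit_ball_even_def unit_ball_def ell1_even_def intro: planar_limit_even_converges)
next
  fix r :: real and a assume "r > 0" "a \<in> ell1 r" "alpha a < 1 / sqrt 12"
  then show "abs_convergent_at (rat_mps planar_limit) a"
    using alpha_less_imp[of r a "sqrt 12"] by (intro planar_limit_converges) simp
next
  show "analytic_series_on (sqrt 12) (rat_mps planar_limit) (unit_ball (sqrt 12))"
    by (rule analytic_series_on_unit_ball) (auto intro: planar_limit_converges)
qed

end
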